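(* Let $(\tau_n)_{n\ge 0}$ be the random recursive tree with doubling events at the root. For all integers $k,n\ge1$, given $\tau_n$, let $u^{(1)}_n,\ldots,u^{(k)}_n$ be $k$ nodes taken uniformly and independently at random in $\tau_n$. Then there is an almost surely finite random variable $V$ such that, for all $k\ge1$, in distribution as $n\to\infty$, $$\left(\frac{|u^{(1)}_n|-\frac{2\log n}{1+\log 2}}{\sqrt{\frac{\log n}{1+\log 2}}},\ldots,\frac{|u^{(k)}_n|-\frac{2\log n}{1+\log 2}}{\sqrt{\frac{\log n}{1+\log 2}}}\right)\Rightarrow (V+W_1,\ldots,V+W_k),$$ where $W_1,\ldots,W_k$ are i.i.d. standard Gaussian random variables, independent of $V$.
   Context: Trees (Ulam--Harris notation): a tree is a set $\tau$ of finite words over the alphabet $\{1,2,3,\ldots\}$ such that every prefix of a word of $\tau$ (including the empty word $\varnothing$, called the root) is in $\tau$. Elements of $\tau$ are called nodes; $|\tau|$ is the number of nodes. For a node $w\in\tau$, $|w|$ denotes its length as a word, called its height. $\log$ is the natural logarithm. The random recursive tree with doubling events $(\tau_n)_{n\ge0}$ is defined by $\tau_0=\{\varnothing\}$ and, for all $n\ge0$, given $\tau_n$ (and the past): pick a node $\nu_n$ uniformly at random among the nodes of $\tau_n$; - if $\nu_n=\varnothing$, set $\tau_{n+1}=\{\varnothing\}\cup\{1w: w\in\tau_n\}\cup\{2w: w\in\tau_n\}$ (a doubling event); - if $\nu_n\ne\varnothing$, set $\tau_{n+1}=\tau_n\cup\{\nu_n j\}$ where $j=\min\{i\ge1:\nu_n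 i\notin\tau_n\}$. *)

theory Defs
  imports "HOL-Probability.Probability"
begin

text \<open>Nodes are words over the positive integers (Ulam--Harris notation); the root is the empty
  word and the height of a node is its length.\<close>

type_synonym node = "nat list"
type_synonym tree = "node set"

text \<open>Note that doubling prepends a letter to every word, while attaching a child to a node
  appends one.\<close>

definition grow :: "tree \<Rightarrow> node \<Rightarrow> tree" where
  "grow t v =
     (if v = [] then {[]} \<union> (\<lambda>w. 1 # w) ` t \<union> (\<lambda>w. 2 # w) ` t
      else t \<union> {v @ [LEAST i. 1 \<le> i \<and> v @ [i] \<notin> t]})"

text \<open>The process \<open>\<tau>\<close> together with the chosen nodes \<open>\<nu>\<close>. Only countably many histories
  have positive probability, so the conditional law of \<open>\<nu> n\<close> given the past is specified by
  elementary conditional probabilities given the individual histories. Such a history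
  determines a finite nonempty tree \<open>t n\<close>, so \<open>pmf_of_set (t n)\<close> really is the uniform
  distribution on its nodes.\<close>

locale doubling_recursive_tree = prob_space M for M :: "'a measure" +
  fixes \<tau> :: "nat \<Rightarrow> 'a \<Rightarrow> tree" and \<nu> :: "nat \<Rightarrow> 'a \<Rightarrow> node"
  assumes nu_measurable: "\<And>n. \<nu> n \<in> measurable M (count_space UNIV)"
    and tau_0: "\<And>\<omega>. \<omega> \<in> space M \<Longrightarrow> \<tau> 0 \<omega> = {[]}"
    and tau_Suc: "\<And>n \<omega>. \<omega> \<in> space M \<Longrightarrow> \<tau> (Suc n) \<omega> = grow (\<tau> n \<omega>) (\<nu> n \<omega>)"
    and nu_uniform:
      "\<And>n (t :: nat \<Rightarrow> tree) (h :: nat \<Rightarrow> node) w.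
         \<P>(\<omega> in M. (\<forall>i\<le>n. \<tau> i \<omega> = t i) \<and> (\<forall>i<n. \<nu> i \<omega> = h i)) > 0 \<Longrightarrow>
         \<P>(\<omega> in M. \<nu> n \<omega> = w \<bar> (\<forall>i\<le>n. \<tau> i \<omega> = t i) \<and> (\<forall>i<n. \<nu> i \<omega> = h i))
           = pmf (pmf_of_set (t n)) w"

text \<open>For fixed \<open>k\<close> and \<open>n\<close>, the nodes \<open>u k n 1, \<dots>, u k n k\<close> are, given \<open>\<tau> n\<close>, independent
  and uniform in \<open>\<tau> n\<close>. Nothing is assumed about the joint law for different \<open>k\<close> or \<open>n\<close>.\<close>

locale sampled_doubling_recursive_tree = doubling_recursive_tree M \<tau> \<nu>
  for M :: "'a measure" and \<tau> \<nu> +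
  fixes u :: "nat \<Rightarrow> nat \<Rightarrow> nat \<Rightarrow> 'a \<Rightarrow> node"
  assumes u_measurable:
      "\<And>k n i. \<lbrakk>1 \<le> k; 1 \<le> n; i \<in> {1..k}\<rbrakk> \<Longrightarrow> u k n i \<in> measurable M (count_space UNIV)"
    and u_uniform:
      "\<And>k n (t :: tree) (w :: nat \<Rightarrow> node).
         \<lbrakk>1 \<le> k; 1 \<le> n; \<P>(\<omega> in M. \<tau> n \<omega> = t) > 0\<rbrakk> \<Longrightarrow>
         \<P>(\<omega> in M. (\<forall>i\<in>{1..k}. u k n i \<omega> = w i) \<bar> \<tau> n \<omega> = t)
           = (\<Prod>i=1..k. pmf (pmf_of_set t) (w i))"

text \<open>Convergence in distribution of random vectors indexed by a finite set \<open>I\<close>, tested against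
  bounded continuous functions. Vectors are elements of \<open>I \<rightarrow>\<^sub>E UNIV\<close>, the carrier of the
  product topology, so that the dimension can vary inside a formula.\<close>

definition converges_in_distribution ::
  "'i set \<Rightarrow> 'a measure \<Rightarrow> (nat \<Rightarrow> 'a \<Rightarrow> 'i \<Rightarrow> real) \<Rightarrow> 'b measure \<Rightarrow> ('b \<Rightarrow> 'i \<Rightarrow> real) \<Rightarrow> bool" where
  "converges_in_distribution I M X N Y \<longleftrightarrow>
     (\<forall>f :: ('i \<Rightarrow> real) \<Rightarrow> real.
        continuous_map (product_topology (\<lambda>_. euclideanreal) I) euclideanreal f \<longrightarrow>
        bounded (f ` (I \<rightarrow>\<^sub>E UNIV)) \<longrightarrow>
        (\<lambda>n. \<integral>\<omega>. f (X n \<omega>) \<partial>M) \<longlonglongrightarrow> (\<integral>\<omega>. f (Y \<omega>) \<partial>N))"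

end

theory Submission
  imports Defs "HOL-Real_Asymp.Real_Asymp"
begin

text \<open>Write \<open>N\<^sub>j\<close> for the size of the tree at time \<open>j\<close>, \<open>P\<close> for the number of doublings up to time
  \<open>n\<close>, and \<open>s = \<Sum>\<^sub>j 1 / N\<^sub>j\<close> for the time on the natural clock of the process, on which doublings occur
  at rate 1. Since \<open>log N\<close> grows by about \<open>1 / N\<close> at an attachment and by about \<open>log 2\<close> at a doubling,
  while \<open>E N\<^sub>n = 2n + 1\<close>, one has \<open>s + P log 2 = log n + O(1)\<close> in mean. A doubling
  raises every height by one, and between doublings the height of a typical node behaves like a Poisson
  process run on the clock \<open>s\<close>: the average of \<open>z^|w|\<close> over the nodes \<open>w\<close> is multiplied by \<open>z\<close> at a doubling and on average
  by about \<open>1 + (z - 1) / N\<close> otherwise, with a fluctuation whose variance is \<open>O(1 / N\<^sup>2)\<close> and hence summable. For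
  \<open>z = exp (i \<theta> / \<surd>\<ell>)\<close> with \<open>\<ell> = log n / (1 + log 2)\<close> this average is therefore close in \<open>L\<^sup>2\<close> to
  \<open>exp (i \<theta> (P + s) / \<surd>\<ell> - \<theta>\<^sup>2 / 2)\<close>. By the relation above, \<open>P + s - 2\<ell>\<close> is, up to \<open>O(1)\<close>,
  \<open>(1 - log 2) / (1 + log 2)\<close> times \<open>P - s\<close>, and \<open>(P - s) / \<surd>\<ell>\<close> is asymptotically standard normal.
  So \<open>V\<close> is a centred Gaussian, coming from the fluctuations of the number of doublings, which all nodes share.\<close>

section \<open>A multivariate continuity theorem\<close>

text \<open>The constant in \<open>\<ell>\<close> comes from a linear system: \<open>P - s\<close>
  is a martingale of order \<open>sqrt (log n)\<close>, so \<open>P\<close> and \<open>s\<close>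
  agree to first order, and the size relation then forces both to be close to \<open>\<ell>\<close>;
  hence the centring \<open>2 \<ell>\<close>. One mechanism controls every error: a doubling has
  conditional probability \<open>1 / N\<close>, so a discrepancy of order \<open>1 / N\<close> there
  costs no more in mean than one of order \<open>1 / N\<^sup>2\<close> at an attachment, and
  \<open>N\<close> exceeds the time for every history. Summable is not yet small, however. The
  comparison of heights therefore starts at a large fixed time \<open>m\<close>, where the tail is
  \<open>O(1 / m)\<close> and all quantities are near 1 as \<open>z\<close> tends to 1; the other
  comparisons carry a factor that vanishes with the angle. For \<open>k\<close> samples, conditional
  independence gives the mean of a product of \<open>k\<close> averages over the same tree: the
  linear parts of the exponents add up to one shared variable, the quadratic parts to separate
  Gaussians. Characteristic functions are turned into distributions one coordinate at a time, by the
  one-dimensional continuity theorem under a reweighted measure.\<close>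

lemma weighted_levy_continuity:
  fixes M :: "'a measure" and N :: "'b measure"
    and w :: "nat \<Rightarrow> 'a \<Rightarrow> real" and w' :: "'b \<Rightarrow> real"
    and X :: "nat \<Rightarrow> 'a \<Rightarrow> real" and X' :: "'b \<Rightarrow> real" and g :: "real \<Rightarrow> real"
  assumes M: "prob_space M" and N: "prob_space N"
    and [measurable]: "\<And>n. X n \<in> borel_measurable M" "X' \<in> borel_measurable N"
      "\<And>n. w n \<in> borel_measurable M" "w' \<in> borel_measurable N"
    and w: "\<And>n \<omega>. 1 \<le> w n \<omega>" "\<And>n \<omega>. w n \<omega> \<le> B"
    and w': "\<And>\<omega>. 1 \<le> w' \<omega>" "\<And>\<omega>. w' \<omega> \<le> B"
    and wconv: "\<And>t. (\<lambda>n. \<integral>\<omega>. of_real (w n \<omega>) * iexp (t * X n \<omega>) \<partial>M) \<longlonglongrightarrow> (\<integral>\<omega>. of_real (w' \<omega>) * iexp (t * X' \<omega>) \<partial>N)"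
    and g: "continuous_on UNIV g" "\<And>x. \<bar>g x\<bar> \<le> C"
  shows "(\<lambda>n. \<integral>\<omega>. w n \<omega> * g (X n \<omega>) \<partial>M) \<longlonglongrightarrow> (\<integral>\<omega>. w' \<omega> * g (X' \<omega>) \<partial>N)"
proof -
  interpret M: prob_space M by fact
  interpret N: prob_space N by fact
  have [measurable]: "g \<in> borel_measurable borel" using g(1) by (rule borel_measurable_continuous_onI)
  have wint [simp]: "integrable M (w n)" for n
    by (rule M.integrable_const_bound[where B = B]) (use w(2)[of n] order_trans[OF zero_le_one w(1)[of n]] in auto)
  have w'int [simp]: "integrable N w'"
    by (rule N.integrable_const_bound[where B = B]) (use w'(2) order_trans[OF zero_le_one w'(1)] in auto)
  define c where "c n = (\<integral>\<omega>. w n \<omega> \<partial>M)" for n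
  define c' where "c' = (\<integral>\<omega>. w' \<omega> \<partial>N)"
  have c: "c n \<ge> 1" for n
    unfolding c_def using integral_mono[of M "\<lambda>_. 1" "w n"] w by (simp add: M.prob_space)
  have c': "c' \<ge> 1"
    unfolding c'_def using integral_mono[of N "\<lambda>_. 1" w'] w' by (simp add: N.prob_space)
  \<comment> \<open>The case \<open>t = 0\<close> of \<open>wconv\<close>. The lower bound 1 on the
    weights keeps the masses away from zero, so normalising is continuous in the limit.\<close>
  have c_conv: "c \<longlonglongrightarrow> c'"
  proof -
    have "(\<lambda>n. of_real (c n) :: complex) \<longlonglongrightarrow> of_real c'"
      using wconv[of 0] by (simp add: c_def[abs_def] c'_def)
    then show ?thesis by (simp only: tendsto_of_real_iff)
  qed
  \<comment> \<open>Under the density \<open>w n / c n\<close> the law of \<open>X n\<close> has the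
    weighted characteristic function divided by its mass, so the ordinary continuity theorem
    applies.\<close>
  define \<mu> where "\<mu> n = distr (density M (\<lambda>\<omega>. ennreal (w n \<omega> / c n))) borel (X n)" for n
  define \<mu>' where "\<mu>' = distr (density N (\<lambda>\<omega>. ennreal (w' \<omega> / c'))) borel X'"
  have pos: "0 \<le> w n \<omega> / c n" "0 \<le> w' \<omega>' / c'" for n \<omega> \<omega>'
    using w(1)[of n \<omega>] c[of n] w'(1)[of \<omega>'] c' by auto
  have int_\<mu>: "(\<integral>x. f x \<partial>\<mu> n) = (\<integral>\<omega>. w n \<omega> *\<^sub>R f (X n \<omega>) \<partial>M) /\<^sub>R c n"
    if [measurable]: "f \<in> borel_measurable borel" for f :: "real \<Rightarrow> 'c::{banach, second_countable_topology}" and n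
    unfolding \<mu>_def using pos c[of n]
    by (simp add: integral_distr integral_density divide_inverse mult.commute scaleR_scaleR[symmetric] del: scaleR_scaleR)
  have int_\<mu>': "(\<integral>x. f x \<partial>\<mu>') = (\<integral>\<omega>. w' \<omega> *\<^sub>R f (X' \<omega>) \<partial>N) /\<^sub>R c'"
    if [measurable]: "f \<in> borel_measurable borel" for f :: "real \<Rightarrow> 'c::{banach, second_countable_topology}"
    unfolding \<mu>'_def using pos c'
    by (simp add: integral_distr integral_density divide_inverse mult.commute scaleR_scaleR[symmetric] del: scaleR_scaleR)
  have prob_\<mu>: "real_distribution (\<mu> n)" for n
  proof -
    have "prob_space (density M (\<lambda>\<omega>. ennreal (w n \<omega> / c n)))"
    proof (rule prob_spaceI)
      have "emeasure (density M (\<lambda>\<omega>. ennreal (w n \<omega> / c n))) (space M) = (\<integral>\<^sup>+\<omega>. ennreal (w n \<omega> / c n) \<partial>M)"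
        by (subst emeasure_density) (auto intro!: nn_integral_cong)
      also have "\<dots> = ennreal (\<integral>\<omega>. w n \<omega> / c n \<partial>M)"
        by (intro nn_integral_eq_integral) (use pos in auto)
      also have "\<dots> = 1" using c[of n] by (simp add: c_def[symmetric])
      finally show "emeasure (density M (\<lambda>\<omega>. ennreal (w n \<omega> / c n))) (space (density M (\<lambda>\<omega>. ennreal (w n \<omega> / c n)))) = 1"
        by simp
    qed
    then interpret P: prob_space "density M (\<lambda>\<omega>. ennreal (w n \<omega> / c n))" .
    show ?thesis unfolding \<mu>_def by (rule P.real_distribution_distr) simp
  qed
  have prob_\<mu>': "real_distribution \<mu>'"
  proof -
    have "prob_space (density N (\<lambda>\<omega>. ennreal (w' \<omega> / c')))"
    proof (rule prob_spaceI)
      have "emeasure (density N (\<lambda>\<omega>. ennreal (w' \<omega> / c'))) (space N) = (\<integral>\<^sup>+\<omega>. ennreal (w' \<omega> / c') \<partial>N)"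
        by (subst emeasure_density) (auto intro!: nn_integral_cong)
      also have "\<dots> = ennreal (\<integral>\<omega>. w' \<omega> / c' \<partial>N)"
        by (intro nn_integral_eq_integral) (use pos in auto)
      also have "\<dots> = 1" using c' by (simp add: c'_def[symmetric])
      finally show "emeasure (density N (\<lambda>\<omega>. ennreal (w' \<omega> / c'))) (space (density N (\<lambda>\<omega>. ennreal (w' \<omega> / c')))) = 1"
        by simp
    qed
    then interpret P: prob_space "density N (\<lambda>\<omega>. ennreal (w' \<omega> / c'))" .
    show ?thesis unfolding \<mu>'_def by (rule P.real_distribution_distr) simp
  qed
  have "weak_conv_m \<mu> \<mu>'"
  proof (rule levy_continuity[OF prob_\<mu> prob_\<mu>'])
    fix t
    have "(\<lambda>n. (\<integral>\<omega>. of_real (w n \<omega>) * iexp (t * X n \<omega>) \<partial>M) /\<^sub>R c n) \<longlonglongrightarrow> (\<integral>\<omega>. of_real (w' \<omega>) * iexp (t * X' \<omega>) \<partial>N) /\<^sub>R c'"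
      using c' by (intro tendsto_intros wconv c_conv) auto
    then show "(\<lambda>n. char (\<mu> n) t) \<longlonglongrightarrow> char \<mu>' t"
      unfolding char_def by (subst int_\<mu>, simp) (subst int_\<mu>', simp, simp add: scaleR_conv_of_real)
  qed
  then have "(\<lambda>n. \<integral>x. g x \<partial>\<mu> n) \<longlonglongrightarrow> (\<integral>x. g x \<partial>\<mu>')"
    using g by (intro weak_conv_imp_integral_bdd_continuous_conv[OF prob_\<mu> prob_\<mu>', where B = C])
      (auto simp: continuous_on_eq_continuous_at)
  then have "(\<lambda>n. c n * (\<integral>x. g x \<partial>\<mu> n)) \<longlonglongrightarrow> c' * (\<integral>x. g x \<partial>\<mu>')"
    by (intro tendsto_intros c_conv)
  moreover have "c n * (\<integral>x. g x \<partial>\<mu> n) = (\<integral>\<omega>. w n \<omega> * g (X n \<omega>) \<partial>M)" for n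
    using c[of n] by (subst int_\<mu>) auto
  moreover have "c' * (\<integral>x. g x \<partial>\<mu>') = (\<integral>\<omega>. w' \<omega> * g (X' \<omega>) \<partial>N)"
    using c' by (subst int_\<mu>') auto
  ultimately show ?thesis by simp
qed

text \<open>Adding a constant to a bounded weight makes it a density up to normalisation. With a weight that is
  a function of other coordinates, this turns a character in one coordinate of a random vector into a general test function.\<close>

lemma levy_continuity_bounded_weight:
  fixes M :: "'a measure" and N :: "'b measure"
    and U :: "nat \<Rightarrow> 'a \<Rightarrow> real" and U' :: "'b \<Rightarrow> real"
    and X :: "nat \<Rightarrow> 'a \<Rightarrow> real" and X' :: "'b \<Rightarrow> real" and g :: "real \<Rightarrow> real"
  assumes M: "prob_space M" and N: "prob_space N"
    and [measurable]: "\<And>n. X n \<in> borel_measurable M" "X' \<in> borel_measurable N"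
      "\<And>n. U n \<in> borel_measurable M" "U' \<in> borel_measurable N"
    and U: "\<And>n \<omega>. \<bar>U n \<omega>\<bar> \<le> B" "\<And>\<omega>. \<bar>U' \<omega>\<bar> \<le> B"
    and conv0: "\<And>t. (\<lambda>n. \<integral>\<omega>. iexp (t * X n \<omega>) \<partial>M) \<longlonglongrightarrow> (\<integral>\<omega>. iexp (t * X' \<omega>) \<partial>N)"
    and conv: "\<And>t. (\<lambda>n. \<integral>\<omega>. of_real (U n \<omega>) * iexp (t * X n \<omega>) \<partial>M) \<longlonglongrightarrow> (\<integral>\<omega>. of_real (U' \<omega>) * iexp (t * X' \<omega>) \<partial>N)"
    and g: "continuous_on UNIV g" "\<And>x. \<bar>g x\<bar> \<le> C"
  shows "(\<lambda>n. \<integral>\<omega>. U n \<omega> * g (X n \<omega>) \<partial>M) \<longlonglongrightarrow> (\<integral>\<omega>. U' \<omega> * g (X' \<omega>) \<partial>N)"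
proof -
  interpret M: prob_space M by fact
  interpret N: prob_space N by fact
  have [measurable]: "g \<in> borel_measurable borel" using g(1) by (rule borel_measurable_continuous_onI)
  have B: "B \<ge> 0" using U(2) order_trans[OF abs_ge_zero] by blast
  have C: "C \<ge> 0" using g(2) order_trans[OF abs_ge_zero] by blast
  have Uint: "integrable M (\<lambda>\<omega>. of_real (U n \<omega>) * iexp (t * X n \<omega>))" for n t
    by (rule M.integrable_const_bound[where B = B]) (use U in \<open>auto simp: norm_mult\<close>)
  have U'int: "integrable N (\<lambda>\<omega>. of_real (U' \<omega>) * iexp (t * X' \<omega>))" for t
    by (rule N.integrable_const_bound[where B = B]) (use U in \<open>auto simp: norm_mult\<close>)
  have eint: "integrable M (\<lambda>\<omega>. iexp (t * X n \<omega>))" for n t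
    by (rule M.integrable_const_bound[where B = 1]) auto
  have e'int: "integrable N (\<lambda>\<omega>. iexp (t * X' \<omega>))" for t
    by (rule N.integrable_const_bound[where B = 1]) auto
  have bound: "\<bar>u * g x\<bar> \<le> B * C" if "\<bar>u\<bar> \<le> B" for u x
    unfolding abs_mult using that g(2) B by (intro mult_mono) auto
  have gint: "integrable M (\<lambda>\<omega>. g (X n \<omega>))" "integrable M (\<lambda>\<omega>. U n \<omega> * g (X n \<omega>))" for n
    by (rule M.integrable_const_bound[where B = C], use g(2) in simp, simp,
        rule M.integrable_const_bound[where B = "B * C"], use bound[OF U(1)] in simp, simp)
  have g'int: "integrable N (\<lambda>\<omega>. g (X' \<omega>))" "integrable N (\<lambda>\<omega>. U' \<omega> * g (X' \<omega>))"
    by (rule N.integrable_const_bound[where B = C], use g(2) in simp, simp,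
        rule N.integrable_const_bound[where B = "B * C"], use bound[OF U(2)] in simp, simp)
  have "(\<lambda>n. \<integral>\<omega>. 1 * g (X n \<omega>) \<partial>M) \<longlonglongrightarrow> (\<integral>\<omega>. 1 * g (X' \<omega>) \<partial>N)"
    by (rule weighted_levy_continuity[OF M N, where X = X and X' = X' and g = g and B = 1 and C = C]) (use conv0 g in auto)
  moreover have "(\<lambda>n. \<integral>\<omega>. (B + 1 + U n \<omega>) * g (X n \<omega>) \<partial>M) \<longlonglongrightarrow> (\<integral>\<omega>. (B + 1 + U' \<omega>) * g (X' \<omega>) \<partial>N)"
  proof (rule weighted_levy_continuity[OF M N, where X = X and X' = X' and g = g and B = "2 * B + 1" and C = C])
    fix t
    have 1: "of_real (B + 1) * (\<integral>\<omega>. iexp (t * X n \<omega>) \<partial>M) + (\<integral>\<omega>. of_real (U n \<omega>) * iexp (t * X n \<omega>) \<partial>M)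
        = (\<integral>\<omega>. of_real (B + 1 + U n \<omega>) * iexp (t * X n \<omega>) \<partial>M)" for n
      unfolding of_real_add[of "B + 1"] distrib_right
      by (subst Bochner_Integration.integral_add) (use Uint eint in auto)
    have 2: "of_real (B + 1) * (\<integral>\<omega>. iexp (t * X' \<omega>) \<partial>N) + (\<integral>\<omega>. of_real (U' \<omega>) * iexp (t * X' \<omega>) \<partial>N)
        = (\<integral>\<omega>. of_real (B + 1 + U' \<omega>) * iexp (t * X' \<omega>) \<partial>N)"
      unfolding of_real_add[of "B + 1"] distrib_right
      by (subst Bochner_Integration.integral_add) (use U'int e'int in auto)
    show "(\<lambda>n. \<integral>\<omega>. of_real (B + 1 + U n \<omega>) * iexp (t * X n \<omega>) \<partial>M)
        \<longlonglongrightarrow> (\<integral>\<omega>. of_real (B + 1 + U' \<omega>) * iexp (t * X' \<omega>) \<partial>N)"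
      unfolding 1[symmetric] 2[symmetric] by (intro tendsto_intros conv0 conv)
  next
    fix n \<omega>
    show "1 \<le> B + 1 + U n \<omega>" "B + 1 + U n \<omega> \<le> 2 * B + 1" using U(1)[of n \<omega>] by (auto simp: abs_le_iff)
  next
    fix \<omega>
    show "1 \<le> B + 1 + U' \<omega>" "B + 1 + U' \<omega> \<le> 2 * B + 1" using U(2)[of \<omega>] by (auto simp: abs_le_iff)
  qed (use g in auto)
  ultimately have "(\<lambda>n. (\<integral>\<omega>. (B + 1 + U n \<omega>) * g (X n \<omega>) \<partial>M) - (B + 1) * (\<integral>\<omega>. 1 * g (X n \<omega>) \<partial>M))
      \<longlonglongrightarrow> (\<integral>\<omega>. (B + 1 + U' \<omega>) * g (X' \<omega>) \<partial>N) - (B + 1) * (\<integral>\<omega>. 1 * g (X' \<omega>) \<partial>N)"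
    by (intro tendsto_intros)
  moreover have "(\<integral>\<omega>. (B + 1 + U n \<omega>) * g (X n \<omega>) \<partial>M) - (B + 1) * (\<integral>\<omega>. 1 * g (X n \<omega>) \<partial>M)
      = (\<integral>\<omega>. U n \<omega> * g (X n \<omega>) \<partial>M)" for n
    unfolding distrib_right[of "B + 1"]
    by (subst Bochner_Integration.integral_add) (use gint in auto)
  moreover have "(\<integral>\<omega>. (B + 1 + U' \<omega>) * g (X' \<omega>) \<partial>N) - (B + 1) * (\<integral>\<omega>. 1 * g (X' \<omega>) \<partial>N)
      = (\<integral>\<omega>. U' \<omega> * g (X' \<omega>) \<partial>N)"
    unfolding distrib_right[of "B + 1"]
    by (subst Bochner_Integration.integral_add) (use g'int in auto)
  ultimately show ?thesis by simp
qed

text \<open>Test functions of an intermediate stage: coordinates in \<open>S\<close> already carry a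
  general function, those in \<open>R\<close> still a character.\<close>

definition mixed_test :: "'j set \<Rightarrow> 'j set \<Rightarrow> ('j \<Rightarrow> real \<Rightarrow> real) \<Rightarrow> ('j \<Rightarrow> real) \<Rightarrow> ('j \<Rightarrow> real) \<Rightarrow> complex" where
  "mixed_test S R g \<theta> x = of_real (\<Prod>j\<in>S. g j (x j)) * iexp (\<Sum>j\<in>R. \<theta> j * x j)"

lemma mixed_test_insert_exp:
  assumes "finite R" "j0 \<notin> R"
  shows "mixed_test S (insert j0 R) g (\<theta>(j0 := t)) x = mixed_test S R g \<theta> x * iexp (t * x j0)"
proof -
  have "(\<Sum>j\<in>R. (\<theta>(j0 := t)) j * x j) = (\<Sum>j\<in>R. \<theta> j * x j)"
    using assms by (intro sum.cong) auto
  then show ?thesis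
    using assms by (simp add: mixed_test_def exp_add[symmetric] algebra_simps)
qed

lemma cnj_mixed_test: "cnj (mixed_test S R g \<theta> x) = mixed_test S R g (\<lambda>j. - \<theta> j) x"
  by (simp add: mixed_test_def exp_cnj sum_negf)

lemma mixed_test_insert_factor:
  assumes "finite S" "j0 \<notin> S"
  shows "mixed_test (insert j0 S) R g \<theta> x = of_real (g j0 (x j0)) * mixed_test S R g \<theta> x"
  using assms by (simp add: mixed_test_def)

lemma norm_mixed_test_le:
  assumes "\<And>j x. \<bar>g j x\<bar> \<le> C j"
  shows "norm (mixed_test S R g \<theta> x) \<le> (\<Prod>j\<in>S. C j)"
  using assms by (auto simp: mixed_test_def norm_mult prod_norm[symmetric] intro!: prod_mono)

text \<open>Induction over the converted coordinates. To convert \<open>i\<close>, everything except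
  the character in coordinate \<open>i\<close> is treated as a bounded weight, split into real and
  imaginary part. These need the conjugate weight too, which the induction hypothesis covers because
  it holds for all \<open>\<theta>\<close>, hence also for \<open>- \<theta>\<close>.\<close>

lemma mixed_test_integral_tendsto:
  fixes M :: "'a measure" and N :: "'b measure"
    and X :: "nat \<Rightarrow> 'a \<Rightarrow> 'j \<Rightarrow> real" and X' :: "'b \<Rightarrow> 'j \<Rightarrow> real"
  assumes M: "prob_space M" and N: "prob_space N" and J: "finite J"
    and [measurable]: "\<And>n j. (\<lambda>\<omega>. X n \<omega> j) \<in> borel_measurable M" "\<And>j. (\<lambda>\<omega>. X' \<omega> j) \<in> borel_measurable N"
    and conv: "\<And>\<theta>. (\<lambda>n. \<integral>\<omega>. iexp (\<Sum>j\<in>J. \<theta> j * X n \<omega> j) \<partial>M) \<longlonglongrightarrow> (\<integral>\<omega>. iexp (\<Sum>j\<in>J. \<theta> j * X' \<omega> j) \<partial>N)"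
    and g: "\<And>j. continuous_on UNIV (g j)" "\<And>j x. \<bar>g j x\<bar> \<le> C j"
    and S: "finite S" "S \<subseteq> J"
  shows "(\<lambda>n. \<integral>\<omega>. mixed_test S (J - S) g \<theta> (X n \<omega>) \<partial>M) \<longlonglongrightarrow> (\<integral>\<omega>. mixed_test S (J - S) g \<theta> (X' \<omega>) \<partial>N)"
  using S
proof (induction S arbitrary: \<theta>)
  case empty
  then show ?case using conv by (simp add: mixed_test_def)
next
  case (insert i S)
  interpret M: prob_space M by fact
  interpret N: prob_space N by fact
  have [measurable]: "g j \<in> borel_measurable borel" for j using g(1) by (rule borel_measurable_continuous_onI)
  have [measurable]: "cnj \<in> borel_measurable borel"
    by (intro borel_measurable_continuous_onI continuous_intros)
  define R where "R = J - insert i S"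
  have R: "finite R" "i \<notin> R" "J - S = insert i R" using J insert by (auto simp: R_def)
  define Y where "Y n \<omega> = mixed_test S R g \<theta> (X n \<omega>)" for n \<omega>
  define Y' where "Y' \<omega> = mixed_test S R g \<theta> (X' \<omega>)" for \<omega>
  define B where "B = (\<Prod>j\<in>S. C j)"
  have C: "C j \<ge> 0" for j using g(2) order_trans[OF abs_ge_zero] by blast
  have B: "B \<ge> 0" using C by (auto simp: B_def intro: prod_nonneg)
  have [measurable]: "Y n \<in> borel_measurable M" "Y' \<in> borel_measurable N" for n
    unfolding Y_def Y'_def mixed_test_def by measurable
  have Yb: "norm (Y n \<omega>) \<le> B" "norm (Y' \<omega>') \<le> B" for n \<omega> \<omega>'
    unfolding Y_def Y'_def B_def using g(2) by (auto intro: norm_mixed_test_le)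
  have Yint: "integrable M (\<lambda>\<omega>. Y n \<omega> * iexp (t * X n \<omega> i))" "integrable M (\<lambda>\<omega>. cnj (Y n \<omega>) * iexp (t * X n \<omega> i))" for n t
    using Yb by (auto intro!: M.integrable_const_bound[where B = B] simp: norm_mult)
  have Y'int: "integrable N (\<lambda>\<omega>. Y' \<omega> * iexp (t * X' \<omega> i))" "integrable N (\<lambda>\<omega>. cnj (Y' \<omega>) * iexp (t * X' \<omega> i))" for t
    using Yb by (auto intro!: N.integrable_const_bound[where B = B] simp: norm_mult)
  have IH: "(\<lambda>n. \<integral>\<omega>. mixed_test S (insert i R) g \<theta>' (X n \<omega>) \<partial>M)
      \<longlonglongrightarrow> (\<integral>\<omega>. mixed_test S (insert i R) g \<theta>' (X' \<omega>) \<partial>N)" for \<theta>'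
    using insert.IH[of \<theta>'] insert.prems R(3) by simp
  have Yconv: "(\<lambda>n. \<integral>\<omega>. Y n \<omega> * iexp (t * X n \<omega> i) \<partial>M) \<longlonglongrightarrow> (\<integral>\<omega>. Y' \<omega> * iexp (t * X' \<omega> i) \<partial>N)" for t
    using IH[of "\<theta>(i := t)"] unfolding mixed_test_insert_exp[OF R(1,2)] Y_def Y'_def .
  have cnjY: "(\<lambda>n. \<integral>\<omega>. cnj (Y n \<omega>) * iexp (t * X n \<omega> i) \<partial>M) \<longlonglongrightarrow> (\<integral>\<omega>. cnj (Y' \<omega>) * iexp (t * X' \<omega> i) \<partial>N)" for t
    using IH[of "(\<lambda>j. - \<theta> j)(i := t)"] unfolding mixed_test_insert_exp[OF R(1,2)] Y_def Y'_def cnj_mixed_test .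
  \<comment> \<open>A frequency vector supported on \<open>i\<close> yields the marginal
    characteristic function.\<close>
  have conv0: "(\<lambda>n. \<integral>\<omega>. iexp (t * X n \<omega> i) \<partial>M) \<longlonglongrightarrow> (\<integral>\<omega>. iexp (t * X' \<omega> i) \<partial>N)" for t
  proof -
    have "(\<Sum>j\<in>J. (if j = i then t else 0) * x j) = t * x i" for x :: "'j \<Rightarrow> real"
      using J insert.prems by (simp add: if_distrib[of "\<lambda>a. a * _"] cong: if_cong)
    then show ?thesis using conv[of "\<lambda>j. if j = i then t else 0"] by simp
  qed
  have Re_eq: "of_real (Re y) * e = (1 / 2) * (y * e + cnj y * e)" for y e :: complex
    unfolding distrib_right[symmetric] complex_add_cnj by simp
  have Im_eq: "of_real (Im y) * e = (- \<i> / 2) * (y * e - cnj y * e)" for y e :: complex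
    unfolding left_diff_distrib[symmetric] complex_diff_cnj by (simp add: complex_eq_iff algebra_simps)
  have Re: "(\<lambda>n. \<integral>\<omega>. Re (Y n \<omega>) * g i (X n \<omega> i) \<partial>M) \<longlonglongrightarrow> (\<integral>\<omega>. Re (Y' \<omega>) * g i (X' \<omega> i) \<partial>N)"
  proof (rule levy_continuity_bounded_weight[OF M N, where X = "\<lambda>n \<omega>. X n \<omega> i" and X' = "\<lambda>\<omega>. X' \<omega> i" and g = "g i" and B = B and C = "C i"])
    fix t
    show "(\<lambda>n. \<integral>\<omega>. of_real (Re (Y n \<omega>)) * iexp (t * X n \<omega> i) \<partial>M)
        \<longlonglongrightarrow> (\<integral>\<omega>. of_real (Re (Y' \<omega>)) * iexp (t * X' \<omega> i) \<partial>N)"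
      unfolding Re_eq integral_mult_right_zero Bochner_Integration.integral_add[OF Yint] Bochner_Integration.integral_add[OF Y'int]
      by (intro tendsto_intros Yconv cnjY)
  qed (use g conv0 order_trans[OF abs_Re_le_cmod Yb(1)] order_trans[OF abs_Re_le_cmod Yb(2)] in auto)
  have Im: "(\<lambda>n. \<integral>\<omega>. Im (Y n \<omega>) * g i (X n \<omega> i) \<partial>M) \<longlonglongrightarrow> (\<integral>\<omega>. Im (Y' \<omega>) * g i (X' \<omega> i) \<partial>N)"
  proof (rule levy_continuity_bounded_weight[OF M N, where X = "\<lambda>n \<omega>. X n \<omega> i" and X' = "\<lambda>\<omega>. X' \<omega> i" and g = "g i" and B = B and C = "C i"])
    fix t
    show "(\<lambda>n. \<integral>\<omega>. of_real (Im (Y n \<omega>)) * iexp (t * X n \<omega> i) \<partial>M)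
        \<longlonglongrightarrow> (\<integral>\<omega>. of_real (Im (Y' \<omega>)) * iexp (t * X' \<omega> i) \<partial>N)"
      unfolding Im_eq integral_mult_right_zero Bochner_Integration.integral_diff[OF Yint] Bochner_Integration.integral_diff[OF Y'int]
      by (intro tendsto_intros Yconv cnjY)
  qed (use g conv0 order_trans[OF abs_Im_le_cmod Yb(1)] order_trans[OF abs_Im_le_cmod Yb(2)] in auto)
  have split: "of_real a * y = of_real (Re y * a) + \<i> * of_real (Im y * a)" for a :: real and y :: complex
    by (simp add: complex_eq_iff)
  have bound: "\<bar>u * g i x\<bar> \<le> B * C i" if "\<bar>u\<bar> \<le> B" for u x
    unfolding abs_mult using that g(2) B by (intro mult_mono) auto
  note bd = bound[OF order_trans[OF abs_Re_le_cmod Yb(1)]] bound[OF order_trans[OF abs_Im_le_cmod Yb(1)]]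
    bound[OF order_trans[OF abs_Re_le_cmod Yb(2)]] bound[OF order_trans[OF abs_Im_le_cmod Yb(2)]]
  have int: "integrable M (\<lambda>\<omega>. Re (Y n \<omega>) * g i (X n \<omega> i))" "integrable M (\<lambda>\<omega>. Im (Y n \<omega>) * g i (X n \<omega> i))" for n
    by (rule M.integrable_const_bound[where B = "B * C i"]; use bd in simp)+
  have int': "integrable N (\<lambda>\<omega>. Re (Y' \<omega>) * g i (X' \<omega> i))" "integrable N (\<lambda>\<omega>. Im (Y' \<omega>) * g i (X' \<omega> i))"
    by (rule N.integrable_const_bound[where B = "B * C i"]; use bd in simp)+
  have eq: "(\<integral>\<omega>. mixed_test (insert i S) R g \<theta> (X n \<omega>) \<partial>M) =
      of_real (\<integral>\<omega>. Re (Y n \<omega>) * g i (X n \<omega> i) \<partial>M) + \<i> * of_real (\<integral>\<omega>. Im (Y n \<omega>) * g i (X n \<omega> i) \<partial>M)" for n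
    unfolding mixed_test_insert_factor[OF insert.hyps] Y_def[symmetric] split
    by (subst Bochner_Integration.integral_add)
      (use int in \<open>auto simp del: of_real_mult intro!: integrable_mult_right integrable_of_real\<close>)
  have eq': "(\<integral>\<omega>. mixed_test (insert i S) R g \<theta> (X' \<omega>) \<partial>N) =
      of_real (\<integral>\<omega>. Re (Y' \<omega>) * g i (X' \<omega> i) \<partial>N) + \<i> * of_real (\<integral>\<omega>. Im (Y' \<omega>) * g i (X' \<omega> i) \<partial>N)"
    unfolding mixed_test_insert_factor[OF insert.hyps] Y'_def[symmetric] split
    by (subst Bochner_Integration.integral_add)
      (use int' in \<open>auto simp del: of_real_mult intro!: integrable_mult_right integrable_of_real\<close>)
  show ?case
    unfolding R_def[symmetric] eq eq' by (intro tendsto_intros Re Im)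
qed

section \<open>Stone-Weierstrass: from product test functions to all bounded continuous ones\<close>

inductive_set product_sums :: "'j set \<Rightarrow> (('j \<Rightarrow> real) \<Rightarrow> real) set" for J :: "'j set" where
  product: "(\<And>j. continuous_on UNIV (g j)) \<Longrightarrow> (\<lambda>x. \<Prod>j\<in>J. g j (x j)) \<in> product_sums J"
| add: "p \<in> product_sums J \<Longrightarrow> q \<in> product_sums J \<Longrightarrow> (\<lambda>x. p x + q x) \<in> product_sums J"

lemma product_sums_mult:
  assumes "p \<in> product_sums J" "q \<in> product_sums J"
  shows "(\<lambda>x. p x * q x) \<in> product_sums J"
  using assms(1)
proof induction
  case (product g)
  note g = this
  show ?case using assms(2)
  proof induction
    case (product g')
    have "(\<lambda>x. \<Prod>j\<in>J. g j (x j) * g' j (x j)) \<in> product_sums J"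
      using g product by (intro product_sums.product continuous_on_mult)
    then show ?case by (simp add: prod.distrib)
  qed (simp add: distrib_left product_sums.add)
qed (simp add: distrib_right product_sums.add)

lemma product_sums_factor:
  assumes "finite J" "j \<in> J" "continuous_on UNIV \<phi>"
  shows "(\<lambda>x. \<phi> (x j)) \<in> product_sums J"
proof -
  have "(\<lambda>x. \<Prod>i\<in>J. (if i = j then \<phi> else (\<lambda>_. 1)) (x i)) \<in> product_sums J"
    using assms(3) by (intro product_sums.product) auto
  moreover have "(\<Prod>i\<in>J. (if i = j then \<phi> else (\<lambda>_. 1)) (x i)) = \<phi> (x j)" for x :: "_ \<Rightarrow> real"
  proof -
    have "(\<Prod>i\<in>J. (if i = j then \<phi> else (\<lambda>_. 1)) (x i)) = (\<Prod>i\<in>J. if i = j then \<phi> (x i) else 1)"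
      by (intro prod.cong) auto
    then show ?thesis using assms(1,2) by simp
  qed
  ultimately show ?thesis by simp
qed

lemma product_sums_continuous: "p \<in> product_sums J \<Longrightarrow> continuous_on A p"
proof (induction rule: product_sums.induct)
  case (product g)
  have "continuous_on UNIV (\<lambda>x. g j (x j))" for j
    by (rule continuous_on_compose2[OF product[of j]]) (auto intro: continuous_intros)
  then have "continuous_on UNIV (\<lambda>x. \<Prod>j\<in>J. g j (x j))"
    by (intro continuous_intros)
  then show ?case by (rule continuous_on_subset) simp
qed (rule continuous_on_add)

lemma product_sums_restrict: "p \<in> product_sums J \<Longrightarrow> p (restrict x J) = p x"
  by (induction rule: product_sums.induct) auto

definition tent :: "real \<Rightarrow> real \<Rightarrow> real" where
  "tent K x = max 0 (min 1 (K + 1 - \<bar>x\<bar>))"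

lemma tent_bounds: "0 \<le> tent K x" "tent K x \<le> 1" "\<bar>tent K x\<bar> \<le> 1"
  by (auto simp: tent_def)

lemma continuous_on_tent: "continuous_on A (tent K)"
  unfolding tent_def by (intro continuous_intros)

lemma bounded_mult_tent:
  assumes "continuous_on UNIV g"
  shows "\<exists>C. \<forall>x. \<bar>g x * tent K x\<bar> \<le> C"
proof -
  have "compact (g ` {- (K + 1)..K + 1})"
    by (rule compact_continuous_image[OF continuous_on_subset[OF assms]]) auto
  then obtain C where C: "\<And>x. x \<in> {- (K + 1)..K + 1} \<Longrightarrow> \<bar>g x\<bar> \<le> C"
    using compact_imp_bounded bounded_iff by (metis imageI real_norm_def)
  have "\<bar>g x * tent K x\<bar> \<le> \<bar>C\<bar>" for x
  proof (cases "\<bar>x\<bar> \<le> K + 1")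
    case True
    then have "\<bar>g x\<bar> \<le> C" by (intro C) auto
    then have "\<bar>g x\<bar> * \<bar>tent K x\<bar> \<le> \<bar>C\<bar> * 1"
      using tent_bounds[of K x] by (intro mult_mono) auto
    then show ?thesis by (simp add: abs_mult)
  qed (simp add: tent_def)
  then show ?thesis by blast
qed

text \<open>Tychonoff in the full function space: coordinates outside \<open>J\<close> range over
  the compact singleton \<open>{undefined}\<close>.\<close>

lemma compact_box:
  fixes J :: "'j set"
  shows "compact (PiE J (\<lambda>_. {-K..K :: real}))"
proof -
  have "compactin (product_topology (\<lambda>_. euclidean :: real topology) (UNIV :: 'j set))
      (PiE UNIV (\<lambda>j. if j \<in> J then {-K..K} else {undefined}))"
    by (subst compactin_PiE) auto
  moreover have "PiE UNIV (\<lambda>j. if j \<in> J then {-K..K} else {undefined}) = PiE J (\<lambda>_. {-K..K})"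
    by (auto simp: PiE_def extensional_def Pi_def split: if_splits)
  ultimately show ?thesis by (simp add: euclidean_product_topology)
qed

text \<open>A coordinate in the nonempty \<open>J\<close> supplies the constants, and two distinct
  extensional functions differ at some coordinate in \<open>J\<close>.\<close>

lemma product_sums_dense:
  fixes f :: "('j :: countable \<Rightarrow> real) \<Rightarrow> real"
  assumes "finite J" "J \<noteq> {}" "continuous_on UNIV f" "e > 0"
  obtains p where "p \<in> product_sums J" "\<And>x. x \<in> PiE J (\<lambda>_. {-K..K}) \<Longrightarrow> \<bar>f x - p x\<bar> < e"
proof -
  obtain j0 where j0: "j0 \<in> J" using assms(2) by blast
  interpret function_ring_on "product_sums J" "PiE J (\<lambda>_. {-K..K})"
  proof
    show "compact (PiE J (\<lambda>_. {-K..K}))" by (rule compact_box)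
    show "(\<lambda>_. c) \<in> product_sums J" for c
      using product_sums_factor[OF assms(1) j0, of "\<lambda>_. c"] by simp
    fix x y assume "x \<in> PiE J (\<lambda>_. {-K..K})" "y \<in> PiE J (\<lambda>_. {-K..K})" "x \<noteq> y"
    then obtain j where "j \<in> J" "x j \<noteq> y j" by (meson PiE_ext)
    then show "\<exists>f\<in>product_sums J. f x \<noteq> f y"
      using product_sums_factor[OF assms(1), of j "\<lambda>a. a"] by (intro bexI[of _ "\<lambda>x. x j"]) auto
  qed (auto intro: product_sums_continuous product_sums.add product_sums_mult)
  show ?thesis
    using Stone_Weierstrass_basic[OF continuous_on_subset[OF assms(3)] assms(4)] that by blast
qed

text \<open>The hypothesis on \<open>restrict\<close> makes \<open>f\<close> a function of the
  coordinates in \<open>J\<close> alone. On a large box \<open>f\<close> is approximated by sums of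
  products; that little mass lies outside the box is itself a consequence of the convergence for the
  product test function \<open>cut K\<close>.\<close>

theorem multivariate_levy_continuity:
  fixes M :: "'a measure" and N :: "'b measure"
    and X :: "nat \<Rightarrow> 'a \<Rightarrow> 'j :: countable \<Rightarrow> real" and X' :: "'b \<Rightarrow> 'j \<Rightarrow> real"
    and f :: "('j \<Rightarrow> real) \<Rightarrow> real"
  assumes M: "prob_space M" and N: "prob_space N" and J: "finite J" "J \<noteq> {}"
    and X [measurable]: "\<And>n j. (\<lambda>\<omega>. X n \<omega> j) \<in> borel_measurable M" "\<And>j. (\<lambda>\<omega>. X' \<omega> j) \<in> borel_measurable N"
    and conv: "\<And>\<theta>. (\<lambda>n. \<integral>\<omega>. iexp (\<Sum>j\<in>J. \<theta> j * X n \<omega> j) \<partial>M) \<longlonglongrightarrow> (\<integral>\<omega>. iexp (\<Sum>j\<in>J. \<theta> j * X' \<omega> j) \<partial>N)"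
    and f: "continuous_on UNIV f" "\<And>x. \<bar>f x\<bar> \<le> C" "\<And>x. f (restrict x J) = f x"
  shows "(\<lambda>n. \<integral>\<omega>. f (X n \<omega>) \<partial>M) \<longlonglongrightarrow> (\<integral>\<omega>. f (X' \<omega>) \<partial>N)"
proof -
  interpret M: prob_space M by fact
  interpret N: prob_space N by fact
  have C: "C \<ge> 0" using f(2) order_trans[OF abs_ge_zero] by blast
  have borel: "(\<lambda>\<omega>. g (Z \<omega>)) \<in> borel_measurable P"
    if "continuous_on UNIV g" "\<And>j. (\<lambda>\<omega>. Z \<omega> j) \<in> borel_measurable P"
    for g :: "('j \<Rightarrow> real) \<Rightarrow> real" and Z :: "'c \<Rightarrow> 'j \<Rightarrow> real" and P
  proof -
    have "Z \<in> measurable P (PiM UNIV (\<lambda>_. borel))"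
      using that(2) by (intro measurable_PiM_single') (auto simp: space_PiM)
    \<comment> \<open>Countability of the index type makes the Borel sets of the product topology
      agree with the product sigma-algebra.\<close>
    moreover have "g \<in> measurable (PiM UNIV (\<lambda>_. borel)) borel"
      using borel_measurable_continuous_onI[OF that(1)] measurable_cong_sets[OF sets_PiM_equal_borel refl] by blast
    ultimately show ?thesis by (rule measurable_compose)
  qed
  have prod_conv: "(\<lambda>n. \<integral>\<omega>. (\<Prod>j\<in>J. g j (X n \<omega> j)) \<partial>M) \<longlonglongrightarrow> (\<integral>\<omega>. (\<Prod>j\<in>J. g j (X' \<omega> j)) \<partial>N)"
    if g: "\<And>j. continuous_on UNIV (g j)" "\<And>j. \<exists>C. \<forall>x. \<bar>g j x\<bar> \<le> C" for g :: "'j \<Rightarrow> real \<Rightarrow> real"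
  proof -
    obtain C where C: "\<And>j x. \<bar>g j x\<bar> \<le> C j" using g(2) by metis
    have "(\<lambda>n. \<integral>\<omega>. mixed_test J (J - J) g (\<lambda>_. 0) (X n \<omega>) \<partial>M) \<longlonglongrightarrow> (\<integral>\<omega>. mixed_test J (J - J) g (\<lambda>_. 0) (X' \<omega>) \<partial>N)"
      by (rule mixed_test_integral_tendsto[OF M N J(1) X conv, where C = C]) (use g(1) C J(1) in auto)
    then have "(\<lambda>n. \<integral>\<omega>. complex_of_real (\<Prod>j\<in>J. g j (X n \<omega> j)) \<partial>M) \<longlonglongrightarrow> (\<integral>\<omega>. complex_of_real (\<Prod>j\<in>J. g j (X' \<omega> j)) \<partial>N)"
      by (simp add: mixed_test_def)
    then show ?thesis by (simp only: integral_complex_of_real tendsto_of_real_iff)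
  qed
  define cut where "cut K x = (\<Prod>j\<in>J. tent K (x j))" for K and x :: "'j \<Rightarrow> real"
  have cut: "0 \<le> cut K x" "cut K x \<le> 1" for K x
    unfolding cut_def using J(1) tent_bounds by (auto intro: prod_nonneg prod_le_1)
  have "continuous_on UNIV (\<lambda>x :: 'j \<Rightarrow> real. tent K (x j))" for K j
    by (rule continuous_on_compose2[OF continuous_on_tent[of UNIV K]]) (auto intro: continuous_intros)
  then have cut_cont: "continuous_on UNIV (cut K)" for K
    unfolding cut_def by (intro continuous_intros)
  have cut_conv: "(\<lambda>n. \<integral>\<omega>. cut K (X n \<omega>) \<partial>M) \<longlonglongrightarrow> (\<integral>\<omega>. cut K (X' \<omega>) \<partial>N)" for K
    unfolding cut_def using continuous_on_tent tent_bounds(3) by (intro prod_conv) blast+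
  have p_cont: "continuous_on UNIV (\<lambda>x. p x * cut K x)" if "p \<in> product_sums J" for p K
    using product_sums_continuous[OF that] cut_cont by (intro continuous_on_mult)
  have p_bounded: "\<exists>B. \<forall>x. \<bar>p x * cut K x\<bar> \<le> B" if "p \<in> product_sums J" for p K
    using that
  proof induction
    case (product g)
    have "\<forall>j. \<exists>B. \<forall>x. \<bar>g j x * tent K x\<bar> \<le> B"
      using bounded_mult_tent[OF product] by blast
    from choice[OF this] obtain B where B: "\<And>j x. \<bar>g j x * tent K x\<bar> \<le> B j" by blast
    have "\<bar>\<Prod>j\<in>J. g j (x j) * tent K (x j)\<bar> \<le> prod B J" for x :: "'j \<Rightarrow> real"
      unfolding abs_prod using B by (intro prod_mono) auto
    then show ?case by (auto simp: cut_def prod.distrib)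
  next
    case (add p q)
    then obtain B1 B2 where "\<And>x. \<bar>p x * cut K x\<bar> \<le> B1" "\<And>x. \<bar>q x * cut K x\<bar> \<le> B2" by blast
    then have "\<bar>(p x + q x) * cut K x\<bar> \<le> B1 + B2" for x
      unfolding distrib_right by (intro order_trans[OF abs_triangle_ineq] add_mono)
    then show ?case by blast
  qed
  have p_int: "integrable M (\<lambda>\<omega>. p (X n \<omega>) * cut K (X n \<omega>))" if p: "p \<in> product_sums J" for p K n
  proof -
    obtain B where "\<And>x. \<bar>p x * cut K x\<bar> \<le> B" using p_bounded[OF p, of K] by blast
    then show ?thesis
      using borel[OF p_cont[OF p] X(1)] by (intro M.integrable_const_bound[where B = B]) auto
  qed
  have p_int': "integrable N (\<lambda>\<omega>. p (X' \<omega>) * cut K (X' \<omega>))" if p: "p \<in> product_sums J" for p K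
  proof -
    obtain B where "\<And>x. \<bar>p x * cut K x\<bar> \<le> B" using p_bounded[OF p, of K] by blast
    then show ?thesis
      using borel[OF p_cont[OF p] X(2)] by (intro N.integrable_const_bound[where B = B]) auto
  qed
  have p_conv: "(\<lambda>n. \<integral>\<omega>. p (X n \<omega>) * cut K (X n \<omega>) \<partial>M) \<longlonglongrightarrow> (\<integral>\<omega>. p (X' \<omega>) * cut K (X' \<omega>) \<partial>N)"
    if "p \<in> product_sums J" for p K
    using that
  proof induction
    case (product g)
    have "(\<lambda>n. \<integral>\<omega>. (\<Prod>j\<in>J. g j (X n \<omega> j) * tent K (X n \<omega> j)) \<partial>M) \<longlonglongrightarrow> (\<integral>\<omega>. (\<Prod>j\<in>J. g j (X' \<omega> j) * tent K (X' \<omega> j)) \<partial>N)"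
      using bounded_mult_tent[OF product] product continuous_on_tent by (intro prod_conv continuous_on_mult) blast+
    then show ?case by (simp add: cut_def prod.distrib)
  next
    case (add p q)
    show ?case
      unfolding distrib_right Bochner_Integration.integral_add[OF p_int[OF add.hyps(1)] p_int[OF add.hyps(2)]]
        Bochner_Integration.integral_add[OF p_int'[OF add.hyps(1)] p_int'[OF add.hyps(2)]]
      by (intro tendsto_add add.IH)
  qed
  have cut_lim: "(\<lambda>K. \<integral>\<omega>. cut (real K) (X' \<omega>) \<partial>N) \<longlonglongrightarrow> (\<integral>\<omega>. 1 \<partial>N)"
  proof (rule integral_dominated_convergence[where w = "\<lambda>_. 1"])
    show "AE \<omega> in N. (\<lambda>K. cut (real K) (X' \<omega>)) \<longlonglongrightarrow> 1"
    proof (rule AE_I2)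
      fix \<omega>
      have "eventually (\<lambda>K. tent (real K) (X' \<omega> j) = 1) sequentially" for j
      proof -
        obtain k :: nat where "\<bar>X' \<omega> j\<bar> < real k" using reals_Archimedean2 by blast
        then show ?thesis
          by (intro eventually_sequentiallyI[of k]) (auto simp: tent_def)
      qed
      then have "(\<lambda>K. cut (real K) (X' \<omega>)) \<longlonglongrightarrow> (\<Prod>j\<in>J. 1)"
        unfolding cut_def by (intro tendsto_prod tendsto_eventually)
      then show "(\<lambda>K. cut (real K) (X' \<omega>)) \<longlonglongrightarrow> 1" by simp
    qed
  qed (use cut borel[OF cut_cont, of X' N] X(2) in \<open>auto simp: abs_le_iff intro: order_trans\<close>)
  show ?thesis
  proof (rule LIMSEQ_I)
    fix r :: real assume "0 < r"
    \<comment> \<open>Replacing \<open>f\<close> by its cut-off approximation costs at most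
      \<open>C * e + e\<close>, once for \<open>X n\<close> and once for the limit; the convergence
      for \<open>p\<close> costs another \<open>e\<close>.\<close>
    define e where "e = r / (2 * C + 4)"
    have e: "e > 0" "(2 * C + 4) * e = r" using \<open>0 < r\<close> C by (auto simp: e_def)
    obtain K :: nat where K: "(\<integral>\<omega>. cut (real K) (X' \<omega>) \<partial>N) > 1 - e"
    proof -
      have "eventually (\<lambda>K. (\<integral>\<omega>. cut (real K) (X' \<omega>) \<partial>N) > 1 - e) sequentially"
        using cut_lim e by (intro order_tendstoD(1)) (auto simp: N.prob_space)
      then show ?thesis using that by (auto dest: eventually_happens)
    qed
    \<comment> \<open>The box reaches to \<open>K + 1\<close> because only there does the cutoff
      vanish.\<close>
    obtain p where p: "p \<in> product_sums J"
        "\<And>x. x \<in> PiE J (\<lambda>_. {-(real K + 1)..real K + 1}) \<Longrightarrow> \<bar>f x - p x\<bar> < e"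
      using product_sums_dense[OF J f(1) e(1)] by metis
    have approx: "\<bar>f x - p x * cut K x\<bar> \<le> C * (1 - cut K x) + e" for x
    proof -
      have "\<bar>f x - p x\<bar> * cut K x \<le> e"
      proof (cases "\<forall>j\<in>J. \<bar>x j\<bar> \<le> real K + 1")
        case True
        then have "restrict x J \<in> PiE J (\<lambda>_. {-(real K + 1)..real K + 1})"
          by (auto simp: abs_le_iff)
        then have "\<bar>f x - p x\<bar> < e"
          using p(2) f(3)[of x] product_sums_restrict[OF p(1), of x] by metis
        then have "\<bar>f x - p x\<bar> * cut K x \<le> e * 1"
          using cut[of K x] by (intro mult_mono) auto
        then show ?thesis by simp
      next
        case False
        then obtain j where "j \<in> J" "tent K (x j) = 0" by (auto simp: tent_def)
        then have "cut K x = 0"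
          unfolding cut_def by (intro prod_zero[OF J(1)]) (rule bexI)
        then show ?thesis using e by simp
      qed
      moreover have "\<bar>f x\<bar> * (1 - cut K x) \<le> C * (1 - cut K x)"
        using f(2) cut by (intro mult_right_mono) auto
      moreover have "f x - p x * cut K x = f x * (1 - cut K x) + (f x - p x) * cut K x"
        by (simp add: algebra_simps)
      moreover have "\<bar>f x * (1 - cut K x) + (f x - p x) * cut K x\<bar> \<le> \<bar>f x\<bar> * (1 - cut K x) + \<bar>f x - p x\<bar> * cut K x"
        using cut[of K x] by (intro order_trans[OF abs_triangle_ineq]) (simp add: abs_mult)
      ultimately show ?thesis by linarith
    qed
    have bound: "\<bar>(\<integral>\<omega>. f (Z \<omega>) \<partial>P) - (\<integral>\<omega>. p (Z \<omega>) * cut K (Z \<omega>) \<partial>P)\<bar> \<le> C * (1 - (\<integral>\<omega>. cut K (Z \<omega>) \<partial>P)) + e"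
      if P: "prob_space P" and Z: "\<And>j. (\<lambda>\<omega>. Z \<omega> j) \<in> borel_measurable P"
        and pi: "integrable P (\<lambda>\<omega>. p (Z \<omega>) * cut K (Z \<omega>))" for Z :: "'c \<Rightarrow> 'j \<Rightarrow> real" and P
    proof -
      interpret P: prob_space P by fact
      have fi: "integrable P (\<lambda>\<omega>. f (Z \<omega>))"
        using borel[OF f(1) Z] f(2) by (intro P.integrable_const_bound[where B = C]) auto
      have ci: "integrable P (\<lambda>\<omega>. cut K (Z \<omega>))"
        using borel[OF cut_cont Z] cut by (auto intro: P.integrable_const_bound[where B = 1])
      have "\<bar>(\<integral>\<omega>. f (Z \<omega>) \<partial>P) - (\<integral>\<omega>. p (Z \<omega>) * cut K (Z \<omega>) \<partial>P)\<bar> = \<bar>\<integral>\<omega>. f (Z \<omega>) - p (Z \<omega>) * cut K (Z \<omega>) \<partial>P\<bar>"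
        using fi pi by simp
      also have "\<dots> \<le> (\<integral>\<omega>. \<bar>f (Z \<omega>) - p (Z \<omega>) * cut K (Z \<omega>)\<bar> \<partial>P)"
        by (rule integral_abs_bound)
      also have "\<dots> \<le> (\<integral>\<omega>. C * (1 - cut K (Z \<omega>)) + e \<partial>P)"
        using fi pi ci approx by (intro integral_mono) auto
      also have "\<dots> = C * (1 - (\<integral>\<omega>. cut K (Z \<omega>) \<partial>P)) + e"
        using ci by (simp add: P.prob_space)
      finally show ?thesis .
    qed
    have "eventually (\<lambda>n. (\<integral>\<omega>. cut K (X n \<omega>) \<partial>M) > 1 - e) sequentially"
      using K by (rule order_tendstoD(1)[OF cut_conv])
    moreover have "eventually (\<lambda>n. \<bar>(\<integral>\<omega>. p (X n \<omega>) * cut K (X n \<omega>) \<partial>M) - (\<integral>\<omega>. p (X' \<omega>) * cut K (X' \<omega>) \<partial>N)\<bar> < e) sequentially"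
      using p_conv[OF p(1), of K] e(1) unfolding tendsto_iff dist_real_def by blast
    ultimately have "eventually (\<lambda>n. norm ((\<integral>\<omega>. f (X n \<omega>) \<partial>M) - (\<integral>\<omega>. f (X' \<omega>) \<partial>N)) < r) sequentially"
    proof eventually_elim
      case (elim n)
      have 1: "C * (1 - (\<integral>\<omega>. cut K (X n \<omega>) \<partial>M)) \<le> C * e" "C * (1 - (\<integral>\<omega>. cut K (X' \<omega>) \<partial>N)) \<le> C * e"
        using elim K C by (auto intro!: mult_left_mono)
      have "r = 2 * (C * e) + 4 * e" using e(2) by (simp add: algebra_simps)
      then show ?case
        using bound[OF M X(1) p_int[OF p(1)], of n] bound[OF N X(2) p_int'[OF p(1)]] 1 elim(2) e(1)
        unfolding real_norm_def by linarith
    qed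
    then show "\<exists>n0. \<forall>n\<ge>n0. norm ((\<integral>\<omega>. f (X n \<omega>) \<partial>M) - (\<integral>\<omega>. f (X' \<omega>) \<partial>N)) < r"
      by (simp only: eventually_sequentially)
  qed
qed

section \<open>Histories of the tree\<close>

text \<open>Mean value bound: the half-plane is convex, and the derivative of \<open>exp\<close> has
  modulus \<open>exp (Re z)\<close>.\<close>

lemma norm_exp_diff_le:
  fixes x y :: complex
  assumes "Re x \<le> c" "Re y \<le> c"
  shows "norm (exp x - exp y) \<le> exp c * norm (x - y)"
proof (rule field_differentiable_bound[where S = "{z. Re z \<le> c}" and f' = exp])
  show "convex {z. Re z \<le> c}" by (rule convex_halfspace_Re_le)
  show "(exp has_field_derivative exp z) (at z within {z. Re z \<le> c})" for z
    by (rule DERIV_exp[THEN has_field_derivative_at_within])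
qed (use assms in \<open>auto simp: norm_exp_eq_Re\<close>)

text \<open>Taylor remainder. The range 2 is what \<open>w = (z - 1) / N\<close> needs for
  \<open>z\<close> on the unit circle and \<open>N \<ge> 1\<close>.\<close>

lemma norm_exp_minus_one_minus_self_le:
  fixes w :: complex
  assumes "\<bar>Re w\<bar> \<le> 2"
  shows "norm (exp w - 1 - w) \<le> exp 2 * (norm w)\<^sup>2"
proof -
  have "norm (exp w - (\<Sum>k\<le>1. w ^ k / fact k)) \<le> exp \<bar>Re w\<bar> * norm w ^ Suc 1 / fact 1"
    by (rule Taylor_exp)
  also have "\<dots> \<le> exp 2 * (norm w)\<^sup>2"
    using assms by (auto intro!: mult_right_mono simp: power2_eq_square)
  finally show ?thesis by (simp add: diff_diff_eq)
qed

text \<open>A history lists the chosen nodes, latest first.\<close>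

primrec hist_tree :: "node list \<Rightarrow> tree" where
  "hist_tree [] = {[]}"
| "hist_tree (v # h) = grow (hist_tree h) v"

text \<open>The process in law, finitely supported at each time, so that all expectations are finite
  sums and integrability is automatic. The given process enters only when this law is transferred to
  it.\<close>

primrec hist_pmf :: "nat \<Rightarrow> node list pmf" where
  "hist_pmf 0 = return_pmf []"
| "hist_pmf (Suc n) = do {h \<leftarrow> hist_pmf n; v \<leftarrow> pmf_of_set (hist_tree h); return_pmf (v # h)}"

lemma finite_hist_tree [simp]: "finite (hist_tree h)"
  by (induction h) (auto simp: grow_def)

lemma root_in_hist_tree [simp]: "[] \<in> hist_tree h"
  by (induction h) (auto simp: grow_def)

lemma hist_tree_nonempty [simp]: "hist_tree h \<noteq> {}"
  using root_in_hist_tree by blast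

text \<open>A node has infinitely many candidate children, and a finite tree cannot contain them
  all.\<close>

lemma new_child_notin:
  fixes t :: tree
  assumes "finite t"
  shows "v @ [LEAST i. 1 \<le> i \<and> v @ [i] \<notin> t] \<notin> t"
proof -
  have inj: "inj_on (\<lambda>i. v @ [i]) {1..}" by (auto simp: inj_on_def)
  have "\<exists>i\<ge>1. v @ [i] \<notin> t"
  proof (rule ccontr)
    assume "\<not> ?thesis"
    then have "(\<lambda>i. v @ [i]) ` {1..} \<subseteq> t" by auto
    then have "finite ((\<lambda>i. v @ [i]) ` {1::nat..})" using assms finite_subset by blast
    then have "finite {1::nat..}" using finite_imageD[OF _ inj] by blast
    then show False using infinite_Ici by blast
  qed
  then show ?thesis by (metis (mono_tags, lifting) LeastI_ex)
qed

lemma sum_grow_root: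
  fixes f :: "node \<Rightarrow> 'b::comm_monoid_add"
  assumes "finite t"
  shows "sum f (grow t []) = f [] + (\<Sum>w\<in>t. f (1 # w)) + (\<Sum>w\<in>t. f (2 # w))"
proof -
  have "sum f (grow t []) = f [] + sum f ((#) 1 ` t \<union> (#) 2 ` t)"
    using assms by (auto simp: grow_def Un_assoc intro!: sum.insert)
  also have "sum f ((#) 1 ` t \<union> (#) 2 ` t) = sum f ((#) 1 ` t) + sum f ((#) 2 ` t)"
    using assms by (intro sum.union_disjoint) auto
  finally show ?thesis by (simp add: sum.reindex o_def add.assoc)
qed

lemma sum_grow_child:
  fixes f :: "node \<Rightarrow> 'b::comm_monoid_add"
  assumes "finite t" "v \<noteq> []"
  shows "sum f (grow t v) = sum f t + f (v @ [LEAST i. 1 \<le> i \<and> v @ [i] \<notin> t])"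
  using assms new_child_notin[OF assms(1), of v] by (simp add: grow_def add.commute)

definition tree_size :: "node list \<Rightarrow> real" where
  "tree_size h = real (card (hist_tree h))"

lemma tree_size_Nil [simp]: "tree_size [] = 1"
  by (simp add: tree_size_def)

lemma tree_size_Cons_root [simp]: "tree_size ([] # h) = 2 * tree_size h + 1"
  using sum_grow_root[OF finite_hist_tree, of "\<lambda>_. 1::real" h]
  by (simp add: tree_size_def)

lemma tree_size_Cons_child [simp]: "v \<noteq> [] \<Longrightarrow> tree_size (v # h) = tree_size h + 1"
  using sum_grow_child[OF finite_hist_tree, of v "\<lambda>_. 1::real" h]
  by (simp add: tree_size_def)

text \<open>Every step adds at least one node. The bound holds for every history and makes errors of
  order \<open>1 / N\<^sup>2\<close> summable over time.\<close>

lemma tree_size_ge: "tree_size h \<ge> real (length h) + 1"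
proof (induction h)
  case (Cons v h)
  then show ?case by (cases "v = []") auto
qed simp

lemma tree_size_ge_1: "tree_size h \<ge> 1"
  using tree_size_ge[of h] by simp

lemma finite_set_hist_pmf [simp]: "finite (set_pmf (hist_pmf n))"
  by (induction n) auto

lemma length_hist_pmf: "h \<in> set_pmf (hist_pmf n) \<Longrightarrow> length h = n"
  by (induction n arbitrary: h) auto

abbreviation hist_exp :: "nat \<Rightarrow> (node list \<Rightarrow> 'b::{banach, second_countable_topology}) \<Rightarrow> 'b" where
  "hist_exp n F \<equiv> measure_pmf.expectation (hist_pmf n) F"

lemma integrable_hist_pmf [simp]:
  fixes F :: "node list \<Rightarrow> 'b::{banach, second_countable_topology}"
  shows "integrable (measure_pmf (hist_pmf n)) F"
  by (rule integrable_measure_pmf_finite) simp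

text \<open>The conditional expectation of \<open>F\<close> one step later, given the history
  \<open>h\<close>.\<close>

definition step_avg :: "(node list \<Rightarrow> 'b::real_vector) \<Rightarrow> node list \<Rightarrow> 'b" where
  "step_avg F h = (\<Sum>v\<in>hist_tree h. F (v # h)) /\<^sub>R tree_size h"

lemma hist_exp_Suc:
  fixes F :: "node list \<Rightarrow> 'b::{banach, second_countable_topology}"
  shows "hist_exp (Suc n) F = hist_exp n (step_avg F)"
proof -
  have "hist_exp (Suc n) F = (\<Sum>h\<in>set_pmf (hist_pmf n). pmf (hist_pmf n) h *\<^sub>R
      measure_pmf.expectation (map_pmf (\<lambda>v. v # h) (pmf_of_set (hist_tree h))) F)"
    unfolding hist_pmf.simps map_pmf_def[symmetric]
    by (rule pmf_expectation_bind) auto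
  also have "(\<lambda>h. measure_pmf.expectation (map_pmf (\<lambda>v. v # h) (pmf_of_set (hist_tree h))) F) = step_avg F"
    by (rule ext, subst integral_map_pmf, subst integral_measure_pmf[of "hist_tree h"])
      (auto simp: step_avg_def tree_size_def scaleR_sum_right divide_inverse)
  also have "(\<Sum>h\<in>set_pmf (hist_pmf n). pmf (hist_pmf n) h *\<^sub>R step_avg F h) = hist_exp n (step_avg F)"
    by (subst integral_measure_pmf[of "set_pmf (hist_pmf n)"]) auto
  finally show ?thesis .
qed

lemma hist_exp_mono:
  assumes "\<And>h. h \<in> set_pmf (hist_pmf n) \<Longrightarrow> length h = n \<Longrightarrow> F h \<le> (G h :: real)"
  shows "hist_exp n F \<le> hist_exp n G"
  by (rule integral_mono_AE) (auto simp: AE_measure_pmf_iff length_hist_pmf intro!: assms)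

text \<open>For quantities that see only whether a doubling occurs: the root is the one choice
  causing it and has probability \<open>1 / tree_size h\<close>.\<close>

lemma step_avg_eq:
  fixes F :: "node list \<Rightarrow> 'b::real_vector"
  assumes "\<And>v. v \<in> hist_tree h \<Longrightarrow> v \<noteq> [] \<Longrightarrow> F (v # h) = c"
  shows "step_avg F h = c + (F ([] # h) - c) /\<^sub>R tree_size h"
proof -
  have "(\<Sum>v\<in>hist_tree h. F (v # h)) = F ([] # h) + (\<Sum>v\<in>hist_tree h - {[]}. c)"
    using assms by (subst sum.remove[of _ "[]"]) auto
  also have "(\<Sum>v\<in>hist_tree h - {[]}. c) = (tree_size h - 1) *\<^sub>R c"
    using card_gt_0_iff[of "hist_tree h"]
    by (subst sum_constant_scaleR) (simp add: tree_size_def card_Diff_singleton of_nat_diff)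
  finally have sum: "(\<Sum>v\<in>hist_tree h. F (v # h)) = F ([] # h) + (tree_size h - 1) *\<^sub>R c" .
  have "inverse (tree_size h) * (tree_size h - 1) = 1 - inverse (tree_size h)"
    using tree_size_ge_1[of h] by (simp add: field_simps)
  then show ?thesis
    unfolding step_avg_def sum by (simp add: algebra_simps)
qed

text \<open>The doubling increment \<open>d\<close> is weighted by its probability, the attachment
  increment \<open>c\<close> is charged in full. So \<open>d\<close> may be as large as
  \<open>O(1 / N)\<close> where \<open>c\<close> has to be \<open>O(1 / N\<^sup>2)\<close>.\<close>

lemma step_avg_le:
  fixes F :: "node list \<Rightarrow> real"
  assumes "\<And>v. v \<in> hist_tree h \<Longrightarrow> v \<noteq> [] \<Longrightarrow> F (v # h) \<le> x + c" "F ([] # h) \<le> x + d" "c \<ge> 0"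
  shows "step_avg F h \<le> x + c + d / tree_size h"
proof -
  have "(\<Sum>v\<in>hist_tree h. F (v # h)) \<le> (x + d) + (\<Sum>v\<in>hist_tree h - {[]}. x + c)"
    using assms by (subst sum.remove[of _ "[]"]) (auto simp del: sum_constant intro!: sum_mono add_mono)
  also have "(\<Sum>v\<in>hist_tree h - {[]}. x + c) = (tree_size h - 1) * (x + c)"
    using card_gt_0_iff[of "hist_tree h"]
    by (simp add: tree_size_def card_Diff_singleton of_nat_diff)
  also have "x + d + (tree_size h - 1) * (x + c) \<le> tree_size h * (x + c) + d"
    using assms(3) by (simp add: algebra_simps)
  finally show ?thesis
    using tree_size_ge_1[of h]
    by (simp add: step_avg_def field_simps)
qed

text \<open>Telescoping in time. The starting time \<open>m\<close> stays free, since a late start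
  is what makes the accumulated error small.\<close>

lemma hist_exp_le_sum:
  fixes F :: "node list \<Rightarrow> real"
  assumes "\<And>h. length h \<ge> m \<Longrightarrow> step_avg F h \<le> F h + b (length h)" and "m \<le> n"
  shows "hist_exp n F \<le> hist_exp m F + (\<Sum>k\<in>{m..<n}. b k)"
  using \<open>m \<le> n\<close>
proof (induction n rule: dec_induct)
  case (step n)
  have "hist_exp (Suc n) F = hist_exp n (step_avg F)" by (rule hist_exp_Suc)
  also have "\<dots> \<le> hist_exp n (\<lambda>h. F h + b n)"
    using assms(1) step by (intro hist_exp_mono) auto
  also have "\<dots> = hist_exp n F + b n" by simp
  finally show ?case using step by simp
qed simp

text \<open>Comparison with the telescoping terms \<open>1 / k - 1 / (k + 1)\<close>.\<close>

lemma sum_inverse_squares_le: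
  assumes "0 < m"
  shows "(\<Sum>k\<in>{m..<n}. 1 / (real k + 1)\<^sup>2) \<le> 1 / real m"
proof (cases "m \<le> n")
  case True
  have "(\<Sum>k\<in>{m..<n}. 1 / (real k + 1)\<^sup>2) \<le> (\<Sum>k\<in>{m..<n}. (- 1 / real (Suc k)) - (- 1 / real k))"
  proof (intro sum_mono)
    fix k assume "k \<in> {m..<n}"
    then have "real k > 0" using assms by auto
    then show "1 / (real k + 1)\<^sup>2 \<le> - 1 / real (Suc k) - - 1 / real k"
      by (simp add: divide_simps power2_eq_square) (simp add: algebra_simps)
  qed
  also have "\<dots> = 1 / real m - 1 / real n"
    using True by (subst sum_Suc_diff') auto
  also have "\<dots> \<le> 1 / real m" by simp
  finally show ?thesis .
qed simp

lemma sum_inverse_squares_le_2: "(\<Sum>k\<in>{0..<n}. 1 / (real k + 1)\<^sup>2) \<le> 2"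
proof (cases "n = 0")
  case False
  then have "(\<Sum>k\<in>{0..<n}. 1 / (real k + 1)\<^sup>2) = 1 + (\<Sum>k\<in>{1..<n}. 1 / (real k + 1)\<^sup>2)"
    by (subst sum.atLeast_Suc_lessThan) auto
  with sum_inverse_squares_le[of 1 n] show ?thesis by simp
qed simp

section \<open>Generating function of the heights\<close>

text \<open>For \<open>z\<close> on the unit circle, the characteristic function of the height of a
  uniform node, given the tree.\<close>

definition height_gf :: "complex \<Rightarrow> node list \<Rightarrow> complex" where
  "height_gf z h = (\<Sum>w\<in>hist_tree h. z ^ length w) / of_real (tree_size h)"

primrec doublings :: "node list \<Rightarrow> real" where
  "doublings [] = 0"
| "doublings (v # h) = doublings h + (if v = [] then 1 else 0)"

primrec recip_sum :: "node list \<Rightarrow> real" where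
  "recip_sum [] = 0"
| "recip_sum (v # h) = recip_sum h + 1 / tree_size h"

text \<open>The factors are the conditional mean factors of \<open>height_gf z\<close>, up to errors that are summable in mean.\<close>

primrec gf_approx :: "complex \<Rightarrow> node list \<Rightarrow> complex" where
  "gf_approx z [] = 1"
| "gf_approx z (v # h) = gf_approx z h *
     (if v = [] then z else 1 + (z - 1) / of_real (tree_size h + 1))"

lemma sum_power_length: "(\<Sum>w\<in>hist_tree h. z ^ length w) = of_real (tree_size h) * height_gf z h"
  using tree_size_ge_1[of h] by (simp add: height_gf_def)

text \<open>Two copies of the tree with all heights raised by one, and a new root of height
  0.\<close>

lemma height_gf_root:
  "height_gf z ([] # h) = (1 + 2 * z * of_real (tree_size h) * height_gf z h) / of_real (2 * tree_size h + 1)"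
  unfolding height_gf_def[of z "[] # h"] hist_tree.simps sum_grow_root[OF finite_hist_tree]
  by (simp add: sum_distrib_left[symmetric] sum_power_length)

lemma height_gf_child:
  "v \<noteq> [] \<Longrightarrow> height_gf z (v # h) =
     (of_real (tree_size h) * height_gf z h + z ^ Suc (length v)) / of_real (tree_size h + 1)"
  unfolding height_gf_def[of z "v # h"] hist_tree.simps
  by (subst sum_grow_child) (simp_all add: sum_power_length)

lemma norm_height_gf_le:
  assumes "norm z = 1"
  shows "norm (height_gf z h) \<le> 1"
proof -
  have "norm (\<Sum>w\<in>hist_tree h. z ^ length w) \<le> (\<Sum>w\<in>hist_tree h. norm (z ^ length w))"
    by (rule norm_sum)
  also have "\<dots> = tree_size h"
    using assms by (simp add: norm_power tree_size_def)
  finally show ?thesis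
    using tree_size_ge_1[of h] by (simp add: height_gf_def norm_divide)
qed

text \<open>The number is the convex combination \<open>(x + z) / (x + 1)\<close> of 1 and
  \<open>z\<close>.\<close>

lemma norm_one_plus_le:
  fixes z :: complex
  assumes "norm z = 1" "x \<ge> 0"
  shows "norm (1 + (z - 1) / of_real (x + 1)) \<le> 1"
proof -
  have "1 + (z - 1) / of_real (x + 1) = (of_real x + z) / of_real (x + 1)"
    using assms(2) by (simp add: field_simps add_eq_0_iff complex_eq_iff)
  also have "norm \<dots> = norm (of_real x + z) / (x + 1)"
    using assms(2) by (simp add: norm_divide del: of_real_add)
  also have "\<dots> \<le> 1"
    using norm_triangle_ineq[of "of_real x" z] assms by (simp add: divide_le_eq)
  finally show ?thesis .
qed

lemma norm_gf_approx_le: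
  assumes "norm z = 1"
  shows "norm (gf_approx z h) \<le> 1"
proof (induction h)
  case (Cons v h)
  have "norm (1 + (z - 1) / of_real (tree_size h + 1)) \<le> 1"
    using assms tree_size_ge_1[of h] by (intro norm_one_plus_le) auto
  then show ?case
    using Cons assms by (auto simp: norm_mult intro!: mult_le_one simp del: of_real_add)
qed simp

lemma length_hist_tree_le: "h \<in> set_pmf (hist_pmf n) \<Longrightarrow> w \<in> hist_tree h \<Longrightarrow> length w \<le> n"
  by (induction n arbitrary: h w) (fastforce simp: grow_def split: if_splits intro: le_SucI)+

text \<open>Heights at time \<open>n\<close> are at most \<open>n\<close>. For a fixed time the
  average is thus near 1 as \<open>z\<close> tends to 1, which controls the starting value of the
  late comparison.\<close>

lemma norm_height_gf_minus_1_le: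
  assumes "norm z = 1" "h \<in> set_pmf (hist_pmf n)"
  shows "norm (height_gf z h - 1) \<le> real n * norm (z - 1)"
proof -
  have "height_gf z h - 1 = (\<Sum>w\<in>hist_tree h. z ^ length w - 1) / of_real (tree_size h)"
    using tree_size_ge_1[of h]
    by (simp add: height_gf_def sum_subtractf field_simps tree_size_def)
  also have "norm \<dots> \<le> (\<Sum>w\<in>hist_tree h. norm (z ^ length w - 1)) / tree_size h"
    using tree_size_ge_1[of h] by (simp add: norm_divide divide_right_mono norm_sum)
  also have "\<dots> \<le> (\<Sum>w\<in>hist_tree h. real n * norm (z - 1)) / tree_size h"
  proof (intro divide_right_mono sum_mono)
    fix w assume "w \<in> hist_tree h"
    have "norm (z ^ length w - 1 ^ length w) \<le> real (length w) * norm (z - 1)"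
      using assms by (intro norm_power_diff) auto
    also have "\<dots> \<le> real n * norm (z - 1)"
      using length_hist_tree_le[OF assms(2) \<open>w \<in> hist_tree h\<close>] by (intro mult_right_mono) auto
    finally show "norm (z ^ length w - 1) \<le> real n * norm (z - 1)" by simp
  qed (use tree_size_ge_1[of h] in simp)
  also have "\<dots> = real n * norm (z - 1)"
    using tree_size_ge_1[of h] by (simp add: tree_size_def)
  finally show ?thesis .
qed

lemma norm_gf_approx_minus_1_le:
  assumes "norm z = 1"
  shows "norm (gf_approx z h - 1) \<le> real (length h) * norm (z - 1)"
proof (induction h)
  case (Cons v h)
  define a where "a = (if v = [] then z else 1 + (z - 1) / of_real (tree_size h + 1))"
  have "norm ((z - 1) / of_real (tree_size h + 1)) \<le> norm (z - 1)"
    using tree_size_ge_1[of h] divide_left_mono[of 1 "tree_size h + 1" "norm (z - 1)"]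
    by (simp add: norm_divide del: of_real_add)
  then have a: "norm (a - 1) \<le> norm (z - 1)"
    by (auto simp: a_def)
  have "norm (gf_approx z (v # h) - 1) = norm (gf_approx z h * (a - 1) + (gf_approx z h - 1))"
    by (simp add: a_def algebra_simps)
  also have "\<dots> \<le> norm (gf_approx z h) * norm (a - 1) + norm (gf_approx z h - 1)"
    by (metis norm_mult norm_triangle_ineq)
  also have "\<dots> \<le> 1 * norm (z - 1) + real (length h) * norm (z - 1)"
    using a Cons norm_gf_approx_le[OF assms, of h] by (intro add_mono mult_mono) auto
  finally show ?case by (simp add: algebra_simps)
qed simp

definition gf_error :: "complex \<Rightarrow> node list \<Rightarrow> complex" where
  "gf_error z h = height_gf z h - gf_approx z h"

lemma gf_error_root:
  "gf_error z ([] # h) = z * gf_error z h + (1 - z * height_gf z h) / of_real (2 * tree_size h + 1)"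
proof -
  have "of_real (2 * tree_size h + 1) \<noteq> (0 :: complex)"
    using tree_size_ge_1[of h] by (subst of_real_eq_0_iff) simp
  then show ?thesis
    unfolding gf_error_def height_gf_root by (simp add: field_simps)
qed

lemma gf_error_child:
  assumes "v \<noteq> []"
  shows "gf_error z (v # h) = (1 + (z - 1) / of_real (tree_size h + 1)) * gf_error z h
           + z * (z ^ length v - height_gf z h) / of_real (tree_size h + 1)"
proof -
  have "of_real (tree_size h + 1) \<noteq> (0 :: complex)"
    using tree_size_ge_1[of h] by (subst of_real_eq_0_iff) simp
  then show ?thesis
    unfolding gf_error_def height_gf_child[OF assms] using assms by (simp add: field_simps)
qed

lemma norm_gf_error_le: "norm z = 1 \<Longrightarrow> norm (gf_error z h) \<le> 2"
  using norm_triangle_ineq4[of "height_gf z h" "gf_approx z h"]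
    norm_height_gf_le[of z h] norm_gf_approx_le[of z h] by (simp add: gf_error_def)

text \<open>Pythagoras: an attachment multiplies the old error by a factor of modulus at most 1 and
  adds a fluctuation of size at most \<open>2 / N\<close> whose cross term averages out, so it
  enters only through its square. A doubling rotates the error by \<open>z\<close> up to
  \<open>O(1 / N)\<close>, with probability \<open>1 / N\<close>.\<close>

lemma step_avg_gf_error:
  assumes z: "norm z = 1"
  shows "step_avg (\<lambda>h. (norm (gf_error z h))\<^sup>2) h \<le> (norm (gf_error z h))\<^sup>2 + 17 / (tree_size h)\<^sup>2"
proof -
  define N where "N = tree_size h"
  define D where "D = gf_error z h"
  define a where "a = 1 + (z - 1) / of_real (N + 1)"
  define \<eta> where "\<eta> v = z * (z ^ length v - height_gf z h) / of_real (N + 1)" for v :: node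
  have N: "N \<ge> 1" using tree_size_ge_1 by (simp add: N_def)
  have D: "norm D \<le> 2" using norm_gf_error_le[OF z] by (simp add: D_def)
  have "norm a \<le> 1" unfolding a_def using z N by (intro norm_one_plus_le) auto
  then have aD: "norm (a * D) \<le> norm D" by (simp add: norm_mult mult_left_le_one_le)
  have \<eta>: "norm (\<eta> v) \<le> 2 / N" for v
  proof -
    have "norm (z ^ length v - height_gf z h) \<le> norm (z ^ length v) + norm (height_gf z h)"
      by (rule norm_triangle_ineq4)
    also have "\<dots> \<le> 2" using z norm_height_gf_le[OF z, of h] by (simp add: norm_power)
    finally have "norm (\<eta> v) \<le> 2 / (N + 1)"
      using z N by (simp add: \<eta>_def norm_mult norm_divide divide_right_mono del: of_real_add)
    also have "\<dots> \<le> 2 / N" using N by (intro divide_left_mono) auto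
    finally show ?thesis .
  qed
  \<comment> \<open>The attachment fluctuations cancel exactly over all nodes, the root included; the sum over the
    other nodes is obtained by exchanging the root term for the doubling term.\<close>
  have \<eta>_sum: "(\<Sum>v\<in>hist_tree h. \<eta> v) = 0"
    unfolding \<eta>_def sum_divide_distrib[symmetric] sum_distrib_left[symmetric] sum_subtractf sum_power_length
    by (simp add: tree_size_def)
  have sq_add: "(norm (x + y))\<^sup>2 = (norm x)\<^sup>2 + 2 * inner x y + (norm y)\<^sup>2" for x y :: complex
    by (simp add: power2_norm_eq_inner inner_add inner_commute)
  have "(\<Sum>v\<in>hist_tree h. (norm (a * D + \<eta> v))\<^sup>2) =
      N * (norm (a * D))\<^sup>2 + (\<Sum>v\<in>hist_tree h. (norm (\<eta> v))\<^sup>2)"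
    unfolding sq_add sum.distrib sum_distrib_left[symmetric] inner_sum_right[symmetric] \<eta>_sum
    by (simp add: N_def tree_size_def)
  also have "(\<Sum>v\<in>hist_tree h. (norm (\<eta> v))\<^sup>2) \<le> (\<Sum>v\<in>hist_tree h. (2 / N)\<^sup>2)"
    by (intro sum_mono power_mono \<eta>) auto
  also have "\<dots> = 4 / N"
    using N by (simp add: N_def tree_size_def power2_eq_square)
  finally have all: "(\<Sum>v\<in>hist_tree h. (norm (a * D + \<eta> v))\<^sup>2) \<le> N * (norm (a * D))\<^sup>2 + 4 / N"
    by simp
  have "\<bar>inner (a * D) (\<eta> [])\<bar> \<le> norm (a * D) * norm (\<eta> [])" by (rule Cauchy_Schwarz_ineq2)
  also have "\<dots> \<le> 2 * (2 / N)" using aD D \<eta> by (intro mult_mono) auto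
  finally have "\<bar>inner (a * D) (\<eta> [])\<bar> \<le> 4 / N" by simp
  then have "2 * inner (a * D) (\<eta> []) \<ge> - (8 / N)" by linarith
  then have root_old: "(norm (a * D + \<eta> []))\<^sup>2 \<ge> (norm (a * D))\<^sup>2 - 8 / N"
    using zero_le_power2[of "norm (\<eta> [])"] unfolding sq_add by linarith
  have "norm (1 - z * height_gf z h) \<le> 2"
    using norm_triangle_ineq4[of 1 "z * height_gf z h"] z norm_height_gf_le[OF z, of h]
    by (simp add: norm_mult)
  then have "norm ((1 - z * height_gf z h) / of_real (2 * N + 1)) \<le> 2 / (2 * N + 1)"
    using N by (simp only: norm_divide norm_of_real) (auto intro!: divide_right_mono)
  also have "\<dots> \<le> 1 / N" using N by (simp add: field_simps)
  finally have "norm (gf_error z ([] # h)) \<le> norm D + 1 / N"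
    unfolding gf_error_root D_def N_def
    using norm_triangle_ineq[of "z * gf_error z h" "(1 - z * height_gf z h) / of_real (2 * tree_size h + 1)"] z
    by (simp add: norm_mult)
  then have "(norm (gf_error z ([] # h)))\<^sup>2 \<le> (norm D + 1 / N)\<^sup>2" by (intro power_mono) auto
  also have "\<dots> = (norm D)\<^sup>2 + (2 * norm D + 1 / N) / N"
    by (simp add: power2_eq_square algebra_simps add_divide_distrib)
  also have "(2 * norm D + 1 / N) / N \<le> 5 / N"
    using N D by (intro divide_right_mono) (auto simp: divide_le_eq intro: add_mono[of _ 4 _ 1, simplified])
  finally have root_new: "(norm (gf_error z ([] # h)))\<^sup>2 \<le> (norm D)\<^sup>2 + 5 / N" by simp
  have "(\<Sum>v\<in>hist_tree h. (norm (gf_error z (v # h)))\<^sup>2)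
      = (norm (gf_error z ([] # h)))\<^sup>2 + (\<Sum>v\<in>hist_tree h - {[]}. (norm (gf_error z (v # h)))\<^sup>2)"
    by (rule sum.remove) auto
  also have "(\<Sum>v\<in>hist_tree h - {[]}. (norm (gf_error z (v # h)))\<^sup>2)
      = (\<Sum>v\<in>hist_tree h - {[]}. (norm (a * D + \<eta> v))\<^sup>2)"
    by (intro sum.cong) (auto simp: gf_error_child a_def D_def \<eta>_def N_def)
  also have "\<dots> = (\<Sum>v\<in>hist_tree h. (norm (a * D + \<eta> v))\<^sup>2) - (norm (a * D + \<eta> []))\<^sup>2"
    by (subst sum.remove[of "hist_tree h" "[]"]) auto
  finally have "(\<Sum>v\<in>hist_tree h. (norm (gf_error z (v # h)))\<^sup>2)
      \<le> ((norm D)\<^sup>2 + 5 / N) + (N * (norm (a * D))\<^sup>2 + 4 / N - ((norm (a * D))\<^sup>2 - 8 / N))"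
    using all root_old root_new by linarith
  \<comment> \<open>The 17 collects 5 from the doubling, 4 from the squared fluctuations and 8 from
    taking the root out of the attachment sum.\<close>
  also have "\<dots> = (norm D)\<^sup>2 + (N - 1) * (norm (a * D))\<^sup>2 + 17 / N"
    by (simp add: algebra_simps add_divide_distrib[symmetric])
  also have "(N - 1) * (norm (a * D))\<^sup>2 \<le> (N - 1) * (norm D)\<^sup>2"
    using N aD by (intro mult_left_mono power_mono) auto
  finally have "(\<Sum>v\<in>hist_tree h. (norm (gf_error z (v # h)))\<^sup>2) \<le> N * (norm D)\<^sup>2 + 17 / N"
    by (simp add: algebra_simps)
  then have "(\<Sum>v\<in>hist_tree h. (norm (gf_error z (v # h)))\<^sup>2) / N \<le> (N * (norm D)\<^sup>2 + 17 / N) / N"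
    using N by (intro divide_right_mono) auto
  also have "\<dots> = (norm D)\<^sup>2 + 17 / N\<^sup>2"
    using N by (simp add: field_simps power2_eq_square)
  finally show ?thesis
    by (simp add: step_avg_def D_def N_def divide_inverse mult.commute)
qed

lemma inverse_tree_size_square_le:
  "c \<ge> 0 \<Longrightarrow> c / (tree_size h)\<^sup>2 \<le> c / (real (length h) + 1)\<^sup>2"
  using tree_size_ge[of h] by (intro divide_left_mono power_mono mult_pos_pos zero_less_power) auto

text \<open>Starting at time \<open>m\<close> leaves only the tail \<open>17 / m\<close> of the
  summed errors. The starting value is small because \<open>height_gf\<close> and
  \<open>gf_approx\<close> are then both within \<open>m * norm (z - 1)\<close> of 1.\<close>

lemma hist_exp_gf_error_le:
  assumes "norm z = 1" "0 < m" "m \<le> n"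
  shows "hist_exp n (\<lambda>h. (norm (gf_error z h))\<^sup>2) \<le> (2 * real m * norm (z - 1))\<^sup>2 + 17 / real m"
proof -
  have "hist_exp n (\<lambda>h. (norm (gf_error z h))\<^sup>2) \<le>
      hist_exp m (\<lambda>h. (norm (gf_error z h))\<^sup>2) + (\<Sum>k\<in>{m..<n}. 17 / (real k + 1)\<^sup>2)"
  proof (rule hist_exp_le_sum)
    show "step_avg (\<lambda>h. (norm (gf_error z h))\<^sup>2) h \<le> (norm (gf_error z h))\<^sup>2 + 17 / (real (length h) + 1)\<^sup>2" for h
      using step_avg_gf_error[OF assms(1), of h] inverse_tree_size_square_le[of 17 h] by simp
  qed fact
  also have "(\<Sum>k\<in>{m..<n}. 17 / (real k + 1)\<^sup>2) = 17 * (\<Sum>k\<in>{m..<n}. 1 / (real k + 1)\<^sup>2)"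
    by (simp add: sum_distrib_left)
  also have "\<dots> \<le> 17 / real m" using sum_inverse_squares_le[OF assms(2), of n] by simp
  also have "hist_exp m (\<lambda>h. (norm (gf_error z h))\<^sup>2) \<le> hist_exp m (\<lambda>h. (2 * real m * norm (z - 1))\<^sup>2)"
  proof (rule hist_exp_mono)
    fix h :: "node list" assume "h \<in> set_pmf (hist_pmf m)" "length h = m"
    have "norm (gf_error z h) = norm ((height_gf z h - 1) - (gf_approx z h - 1))"
      by (simp add: gf_error_def)
    also have "\<dots> \<le> norm (height_gf z h - 1) + norm (gf_approx z h - 1)"
      by (rule norm_triangle_ineq4)
    also have "\<dots> \<le> real m * norm (z - 1) + real m * norm (z - 1)"
      using norm_height_gf_minus_1_le[OF assms(1) \<open>h \<in> set_pmf (hist_pmf m)\<close>]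
        norm_gf_approx_minus_1_le[OF assms(1), of h] \<open>length h = m\<close>
      by (intro add_mono) auto
    finally show "(norm (gf_error z h))\<^sup>2 \<le> (2 * real m * norm (z - 1))\<^sup>2"
      by (intro power_mono) auto
  qed
  finally show ?thesis by simp
qed

section \<open>Doublings and the logarithm of the size\<close>

lemma recip_sum_nonneg: "recip_sum h \<ge> 0"
  by (induction h) (auto simp: tree_size_def)

text \<open>Bounds the clock by about \<open>log n\<close> for every history, not merely in mean;
  exponents can therefore be bounded uniformly.\<close>

lemma recip_sum_le_harm: "recip_sum h \<le> harm (length h)"
proof (induction h)
  case (Cons v h)
  have "1 / tree_size h \<le> inverse (of_nat (Suc (length h)))"
    using tree_size_ge[of h] by (auto simp: inverse_eq_divide intro!: divide_left_mono)
  with Cons show ?case by (simp add: harm_Suc)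
qed (simp add: harm_def)

lemma harm_le_ln: "n \<ge> 1 \<Longrightarrow> (harm n :: real) \<le> 1 + ln (real n)"
  using euler_mascheroni_sequence_decreasing[of 1 n] by (simp add: harm_expand)

section \<open>Comparison of the height average with a Poisson characteristic function\<close>

text \<open>The characteristic function at \<open>\<alpha>\<close> of \<open>P\<close> plus a
  Poisson variable of mean \<open>s\<close>, where \<open>P = doublings h\<close> and
  \<open>s = recip_sum h\<close>.\<close>

definition phase :: "real \<Rightarrow> node list \<Rightarrow> complex" where
  "phase \<alpha> h = exp (\<i> * of_real (\<alpha> * doublings h) + (exp (\<i> * of_real \<alpha>) - 1) * of_real (recip_sum h))"

lemma Re_iexp_minus_1_le: "Re (exp (\<i> * of_real \<alpha>) - 1) \<le> 0"
  by (simp add: Re_exp)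

text \<open>The clock advances by \<open>1 / N\<close> at a doubling too, hence the second
  exponential factor.\<close>

lemma phase_root:
  "phase \<alpha> ([] # h) = exp (\<i> * of_real \<alpha>) * exp ((exp (\<i> * of_real \<alpha>) - 1) / of_real (tree_size h)) * phase \<alpha> h"
  unfolding phase_def by (simp add: exp_add[symmetric] algebra_simps add_divide_distrib diff_divide_distrib)

lemma phase_child:
  "v \<noteq> [] \<Longrightarrow> phase \<alpha> (v # h) = exp ((exp (\<i> * of_real \<alpha>) - 1) / of_real (tree_size h)) * phase \<alpha> h"
  unfolding phase_def by (simp add: exp_add[symmetric] algebra_simps add_divide_distrib diff_divide_distrib)

lemma norm_phase_le: "norm (phase \<alpha> h) \<le> 1"
proof -
  have "Re (exp (\<i> * of_real \<alpha>) - 1) * recip_sum h \<le> 0"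
    using Re_iexp_minus_1_le recip_sum_nonneg by (rule mult_nonpos_nonneg)
  then show ?thesis by (simp add: phase_def norm_exp_eq_Re)
qed

lemma norm_iexp_minus_1_le: "norm (exp (\<i> * of_real \<alpha>) - 1) \<le> \<bar>\<alpha>\<bar>"
  using iexp_approx1[of \<alpha> 0] by simp

text \<open>With \<open>w = (z - 1) / N\<close>, the factors \<open>z\<close> and
  \<open>z * exp w\<close> at a doubling differ by at most \<open>norm (z - 1) / N\<close>, and
  those at an attachment, \<open>1 + (z - 1) / (N + 1)\<close> and \<open>exp w\<close>, by a
  multiple of \<open>norm (z - 1) / N\<^sup>2\<close>. As the total error vanishes with
  \<open>\<alpha>\<close>, no late start is needed here.\<close>

lemma step_avg_gf_approx_phase:
  fixes \<alpha> :: real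
  defines "z \<equiv> exp (\<i> * of_real \<alpha>)"
  shows "step_avg (\<lambda>h. norm (gf_approx z h - phase \<alpha> h)) h
    \<le> norm (gf_approx z h - phase \<alpha> h) + (2 + 2 * exp 2) * norm (z - 1) / (tree_size h)\<^sup>2"
proof -
  define N where "N = tree_size h"
  define \<delta> where "\<delta> = norm (z - 1)"
  define w where "w = (z - 1) / of_real N"
  define x where "x = norm (gf_approx z h - phase \<alpha> h)"
  have N: "N \<ge> 1" using tree_size_ge_1 by (simp add: N_def)
  have z: "norm z = 1" by (simp add: z_def)
  have \<delta>: "\<delta> \<ge> 0" "\<delta> \<le> 2"
    using norm_triangle_ineq4[of z 1] z by (auto simp: \<delta>_def)
  have w: "norm w = \<delta> / N" using N by (simp add: w_def \<delta>_def norm_divide)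
  have Re_w: "Re w \<le> 0"
    using N Re_iexp_minus_1_le[of \<alpha>] by (simp add: w_def z_def divide_le_0_iff)
  have "\<delta> / N \<le> 2" using \<delta> N by (simp add: divide_le_eq)
  then have Re_w': "\<bar>Re w\<bar> \<le> 2" using abs_Re_le_cmod[of w] w by linarith
  have step: "norm (a * gf_approx z h - b * phase \<alpha> h) \<le> x + norm (a - b)"
    if "norm a \<le> 1" for a b
  proof -
    have "a * gf_approx z h - b * phase \<alpha> h = a * (gf_approx z h - phase \<alpha> h) + (a - b) * phase \<alpha> h"
      by (simp add: algebra_simps)
    also have "norm \<dots> \<le> norm a * x + norm (a - b) * norm (phase \<alpha> h)"
      unfolding x_def norm_mult[symmetric] by (rule norm_triangle_ineq)
    also have "\<dots> \<le> 1 * x + norm (a - b) * 1"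
      using that norm_phase_le by (intro add_mono mult_mono) (auto simp: x_def)
    finally show ?thesis by simp
  qed
  have "norm (exp w - 1) \<le> \<delta> / N"
    using norm_exp_diff_le[of w 0 0] Re_w w by simp
  then have "norm (z - z * exp w) \<le> \<delta> / N"
    using z by (metis mult.right_neutral mult_1 norm_minus_commute norm_mult right_diff_distrib)
  then have root: "norm (gf_approx z ([] # h) - phase \<alpha> ([] # h)) \<le> x + \<delta> / N"
    using step[of z "z * exp w"] z unfolding phase_root
    by (simp add: z_def[symmetric] N_def[symmetric] w_def mult_ac)
  have "norm (1 + (z - 1) / of_real (N + 1) - exp w) \<le>
      norm ((z - 1) / of_real (N + 1) - w) + norm (exp w - 1 - w)"
    using norm_triangle_ineq4[of "(z - 1) / of_real (N + 1) - w" "exp w - 1 - w"]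
    by (simp add: algebra_simps)
  also have "(z - 1) / of_real (N + 1) - w = (z - 1) * of_real (1 / (N + 1) - 1 / N)"
    by (simp add: w_def algebra_simps)
  also have "norm \<dots> = \<delta> * (1 / (N * (N + 1)))"
  proof -
    have "1 / (N + 1) - 1 / N = - (1 / (N * (N + 1)))" using N by (simp add: field_simps)
    then show ?thesis
      unfolding norm_mult norm_of_real using N by (simp add: \<delta>_def)
  qed
  also have "1 / (N * (N + 1)) \<le> 1 / N\<^sup>2"
    using N by (intro divide_left_mono) (auto simp: power2_eq_square)
  also have "norm (exp w - 1 - w) \<le> exp 2 * (norm w)\<^sup>2"
    by (rule norm_exp_minus_one_minus_self_le) fact
  \<comment> \<open>Since \<open>\<delta> \<le> 2\<close>, the square
    \<open>\<delta>\<^sup>2\<close> is weakened to \<open>2 * \<delta>\<close>, to match the other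
    term.\<close>
  also have "(norm w)\<^sup>2 \<le> 2 * \<delta> / N\<^sup>2"
    unfolding w power_divide using \<delta> by (intro divide_right_mono) (auto simp: power2_eq_square mult_right_mono)
  finally have "norm (1 + (z - 1) / of_real (N + 1) - exp w) \<le> \<delta> * (1 / N\<^sup>2) + exp 2 * (2 * \<delta> / N\<^sup>2)"
    using \<delta> by (simp add: mult_left_mono)
  also have "\<dots> = (1 + 2 * exp 2) * \<delta> / N\<^sup>2"
    by (simp add: algebra_simps add_divide_distrib)
  finally have child: "norm (gf_approx z (v # h) - phase \<alpha> (v # h)) \<le> x + (1 + 2 * exp 2) * \<delta> / N\<^sup>2"
    if "v \<noteq> []" for v
    using step[of "1 + (z - 1) / of_real (N + 1)" "exp w"] norm_one_plus_le[OF z, of N] N that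
    by (simp add: phase_child z_def[symmetric] N_def[symmetric] w_def mult_ac)
  have "step_avg (\<lambda>h. norm (gf_approx z h - phase \<alpha> h)) h \<le>
      x + (1 + 2 * exp 2) * \<delta> / N\<^sup>2 + (\<delta> / N) / tree_size h"
    using child root \<delta> by (intro step_avg_le) auto
  also have "\<dots> = x + (2 + 2 * exp 2) * \<delta> / N\<^sup>2"
    by (simp add: N_def[symmetric] power2_eq_square add_divide_distrib algebra_simps)
  finally show ?thesis by (simp add: x_def \<delta>_def N_def)
qed

lemma hist_exp_le_square_sum:
  fixes F :: "node list \<Rightarrow> real"
  assumes "\<And>h. step_avg F h \<le> F h + c / (tree_size h)\<^sup>2" "c \<ge> 0"
  shows "hist_exp n F \<le> F [] + 2 * c"
proof -
  have "hist_exp n F \<le> hist_exp 0 F + (\<Sum>k\<in>{0..<n}. c / (real k + 1)\<^sup>2)"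
  proof (rule hist_exp_le_sum)
    show "step_avg F h \<le> F h + c / (real (length h) + 1)\<^sup>2" for h
      using assms(1)[of h] inverse_tree_size_square_le[OF assms(2), of h] by simp
  qed simp
  also have "(\<Sum>k\<in>{0..<n}. c / (real k + 1)\<^sup>2) = c * (\<Sum>k\<in>{0..<n}. 1 / (real k + 1)\<^sup>2)"
    by (simp add: sum_distrib_left)
  also have "\<dots> \<le> c * 2" by (intro mult_left_mono sum_inverse_squares_le_2 assms)
  finally show ?thesis by simp
qed

lemma hist_exp_gf_approx_phase_le:
  "hist_exp n (\<lambda>h. norm (gf_approx (exp (\<i> * of_real \<alpha>)) h - phase \<alpha> h)) \<le> 2 * (2 + 2 * exp 2) * \<bar>\<alpha>\<bar>"
proof -
  have "hist_exp n (\<lambda>h. norm (gf_approx (exp (\<i> * of_real \<alpha>)) h - phase \<alpha> h))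
      \<le> norm (gf_approx (exp (\<i> * of_real \<alpha>)) [] - phase \<alpha> []) + 2 * ((2 + 2 * exp 2) * norm (exp (\<i> * of_real \<alpha>) - 1))"
    using step_avg_gf_approx_phase by (rule hist_exp_le_square_sum) simp
  also have "gf_approx (exp (\<i> * of_real \<alpha>)) [] - phase \<alpha> [] = 0"
    by (simp add: phase_def)
  also have "norm (0::complex) + 2 * ((2 + 2 * exp 2) * norm (exp (\<i> * of_real \<alpha>) - 1)) \<le> 2 * ((2 + 2 * exp 2) * \<bar>\<alpha>\<bar>)"
    using norm_iexp_minus_1_le[of \<alpha>] by (simp add: mult_left_mono)
  finally show ?thesis by (simp add: mult_ac)
qed

text \<open>A martingale only up to a relative error \<open>O(\<beta>\<^sup>2 / N\<^sup>2)\<close> per step.\<close>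

definition doubling_martingale :: "real \<Rightarrow> node list \<Rightarrow> complex" where
  "doubling_martingale \<beta> h =
     exp (\<i> * of_real (\<beta> * doublings h) - (exp (\<i> * of_real \<beta>) - 1) * of_real (recip_sum h))"

text \<open>With \<open>w = (exp (\<i> * \<beta>) - 1) / N\<close> the mean one-step factor is
  \<open>exp (- w) * (1 + w)\<close>, because a doubling has probability \<open>1 / N\<close>. It
  differs from 1 only to second order in \<open>w\<close>.\<close>

lemma norm_step_avg_doubling_martingale:
  "norm (step_avg (doubling_martingale \<beta>) h - doubling_martingale \<beta> h)
     \<le> norm (doubling_martingale \<beta> h) * (exp 4 * \<beta>\<^sup>2 / (tree_size h)\<^sup>2)"
proof -
  define N where "N = tree_size h"
  define \<zeta> where "\<zeta> = exp (\<i> * of_real \<beta>)"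
  define w where "w = (\<zeta> - 1) / of_real N"
  define G where "G = doubling_martingale \<beta> h"
  have N: "N \<ge> 1" using tree_size_ge_1 by (simp add: N_def)
  have "norm (\<zeta> - 1) \<le> 2" using norm_triangle_ineq4[of \<zeta> 1] by (simp add: \<zeta>_def)
  then have w2: "norm w \<le> 2"
    using N by (simp add: w_def norm_divide divide_le_eq) 
  have "norm w \<le> \<bar>\<beta>\<bar> / N"
    using N norm_iexp_minus_1_le[of \<beta>] by (simp add: w_def \<zeta>_def norm_divide divide_right_mono)
  then have "(norm w)\<^sup>2 \<le> (\<bar>\<beta>\<bar> / N)\<^sup>2" by (intro power_mono) auto
  then have w3: "(norm w)\<^sup>2 \<le> \<beta>\<^sup>2 / N\<^sup>2" by (simp add: power_divide)
  have Re_w: "\<bar>Re w\<bar> \<le> 2" using abs_Re_le_cmod[of w] w2 by linarith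
  have child: "doubling_martingale \<beta> (v # h) = G * exp (- w)" if "v \<noteq> []" for v
    unfolding G_def doubling_martingale_def using that
    by (simp add: exp_add[symmetric] \<zeta>_def[symmetric] N_def[symmetric] w_def algebra_simps diff_divide_distrib)
  have root: "doubling_martingale \<beta> ([] # h) = G * exp (- w) * \<zeta>"
    unfolding G_def doubling_martingale_def
    by (simp add: exp_add[symmetric] \<zeta>_def N_def[symmetric] w_def algebra_simps diff_divide_distrib)
  have "step_avg (doubling_martingale \<beta>) h = G * exp (- w) + (G * exp (- w) * \<zeta> - G * exp (- w)) /\<^sub>R tree_size h"
    using child by (subst step_avg_eq) (auto simp: root)
  also have "\<dots> = G * exp (- w) * (1 + w)"
    by (simp add: w_def N_def[symmetric] scaleR_conv_of_real field_simps)
  finally have "step_avg (doubling_martingale \<beta>) h - G = - (G * exp (- w) * (exp w - 1 - w))"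
    by (simp add: algebra_simps exp_minus_inverse exp_minus)
  then have "norm (step_avg (doubling_martingale \<beta>) h - G) = norm G * (norm (exp (- w)) * norm (exp w - 1 - w))"
    by (simp add: norm_mult)
  also have "\<dots> \<le> norm G * (exp 2 * (exp 2 * (norm w)\<^sup>2))"
    using norm_exp_minus_one_minus_self_le[OF Re_w] Re_w
    by (intro mult_left_mono mult_mono) (auto simp: norm_exp_eq_Re)
  also have "exp 2 * (exp 2 * (norm w)\<^sup>2) = exp (4::real) * (norm w)\<^sup>2"
    by (simp add: mult.assoc[symmetric] exp_add[symmetric])
  also have "norm G * (exp 4 * (norm w)\<^sup>2) \<le> norm G * (exp 4 * (\<beta>\<^sup>2 / N\<^sup>2))"
    using w3 by (intro mult_left_mono) auto
  finally show ?thesis by (simp add: G_def N_def)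
qed

text \<open>The modulus is \<open>exp ((1 - cos \<beta>) * recip_sum h)\<close>, which unlike that
  of \<open>phase\<close> may exceed 1. It stays bounded since
  \<open>1 - cos \<beta> \<le> \<beta>\<^sup>2\<close>, and \<open>\<beta>\<^sup>2\<close> will be
  of order \<open>1 / log n\<close>.\<close>

lemma norm_doubling_martingale_le:
  assumes "\<beta>\<^sup>2 * recip_sum h \<le> K"
  shows "norm (doubling_martingale \<beta> h) \<le> exp K"
proof -
  define r where "r = iexp \<beta> - (\<Sum>k\<le>1. (\<i> * of_real \<beta>) ^ k / fact k)"
  have "1 - cos \<beta> \<le> \<bar>Re r\<bar>" by (simp add: r_def Re_exp)
  also have "\<dots> \<le> norm r" by (rule abs_Re_le_cmod)
  also have "\<dots> \<le> \<bar>\<beta>\<bar> ^ Suc 1 / fact (Suc 1)" unfolding r_def by (rule iexp_approx1)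
  also have "\<dots> \<le> \<beta>\<^sup>2" by (simp add: power2_eq_square)
  finally have "1 - cos \<beta> \<le> \<beta>\<^sup>2" .
  then have "(1 - cos \<beta>) * recip_sum h \<le> \<beta>\<^sup>2 * recip_sum h"
    by (intro mult_right_mono recip_sum_nonneg)
  with assms show ?thesis
    by (simp add: doubling_martingale_def norm_exp_eq_Re Re_exp algebra_simps)
qed

text \<open>Sums the one-step errors. The angle is tied to the final time \<open>n\<close>, so the
  induction runs over \<open>m \<le> n\<close> with the bound \<open>exp K\<close> valid
  throughout.\<close>

lemma hist_exp_doubling_martingale:
  assumes "\<beta>\<^sup>2 * harm n \<le> K"
  shows "norm (hist_exp n (doubling_martingale \<beta>) - 1) \<le> 2 * exp K * exp 4 * \<beta>\<^sup>2"
proof -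
  have "norm (hist_exp m (doubling_martingale \<beta>) - 1) \<le> (\<Sum>k\<in>{0..<m}. exp K * exp 4 * \<beta>\<^sup>2 / (real k + 1)\<^sup>2)"
    if "m \<le> n" for m
    using that
  proof (induction m)
    case 0
    then show ?case by (simp add: doubling_martingale_def)
  next
    case (Suc m)
    have "norm (hist_exp (Suc m) (doubling_martingale \<beta>) - hist_exp m (doubling_martingale \<beta>))
        = norm (hist_exp m (\<lambda>h. step_avg (doubling_martingale \<beta>) h - doubling_martingale \<beta> h))"
      by (simp only: hist_exp_Suc) (subst Bochner_Integration.integral_diff; simp)
    also have "\<dots> \<le> hist_exp m (\<lambda>h. norm (step_avg (doubling_martingale \<beta>) h - doubling_martingale \<beta> h))"
      by (rule integral_norm_bound)
    also have "\<dots> \<le> hist_exp m (\<lambda>h. exp K * exp 4 * \<beta>\<^sup>2 / (real m + 1)\<^sup>2)"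
    proof (rule hist_exp_mono)
      fix h :: "node list" assume h: "length h = m"
      have "\<beta>\<^sup>2 * recip_sum h \<le> \<beta>\<^sup>2 * harm n"
        using recip_sum_le_harm[of h] harm_mono[of m n, where ?'a = real] h Suc.prems
        by (intro mult_left_mono) auto
      then have "norm (doubling_martingale \<beta> h) \<le> exp K"
        using assms by (intro norm_doubling_martingale_le) simp
      have "norm (step_avg (doubling_martingale \<beta>) h - doubling_martingale \<beta> h)
          \<le> norm (doubling_martingale \<beta> h) * (exp 4 * \<beta>\<^sup>2 / (tree_size h)\<^sup>2)"
        by (rule norm_step_avg_doubling_martingale)
      also have "\<dots> \<le> exp K * (exp 4 * \<beta>\<^sup>2 / (real m + 1)\<^sup>2)"
        using \<open>norm (doubling_martingale \<beta> h) \<le> exp K\<close> inverse_tree_size_square_le[of "exp 4 * \<beta>\<^sup>2" h] h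
        by (intro mult_mono) auto
      finally show "norm (step_avg (doubling_martingale \<beta>) h - doubling_martingale \<beta> h)
          \<le> exp K * exp 4 * \<beta>\<^sup>2 / (real m + 1)\<^sup>2" by simp
    qed
    finally have "norm (hist_exp (Suc m) (doubling_martingale \<beta>) - hist_exp m (doubling_martingale \<beta>))
        \<le> exp K * exp 4 * \<beta>\<^sup>2 / (real m + 1)\<^sup>2" by simp
    moreover have "norm (hist_exp (Suc m) (doubling_martingale \<beta>) - 1)
        \<le> norm (hist_exp (Suc m) (doubling_martingale \<beta>) - hist_exp m (doubling_martingale \<beta>))
          + norm (hist_exp m (doubling_martingale \<beta>) - 1)"
      by (rule order_trans[OF _ norm_triangle_ineq]) simp
    ultimately show ?case using Suc by simp
  qed
  from this[of n] have "norm (hist_exp n (doubling_martingale \<beta>) - 1)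
      \<le> (exp K * exp 4 * \<beta>\<^sup>2) * (\<Sum>k\<in>{0..<n}. 1 / (real k + 1)\<^sup>2)"
    by (simp add: sum_distrib_left)
  also have "\<dots> \<le> (exp K * exp 4 * \<beta>\<^sup>2) * 2"
    by (intro mult_left_mono sum_inverse_squares_le_2) auto
  finally show ?thesis by simp
qed

section \<open>The logarithm of the size, and the variance of the number of doublings\<close>

text \<open>An attachment adds one node and a doubling, of probability \<open>1 / N\<close>, adds
  \<open>N + 1\<close>: the mean increment is exactly 2.\<close>

lemma hist_exp_tree_size: "hist_exp n tree_size = 2 * real n + 1"
proof (induction n)
  case (Suc n)
  have "step_avg tree_size h = tree_size h + 2" for h
    using tree_size_ge_1[of h] by (subst step_avg_eq) (auto simp: field_simps)
  then have "step_avg tree_size = (\<lambda>h. tree_size h + 2)" by blast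
  with Suc show ?case by (simp only: hist_exp_Suc) simp
qed simp

text \<open>An attachment changes \<open>F\<close> by \<open>1 / N - ln (1 + 1 / N)\<close>, which
  lies between 0 and \<open>1 / N\<^sup>2\<close>. A doubling changes it by
  \<open>1 / N - ln (1 + 1 / (2 * N))\<close>, at most \<open>1 / N\<close>, because the term in
  \<open>doublings\<close> cancels the main part \<open>ln 2\<close>.\<close>

lemma step_avg_log_size:
  fixes F :: "node list \<Rightarrow> real"
  defines "F \<equiv> \<lambda>h. recip_sum h + ln 2 * doublings h - ln (tree_size h)"
  shows "step_avg (\<lambda>h. \<bar>F h\<bar>) h \<le> \<bar>F h\<bar> + 2 / (tree_size h)\<^sup>2"
proof -
  define N where "N = tree_size h"
  have N: "N \<ge> 1" using tree_size_ge_1 by (simp add: N_def)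
  have "2 * N + 1 = N * (2 * (1 + 1 / (2 * N)))" using N by (simp add: field_simps)
  moreover have "0 < 1 + 1 / (2 * N)" using N by (simp add: add_pos_pos)
  ultimately have "ln (2 * N + 1) = ln N + (ln 2 + ln (1 + 1 / (2 * N)))"
    using N ln_mult_pos[of N "2 * (1 + 1 / (2 * N))"] ln_mult_pos[of 2 "1 + 1 / (2 * N)"] by simp
  then have "F ([] # h) = F h + (1 / N - ln (1 + 1 / (2 * N)))"
    by (simp add: F_def N_def[symmetric] algebra_simps)
  moreover have "0 \<le> ln (1 + 1 / (2 * N))" "ln (1 + 1 / (2 * N)) \<le> 1 / (2 * N)"
    using N by (auto intro!: ln_add_one_self_le_self)
  moreover have "1 / (2 * N) \<le> 1 / N" using N by (simp add: field_simps)
  ultimately have root: "\<bar>F ([] # h)\<bar> \<le> \<bar>F h\<bar> + 1 / N"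
    by linarith
  have "N + 1 = N * (1 + 1 / N)" using N by (simp add: field_simps)
  moreover have "0 < 1 + 1 / N" using N by (simp add: add_pos_pos)
  ultimately have "ln (N + 1) = ln N + ln (1 + 1 / N)"
    using N ln_mult_pos[of N "1 + 1 / N"] by simp
  moreover have "ln (1 + 1 / N) \<le> 1 / N"
    using N by (intro ln_add_one_self_le_self) auto
  moreover have "1 / N - (1 / N)\<^sup>2 \<le> ln (1 + 1 / N)"
    using N by (intro ln_one_plus_pos_lower_bound) auto
  ultimately have child: "\<bar>F (v # h)\<bar> \<le> \<bar>F h\<bar> + 1 / N\<^sup>2" if "v \<noteq> []" for v
    using that by (simp add: F_def N_def[symmetric] algebra_simps power_divide)
  have "step_avg (\<lambda>h. \<bar>F h\<bar>) h \<le> \<bar>F h\<bar> + 1 / N\<^sup>2 + (1 / N) / tree_size h"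
    using child root by (intro step_avg_le) auto
  then show ?thesis by (simp add: N_def power2_eq_square)
qed

text \<open>Of the 6, 4 is the accumulated one-step error and 2 pays for replacing
  \<open>ln (tree_size h)\<close> by \<open>ln n\<close>, through \<open>ln x \<le> x - 1\<close>
  and the mean size \<open>2 * n + 1\<close>.\<close>

lemma hist_exp_log_size_le:
  assumes "n \<ge> 1"
  shows "hist_exp n (\<lambda>h. \<bar>recip_sum h + ln 2 * doublings h - ln (real n)\<bar>) \<le> 6"
proof -
  have "hist_exp n (\<lambda>h. \<bar>recip_sum h + ln 2 * doublings h - ln (real n)\<bar>)
      \<le> hist_exp n (\<lambda>h. \<bar>recip_sum h + ln 2 * doublings h - ln (tree_size h)\<bar> + (tree_size h / real n - 1))"
  proof (rule hist_exp_mono)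
    fix h :: "node list" assume "length h = n"
    then have size: "tree_size h \<ge> real n + 1" using tree_size_ge[of h] by simp
    have "ln (tree_size h) - ln (real n) = ln (tree_size h / real n)"
      using size assms by (simp add: ln_div)
    also have "\<dots> \<le> tree_size h / real n - 1"
      using size assms by (intro ln_le_minus_one) auto
    finally have "ln (tree_size h) - ln (real n) \<le> tree_size h / real n - 1" .
    moreover have "ln (real n) \<le> ln (tree_size h)" using size assms by simp
    ultimately show "\<bar>recip_sum h + ln 2 * doublings h - ln (real n)\<bar>
        \<le> \<bar>recip_sum h + ln 2 * doublings h - ln (tree_size h)\<bar> + (tree_size h / real n - 1)"
      by linarith
  qed
  also have "\<dots> = hist_exp n (\<lambda>h. \<bar>recip_sum h + ln 2 * doublings h - ln (tree_size h)\<bar>)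
      + ((2 * real n + 1) / real n - 1)"
    by (simp add: hist_exp_tree_size)
  also have "hist_exp n (\<lambda>h. \<bar>recip_sum h + ln 2 * doublings h - ln (tree_size h)\<bar>)
      \<le> \<bar>recip_sum [] + ln 2 * doublings [] - ln (tree_size [])\<bar> + 2 * 2"
    using step_avg_log_size by (rule hist_exp_le_square_sum) simp
  also have "(2 * real n + 1) / real n - 1 \<le> 2"
    using assms by (simp add: field_simps)
  finally show ?thesis by simp
qed

text \<open>\<open>doublings - recip_sum\<close> is a martingale whose conditional variance is
  \<open>1 / N - 1 / N\<^sup>2\<close>, and \<open>N\<close> is at least the time plus 1.\<close>

lemma hist_exp_doublings_variance_le: "hist_exp n (\<lambda>h. (doublings h - recip_sum h)\<^sup>2) \<le> harm n"
proof (induction n)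
  case (Suc n)
  define F where "F h = (doublings h - recip_sum h)\<^sup>2" for h
  have "step_avg F h \<le> F h + inverse (real (length h) + 1)" for h
  proof -
    define N where "N = tree_size h"
    define Q where "Q = doublings h - recip_sum h"
    have N: "N \<ge> 1" using tree_size_ge_1 by (simp add: N_def)
    have "step_avg F h = (Q - 1 / N)\<^sup>2 + ((Q + 1 - 1 / N)\<^sup>2 - (Q - 1 / N)\<^sup>2) / N"
      by (subst step_avg_eq[where c = "(Q - 1 / N)\<^sup>2"])
        (auto simp: F_def Q_def N_def algebra_simps divide_inverse)
    also have "\<dots> = Q\<^sup>2 + 1 / N - 1 / N\<^sup>2"
      using N by (simp add: field_simps power2_eq_square)
    also have "\<dots> \<le> Q\<^sup>2 + 1 / N" by simp
    also have "1 / N \<le> inverse (real (length h) + 1)"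
      using tree_size_ge[of h] by (auto simp: N_def inverse_eq_divide intro!: divide_left_mono)
    finally show ?thesis by (simp add: F_def Q_def)
  qed
  then have "hist_exp n (step_avg F) \<le> hist_exp n (\<lambda>h. F h + inverse (real n + 1))"
    by (intro hist_exp_mono) auto
  with Suc show ?case
    unfolding F_def[symmetric] by (simp only: hist_exp_Suc) (simp add: F_def harm_Suc add.commute)
qed (simp add: harm_def)

section \<open>Limits on the logarithmic scale\<close>

definition log_scale :: "nat \<Rightarrow> real" where
  "log_scale n = ln (real n) / (1 + ln 2)"

lemma ln2_bounds: "0 < ln (2::real)" "ln (2::real) < 1"
  using ln_2_less_1 by auto

lemma log_scale_at_top: "filterlim log_scale at_top sequentially"
proof -
  have "filterlim (\<lambda>n. ln (real n) / c) at_top sequentially" if "c > 0" for c :: real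
    using that by real_asymp
  from this[of "1 + ln 2"] show ?thesis
    using ln2_bounds(1) by (simp add: log_scale_def[abs_def])
qed

lemma log_scale_ge_1: "eventually (\<lambda>n. log_scale n \<ge> 1 \<and> n \<ge> 1) sequentially"
  using filterlim_at_top[THEN iffD1, OF log_scale_at_top, rule_format, of 1]
    eventually_ge_at_top[of 1] by eventually_elim auto

lemma ln_eq_log_scale: "ln (real n) = (1 + ln 2) * log_scale n"
proof -
  have "1 + ln (2::real) \<noteq> 0" using ln2_bounds(1) by linarith
  then show ?thesis by (simp add: log_scale_def)
qed

lemma harm_le_log_scale:
  assumes "log_scale n \<ge> 1" "n \<ge> 1"
  shows "harm n \<le> 3 * log_scale n"
proof -
  have "harm n \<le> 1 + (1 + ln 2) * log_scale n"
    using harm_le_ln[OF assms(2)] by (simp add: ln_eq_log_scale)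
  also have "\<dots> \<le> log_scale n + 2 * log_scale n"
    using assms ln2_bounds by (intro add_mono mult_right_mono) auto
  finally show ?thesis by simp
qed

lemma hist_exp_abs_le_sqrt:
  fixes F :: "node list \<Rightarrow> real"
  shows "hist_exp n (\<lambda>h. \<bar>F h\<bar>) \<le> sqrt (hist_exp n (\<lambda>h. (F h)\<^sup>2))"
proof (rule real_le_rsqrt)
  have "0 \<le> measure_pmf.variance (hist_pmf n) (\<lambda>h. \<bar>F h\<bar>)"
    by (rule measure_pmf.variance_positive)
  then show "(hist_exp n (\<lambda>h. \<bar>F h\<bar>))\<^sup>2 \<le> hist_exp n (\<lambda>h. (F h)\<^sup>2)"
    by (subst (asm) measure_pmf.variance_eq) simp_all
qed

definition log_defect :: "nat \<Rightarrow> node list \<Rightarrow> real" where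
  "log_defect n h = recip_sum h + ln 2 * doublings h - ln (real n)"

definition centered_doublings :: "node list \<Rightarrow> real" where
  "centered_doublings h = doublings h - recip_sum h"

text \<open>Solves the two relations \<open>P - s = centered_doublings h\<close> and
  \<open>s + ln 2 * P = ln n + log_defect n h\<close> for \<open>s\<close>.\<close>

lemma recip_sum_ratio_minus_1:
  assumes "log_scale n > 0"
  shows "recip_sum h / log_scale n - 1 = (log_defect n h - ln 2 * centered_doublings h) / ((1 + ln 2) * log_scale n)"
proof -
  have "(1 + ln 2) * (recip_sum h - log_scale n) = log_defect n h - ln 2 * centered_doublings h"
    by (simp add: log_defect_def centered_doublings_def ln_eq_log_scale algebra_simps)
  moreover have "1 + ln (2::real) \<noteq> 0" using ln2_bounds(1) by linarith
  then have "recip_sum h / log_scale n - 1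
      = (1 + ln 2) * (recip_sum h - log_scale n) / ((1 + ln 2) * log_scale n)"
    using assms by (simp add: diff_divide_distrib)
  ultimately show ?thesis by simp
qed

lemma hist_exp_log_defect_tendsto:
  "(\<lambda>n. hist_exp n (\<lambda>h. \<bar>log_defect n h\<bar> / sqrt (log_scale n))) \<longlonglongrightarrow> 0"
proof (rule tendsto_sandwich[OF _ _ tendsto_const])
  show "eventually (\<lambda>n. hist_exp n (\<lambda>h. \<bar>log_defect n h\<bar> / sqrt (log_scale n)) \<le> 6 / sqrt (log_scale n)) sequentially"
    using log_scale_ge_1
  proof eventually_elim
    case (elim n)
    then have "hist_exp n (\<lambda>h. \<bar>log_defect n h\<bar>) \<le> 6"
      unfolding log_defect_def by (intro hist_exp_log_size_le) simp
    then show ?case using elim by (simp add: divide_right_mono)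
  qed
  show "eventually (\<lambda>n. 0 \<le> hist_exp n (\<lambda>h. \<bar>log_defect n h\<bar> / sqrt (log_scale n))) sequentially"
    using log_scale_ge_1 by eventually_elim (auto intro!: Bochner_Integration.integral_nonneg)
  have "((\<lambda>x::real. 6 / sqrt x) \<longlongrightarrow> 0) at_top" by real_asymp
  from filterlim_compose[OF this log_scale_at_top]
  show "(\<lambda>n. 6 / sqrt (log_scale n)) \<longlonglongrightarrow> 0" .
qed

text \<open>A law of large numbers for the clock: in absolute mean the defect is at most 6 and
  \<open>centered_doublings\<close> at most \<open>sqrt (3 * log_scale n)\<close>, both negligible
  against \<open>log_scale n\<close>.\<close>

lemma hist_exp_recip_sum_tendsto:
  "(\<lambda>n. hist_exp n (\<lambda>h. \<bar>recip_sum h / log_scale n - 1\<bar>)) \<longlonglongrightarrow> 0"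
proof (rule tendsto_sandwich[OF _ _ tendsto_const])
  show "eventually (\<lambda>n. hist_exp n (\<lambda>h. \<bar>recip_sum h / log_scale n - 1\<bar>)
      \<le> (6 + sqrt (3 * log_scale n)) / log_scale n) sequentially"
    using log_scale_ge_1
  proof eventually_elim
    case (elim n)
    have "hist_exp n (\<lambda>h. \<bar>recip_sum h / log_scale n - 1\<bar>)
        \<le> hist_exp n (\<lambda>h. (\<bar>log_defect n h\<bar> + \<bar>centered_doublings h\<bar>) / log_scale n)"
    proof (rule hist_exp_mono)
      fix h :: "node list"
      have "\<bar>recip_sum h / log_scale n - 1\<bar>
          = \<bar>log_defect n h - ln 2 * centered_doublings h\<bar> / ((1 + ln 2) * log_scale n)"
        using elim ln2_bounds by (subst recip_sum_ratio_minus_1) auto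
      also have "\<dots> \<le> (\<bar>log_defect n h\<bar> + \<bar>centered_doublings h\<bar>) / (1 * log_scale n)"
      proof (rule frac_le)
        have "\<bar>log_defect n h - ln 2 * centered_doublings h\<bar> \<le> \<bar>log_defect n h\<bar> + ln 2 * \<bar>centered_doublings h\<bar>"
          using ln2_bounds abs_triangle_ineq4[of "log_defect n h" "ln 2 * centered_doublings h"]
          by (simp add: abs_mult)
        also have "ln 2 * \<bar>centered_doublings h\<bar> \<le> 1 * \<bar>centered_doublings h\<bar>"
          using ln2_bounds by (intro mult_right_mono) auto
        finally show "\<bar>log_defect n h - ln 2 * centered_doublings h\<bar> \<le> \<bar>log_defect n h\<bar> + \<bar>centered_doublings h\<bar>"
          by simp
        show "1 * log_scale n \<le> (1 + ln 2) * log_scale n"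
          using elim ln2_bounds by (intro mult_right_mono) auto
      qed (use elim in auto)
      finally show "\<bar>recip_sum h / log_scale n - 1\<bar> \<le> (\<bar>log_defect n h\<bar> + \<bar>centered_doublings h\<bar>) / log_scale n"
        by simp
    qed
    also have "\<dots> = (hist_exp n (\<lambda>h. \<bar>log_defect n h\<bar>) + hist_exp n (\<lambda>h. \<bar>centered_doublings h\<bar>)) / log_scale n"
      by simp
    also have "\<dots> \<le> (6 + sqrt (3 * log_scale n)) / log_scale n"
    proof (intro divide_right_mono add_mono)
      show "hist_exp n (\<lambda>h. \<bar>log_defect n h\<bar>) \<le> 6"
        unfolding log_defect_def using elim by (intro hist_exp_log_size_le) simp
      have "hist_exp n (\<lambda>h. \<bar>centered_doublings h\<bar>) \<le> sqrt (hist_exp n (\<lambda>h. (centered_doublings h)\<^sup>2))"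
        by (rule hist_exp_abs_le_sqrt)
      also have "\<dots> \<le> sqrt (3 * log_scale n)"
        using hist_exp_doublings_variance_le[of n] harm_le_log_scale[of n] elim
        by (intro real_sqrt_le_mono) (simp add: centered_doublings_def)
      finally show "hist_exp n (\<lambda>h. \<bar>centered_doublings h\<bar>) \<le> sqrt (3 * log_scale n)" .
    qed (use elim in auto)
    finally show ?case .
  qed
  show "eventually (\<lambda>n. 0 \<le> hist_exp n (\<lambda>h. \<bar>recip_sum h / log_scale n - 1\<bar>)) sequentially"
    by (intro always_eventually allI Bochner_Integration.integral_nonneg) auto
  have "((\<lambda>x::real. (6 + sqrt (3 * x)) / x) \<longlongrightarrow> 0) at_top" by real_asymp
  from filterlim_compose[OF this log_scale_at_top]
  show "(\<lambda>n. (6 + sqrt (3 * log_scale n)) / log_scale n) \<longlonglongrightarrow> 0" .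
qed

lemma hist_exp_gf_phase_tendsto:
  assumes "\<alpha> \<longlonglongrightarrow> 0"
  shows "(\<lambda>n. hist_exp n (\<lambda>h. norm (height_gf (exp (\<i> * of_real (\<alpha> n))) h - phase (\<alpha> n) h))) \<longlonglongrightarrow> 0"
proof -
  define z where "z n = exp (\<i> * of_real (\<alpha> n))" for n
  have "(\<lambda>n. hist_exp n (\<lambda>h. (norm (gf_error (z n) h))\<^sup>2)) \<longlonglongrightarrow> 0"
  proof (rule order_tendstoI)
    fix a :: real assume "a < 0"
    then show "eventually (\<lambda>n. a < hist_exp n (\<lambda>h. (norm (gf_error (z n) h))\<^sup>2)) sequentially"
      by (intro always_eventually allI less_le_trans[OF _ Bochner_Integration.integral_nonneg]) auto
  next
    fix e :: real assume "0 < e"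
    \<comment> \<open>The late start is fixed first, making the tail \<open>17 / m\<close> small
      uniformly in \<open>n\<close>; only then does \<open>n\<close> grow, so that
      \<open>\<alpha> n\<close> outweighs the fixed factor \<open>m\<close>.\<close>
    obtain m :: nat where m: "17 * 2 / e < real m" using reals_Archimedean2 by blast
    then have "0 < real m" using \<open>0 < e\<close> by (intro less_trans[OF _ m]) simp
    with m \<open>0 < e\<close> have m: "m > 0" "17 / real m < e / 2" by (auto simp: field_simps)
    have "(\<lambda>n. (2 * real m * \<bar>\<alpha> n\<bar>)\<^sup>2) \<longlonglongrightarrow> (2 * real m * \<bar>0\<bar>)\<^sup>2"
      by (intro tendsto_intros assms)
    then have "eventually (\<lambda>n. (2 * real m * \<bar>\<alpha> n\<bar>)\<^sup>2 < e / 2) sequentially"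
      by (rule order_tendstoD(2)) (use \<open>0 < e\<close> in simp)
    with eventually_ge_at_top[of m]
    show "eventually (\<lambda>n. hist_exp n (\<lambda>h. (norm (gf_error (z n) h))\<^sup>2) < e) sequentially"
    proof eventually_elim
      case (elim n)
      have "hist_exp n (\<lambda>h. (norm (gf_error (z n) h))\<^sup>2) \<le> (2 * real m * norm (z n - 1))\<^sup>2 + 17 / real m"
        using elim m by (intro hist_exp_gf_error_le) (auto simp: z_def)
      also have "(2 * real m * norm (z n - 1))\<^sup>2 \<le> (2 * real m * \<bar>\<alpha> n\<bar>)\<^sup>2"
        using norm_iexp_minus_1_le[of "\<alpha> n"] unfolding z_def
        by (intro power_mono mult_left_mono) auto
      finally show ?case using elim m by simp
    qed
  qed
  then have "(\<lambda>n. sqrt (hist_exp n (\<lambda>h. (norm (gf_error (z n) h))\<^sup>2))) \<longlonglongrightarrow> sqrt 0"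
    by (rule tendsto_real_sqrt)
  moreover have "(\<lambda>n. 2 * (2 + 2 * exp 2) * \<bar>\<alpha> n\<bar>) \<longlonglongrightarrow> 2 * (2 + 2 * exp 2) * \<bar>0\<bar>"
    by (intro tendsto_intros assms)
  ultimately have "(\<lambda>n. sqrt (hist_exp n (\<lambda>h. (norm (gf_error (z n) h))\<^sup>2)) + 2 * (2 + 2 * exp 2) * \<bar>\<alpha> n\<bar>)
      \<longlonglongrightarrow> sqrt 0 + 2 * (2 + 2 * exp 2) * \<bar>0\<bar>"
    by (rule tendsto_add)
  then have lim: "(\<lambda>n. sqrt (hist_exp n (\<lambda>h. (norm (gf_error (z n) h))\<^sup>2)) + 2 * (2 + 2 * exp 2) * \<bar>\<alpha> n\<bar>) \<longlonglongrightarrow> 0"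
    by simp
  have le: "hist_exp n (\<lambda>h. norm (height_gf (z n) h - phase (\<alpha> n) h))
      \<le> sqrt (hist_exp n (\<lambda>h. (norm (gf_error (z n) h))\<^sup>2)) + 2 * (2 + 2 * exp 2) * \<bar>\<alpha> n\<bar>" for n
  proof -
    have "hist_exp n (\<lambda>h. norm (height_gf (z n) h - phase (\<alpha> n) h))
        \<le> hist_exp n (\<lambda>h. \<bar>norm (gf_error (z n) h)\<bar> + norm (gf_approx (z n) h - phase (\<alpha> n) h))"
      by (rule hist_exp_mono) (auto simp: gf_error_def intro: norm_diff_triangle_le)
    also have "\<dots> = hist_exp n (\<lambda>h. \<bar>norm (gf_error (z n) h)\<bar>) + hist_exp n (\<lambda>h. norm (gf_approx (z n) h - phase (\<alpha> n) h))"
      by simp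
    also have "\<dots> \<le> sqrt (hist_exp n (\<lambda>h. (norm (gf_error (z n) h))\<^sup>2)) + 2 * (2 + 2 * exp 2) * \<bar>\<alpha> n\<bar>"
      unfolding z_def by (intro add_mono hist_exp_abs_le_sqrt hist_exp_gf_approx_phase_le)
    finally show ?thesis .
  qed
  show ?thesis
    unfolding z_def[symmetric]
    by (rule tendsto_sandwich[OF _ always_eventually[OF allI[OF le]] tendsto_const lim])
      (auto intro!: always_eventually Bochner_Integration.integral_nonneg)
qed

lemma iexp_third_order:
  "norm (exp (\<i> * of_real \<alpha>) - 1 - \<i> * of_real \<alpha> + of_real (\<alpha>\<^sup>2 / 2)) \<le> \<bar>\<alpha>\<bar> ^ 3"
proof -
  have "exp (\<i> * of_real \<alpha>) - 1 - \<i> * of_real \<alpha> + of_real (\<alpha>\<^sup>2 / 2)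
      = iexp \<alpha> - (\<Sum>k\<le>2. (\<i> * of_real \<alpha>) ^ k / fact k)"
    by (simp add: numeral_2_eq_2 power_mult_distrib)
  also have "norm \<dots> \<le> \<bar>\<alpha>\<bar> ^ Suc 2 / fact (Suc 2)"
    by (rule iexp_approx1)
  also have "\<dots> \<le> \<bar>\<alpha>\<bar> ^ 3"
    by (simp add: numeral_3_eq_3[symmetric] fact_numeral divide_le_eq mult_le_cancel_left1)
  finally show ?thesis .
qed

text \<open>Replaces an exponent inside the mean, using that \<open>exp\<close> is Lipschitz where
  \<open>Re \<le> K\<close>. The three admissible errors are those known to vanish: the defect, the
  deviation of the clock, and a cubic Taylor remainder.\<close>

lemma hist_exp_exp_diff_tendsto:
  fixes \<xi> y :: "nat \<Rightarrow> node list \<Rightarrow> complex"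
  assumes "a \<ge> 0" "b \<ge> 0" "c \<ge> 0"
    and Re: "\<And>n h. log_scale n \<ge> 1 \<Longrightarrow> n \<ge> 1 \<Longrightarrow> length h = n \<Longrightarrow> Re (\<xi> n h) \<le> K \<and> Re (y n h) \<le> K"
    and diff: "\<And>n h. log_scale n \<ge> 1 \<Longrightarrow> n \<ge> 1 \<Longrightarrow> length h = n \<Longrightarrow>
      norm (\<xi> n h - y n h) \<le> a * (\<bar>log_defect n h\<bar> / sqrt (log_scale n))
        + b * \<bar>recip_sum h / log_scale n - 1\<bar> + c / sqrt (log_scale n)"
  shows "(\<lambda>n. hist_exp n (\<lambda>h. exp (\<xi> n h)) - hist_exp n (\<lambda>h. exp (y n h))) \<longlonglongrightarrow> 0"
proof (rule Lim_null_comparison)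
  define B where "B n = exp K * (a * hist_exp n (\<lambda>h. \<bar>log_defect n h\<bar> / sqrt (log_scale n))
        + b * hist_exp n (\<lambda>h. \<bar>recip_sum h / log_scale n - 1\<bar>) + c / sqrt (log_scale n))" for n
  show "eventually (\<lambda>n. norm (hist_exp n (\<lambda>h. exp (\<xi> n h)) - hist_exp n (\<lambda>h. exp (y n h))) \<le> B n) sequentially"
    using log_scale_ge_1
  proof eventually_elim
    case (elim n)
    have "norm (hist_exp n (\<lambda>h. exp (\<xi> n h)) - hist_exp n (\<lambda>h. exp (y n h)))
        = norm (hist_exp n (\<lambda>h. exp (\<xi> n h) - exp (y n h)))" by simp
    also have "\<dots> \<le> hist_exp n (\<lambda>h. norm (exp (\<xi> n h) - exp (y n h)))"
      by (rule integral_norm_bound)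
    also have "\<dots> \<le> hist_exp n (\<lambda>h. exp K * (a * (\<bar>log_defect n h\<bar> / sqrt (log_scale n))
        + b * \<bar>recip_sum h / log_scale n - 1\<bar> + c / sqrt (log_scale n)))"
    proof (rule hist_exp_mono)
      fix h :: "node list" assume h: "length h = n"
      have "norm (exp (\<xi> n h) - exp (y n h)) \<le> exp K * norm (\<xi> n h - y n h)"
        using Re[of n h] elim h by (intro norm_exp_diff_le) auto
      also have "\<dots> \<le> exp K * (a * (\<bar>log_defect n h\<bar> / sqrt (log_scale n))
        + b * \<bar>recip_sum h / log_scale n - 1\<bar> + c / sqrt (log_scale n))"
        using diff[of n h] elim h by (intro mult_left_mono) auto
      finally show "norm (exp (\<xi> n h) - exp (y n h)) \<le> exp K * (a * (\<bar>log_defect n h\<bar> / sqrt (log_scale n))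
        + b * \<bar>recip_sum h / log_scale n - 1\<bar> + c / sqrt (log_scale n))" .
    qed
    also have "\<dots> = B n" by (simp add: B_def)
    finally show ?case .
  qed
  have "((\<lambda>x::real. c / sqrt x) \<longlongrightarrow> 0) at_top" by real_asymp
  from filterlim_compose[OF this log_scale_at_top]
  have "(\<lambda>n. c / sqrt (log_scale n)) \<longlonglongrightarrow> 0" .
  then have "B \<longlonglongrightarrow> exp K * (a * 0 + b * 0 + 0)"
    unfolding B_def
    by (intro tendsto_intros hist_exp_log_defect_tendsto hist_exp_recip_sum_tendsto)
  then show "B \<longlonglongrightarrow> 0" by simp
qed

text \<open>The cubic remainder acquires a factor from the clock, which is at most
  \<open>3 * log_scale n\<close>; one inverse square root of the scale survives.\<close>

lemma cube_scaled_le: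
  assumes "log_scale n \<ge> 1" "n \<ge> 1" "length h = n"
  shows "\<bar>\<theta> / sqrt (log_scale n)\<bar> ^ 3 * recip_sum h \<le> 3 * \<bar>\<theta>\<bar> ^ 3 / sqrt (log_scale n)"
proof -
  have "recip_sum h \<le> 3 * log_scale n"
    using recip_sum_le_harm[of h] harm_le_log_scale[of n] assms by simp
  then have "\<bar>\<theta> / sqrt (log_scale n)\<bar> ^ 3 * recip_sum h \<le> \<bar>\<theta> / sqrt (log_scale n)\<bar> ^ 3 * (3 * log_scale n)"
    by (intro mult_left_mono) auto
  also have "sqrt (log_scale n) ^ 3 = log_scale n * sqrt (log_scale n)"
    using assms by (simp add: power3_eq_cube)
  then have "\<bar>\<theta> / sqrt (log_scale n)\<bar> ^ 3 * (3 * log_scale n) = 3 * \<bar>\<theta>\<bar> ^ 3 / sqrt (log_scale n)"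
    using assms by (simp add: abs_divide power_divide)
  finally show ?thesis .
qed

section \<open>Central limit theorem for the number of doublings\<close>

text \<open>The mean of the near-martingale tends to 1. Expanding
  \<open>exp (\<i> * \<beta>) - 1\<close> to second order and replacing the clock by
  \<open>log_scale n\<close>, its exponent becomes
  \<open>\<i> * \<beta> * centered_doublings h + b\<^sup>2 / 2\<close>; the second term is
  deterministic and is divided out.\<close>

lemma centered_doublings_clt:
  "(\<lambda>n. hist_exp n (\<lambda>h. exp (\<i> * of_real (b / sqrt (log_scale n) * centered_doublings h))))
     \<longlonglongrightarrow> of_real (exp (- b\<^sup>2 / 2))"
proof -
  define \<beta> where "\<beta> n = b / sqrt (log_scale n)" for n
  define \<xi> where "\<xi> n h = \<i> * of_real (\<beta> n * doublings h) - (exp (\<i> * of_real (\<beta> n)) - 1) * of_real (recip_sum h)" for n h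
  define y where "y n h = \<i> * of_real (\<beta> n * centered_doublings h) + of_real (b\<^sup>2 / 2)" for n h
  have \<beta>2: "(\<beta> n)\<^sup>2 = b\<^sup>2 / log_scale n" if "log_scale n \<ge> 1" for n
    using that by (simp add: \<beta>_def power_divide)
  have K: "(\<beta> n)\<^sup>2 * harm n \<le> 3 * b\<^sup>2" if "log_scale n \<ge> 1" "n \<ge> 1" for n
  proof -
    have "(\<beta> n)\<^sup>2 * harm n \<le> (\<beta> n)\<^sup>2 * (3 * log_scale n)"
      using that by (intro mult_left_mono harm_le_log_scale) auto
    also have "\<dots> = 3 * b\<^sup>2" using that by (simp add: \<beta>2)
    finally show ?thesis .
  qed
  have "(\<lambda>n. hist_exp n (\<lambda>h. exp (\<xi> n h)) - hist_exp n (\<lambda>h. exp (y n h))) \<longlonglongrightarrow> 0"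
  proof (rule hist_exp_exp_diff_tendsto[where a = 0 and b = "b\<^sup>2 / 2" and c = "3 * \<bar>b\<bar> ^ 3" and K = "3 * b\<^sup>2"])
    fix n and h :: "node list" assume n: "log_scale n \<ge> 1" "n \<ge> 1" "length h = n"
    have "(\<beta> n)\<^sup>2 * recip_sum h \<le> (\<beta> n)\<^sup>2 * harm n"
      using recip_sum_le_harm[of h] n by (intro mult_left_mono) auto
    also note K[OF n(1,2)]
    finally have "norm (doubling_martingale (\<beta> n) h) \<le> exp (3 * b\<^sup>2)"
      by (rule norm_doubling_martingale_le)
    then show "Re (\<xi> n h) \<le> 3 * b\<^sup>2 \<and> Re (y n h) \<le> 3 * b\<^sup>2"
      by (simp add: doubling_martingale_def norm_exp_eq_Re \<xi>_def y_def)
    define r where "r = exp (\<i> * of_real (\<beta> n)) - 1 - \<i> * of_real (\<beta> n) + of_real ((\<beta> n)\<^sup>2 / 2)"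
    have "\<xi> n h - y n h = of_real ((\<beta> n)\<^sup>2 * recip_sum h / 2 - b\<^sup>2 / 2) - r * of_real (recip_sum h)"
      by (simp add: \<xi>_def y_def r_def centered_doublings_def algebra_simps)
    also have "(\<beta> n)\<^sup>2 * recip_sum h / 2 - b\<^sup>2 / 2 = b\<^sup>2 / 2 * (recip_sum h / log_scale n - 1)"
      using n by (simp add: \<beta>2 algebra_simps)
    finally have "norm (\<xi> n h - y n h) \<le>
        norm (of_real (b\<^sup>2 / 2 * (recip_sum h / log_scale n - 1)) :: complex) + norm (r * of_real (recip_sum h))"
      by (metis norm_triangle_ineq4)
    also have "norm (of_real (b\<^sup>2 / 2 * (recip_sum h / log_scale n - 1)) :: complex)
        = b\<^sup>2 / 2 * \<bar>recip_sum h / log_scale n - 1\<bar>"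
      unfolding norm_of_real by (simp add: abs_mult)
    also have "norm (r * of_real (recip_sum h)) \<le> \<bar>\<beta> n\<bar> ^ 3 * recip_sum h"
      using iexp_third_order[of "\<beta> n"] recip_sum_nonneg[of h]
      unfolding r_def[symmetric] norm_mult by (simp add: mult_right_mono)
    also have "\<dots> \<le> 3 * \<bar>b\<bar> ^ 3 / sqrt (log_scale n)"
      unfolding \<beta>_def using n by (rule cube_scaled_le)
    finally show "norm (\<xi> n h - y n h) \<le> 0 * (\<bar>log_defect n h\<bar> / sqrt (log_scale n)) +
        b\<^sup>2 / 2 * \<bar>recip_sum h / log_scale n - 1\<bar> + 3 * \<bar>b\<bar> ^ 3 / sqrt (log_scale n)"
      by simp
  qed auto
  moreover have "(\<lambda>n. hist_exp n (\<lambda>h. exp (\<xi> n h)) - 1) \<longlonglongrightarrow> 0"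
  proof (rule Lim_null_comparison)
    show "eventually (\<lambda>n. norm (hist_exp n (\<lambda>h. exp (\<xi> n h)) - 1)
        \<le> 2 * exp (3 * b\<^sup>2) * exp 4 * (b\<^sup>2 / log_scale n)) sequentially"
      using log_scale_ge_1
    proof eventually_elim
      case (elim n)
      then show ?case
        using hist_exp_doubling_martingale[OF K, of n] \<beta>2[of n]
        by (simp add: \<xi>_def doubling_martingale_def[abs_def])
    qed
    have "((\<lambda>x::real. b\<^sup>2 / x) \<longlongrightarrow> 0) at_top" by real_asymp
    from filterlim_compose[OF this log_scale_at_top]
    have "(\<lambda>n. b\<^sup>2 / log_scale n) \<longlonglongrightarrow> 0" .
    then have "(\<lambda>n. 2 * exp (3 * b\<^sup>2) * exp 4 * (b\<^sup>2 / log_scale n)) \<longlonglongrightarrow> 2 * exp (3 * b\<^sup>2) * exp 4 * 0"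
      by (intro tendsto_intros)
    then show "(\<lambda>n. 2 * exp (3 * b\<^sup>2) * exp 4 * (b\<^sup>2 / log_scale n)) \<longlonglongrightarrow> 0"
      by (simp only: mult_zero_right)
  qed
  ultimately have "(\<lambda>n. (hist_exp n (\<lambda>h. exp (\<xi> n h)) - 1)
      - (hist_exp n (\<lambda>h. exp (\<xi> n h)) - hist_exp n (\<lambda>h. exp (y n h))) + 1) \<longlonglongrightarrow> 0 - 0 + 1"
    by (intro tendsto_intros)
  then have "(\<lambda>n. hist_exp n (\<lambda>h. exp (y n h))) \<longlonglongrightarrow> 1" by simp
  then have "(\<lambda>n. of_real (exp (- b\<^sup>2 / 2)) * hist_exp n (\<lambda>h. exp (y n h))) \<longlonglongrightarrow> of_real (exp (- b\<^sup>2 / 2)) * 1"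
    by (intro tendsto_intros)
  moreover have "of_real (exp (- b\<^sup>2 / 2)) * hist_exp n (\<lambda>h. exp (y n h)) =
      hist_exp n (\<lambda>h. exp (\<i> * of_real (b / sqrt (log_scale n) * centered_doublings h)))" for n
  proof -
    have "of_real (exp (- b\<^sup>2 / 2)) * exp (y n h) = exp (\<i> * of_real (b / sqrt (log_scale n) * centered_doublings h))" for h
      unfolding y_def \<beta>_def exp_of_real[symmetric] exp_add[symmetric] by simp
    then show ?thesis
      by (subst integral_mult_right_zero[symmetric]) simp
  qed
  ultimately show ?thesis by simp
qed

section \<open>Limit of the joint characteristic function, averaged over the tree\<close>

definition doubling_coeff :: real where
  "doubling_coeff = (1 - ln 2) / (1 + ln 2)"

text \<open>The same linear system solved for \<open>P + s\<close>: an excess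
  \<open>Q = P - s\<close> shifts \<open>P\<close> by \<open>Q / (1 + ln 2)\<close> but
  \<open>s\<close> by \<open>- ln 2 * Q / (1 + ln 2)\<close>, since extra doublings leave less
  logarithmic size for the clock.\<close>

lemma doublings_plus_recip_sum:
  "doublings h + recip_sum h - 2 * log_scale n
     = doubling_coeff * centered_doublings h + 2 / (1 + ln 2) * log_defect n h"
proof -
  define c :: real where "c = 1 + ln 2"
  have c: "c \<noteq> 0" "ln 2 = c - 1" unfolding c_def using ln2_bounds(1) by linarith+
  show ?thesis
    unfolding doubling_coeff_def centered_doublings_def log_defect_def ln_eq_log_scale c(2)
    using c(1) by (simp add: divide_simps) (simp add: algebra_simps)
qed

text \<open>To second order the exponents add up to \<open>sum \<theta> J\<close> times the common
  fluctuation of \<open>P + s\<close>, the source of \<open>V\<close>, minus half the sum of the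
  \<open>(\<theta> j)\<^sup>2\<close>, one independent Gaussian for each sample. The extra
  exponential factors are the centring by \<open>2 * log_scale n\<close> after scaling.\<close>

lemma prod_phase_tendsto:
  assumes "finite J"
  shows "(\<lambda>n. hist_exp n (\<lambda>h. \<Prod>j\<in>J. phase (\<theta> j / sqrt (log_scale n)) h * exp (- \<i> * of_real (2 * \<theta> j * sqrt (log_scale n)))))
    \<longlonglongrightarrow> of_real (exp (- (doubling_coeff * sum \<theta> J)\<^sup>2 / 2 - (\<Sum>j\<in>J. (\<theta> j)\<^sup>2) / 2))"
proof -
  define \<Theta> where "\<Theta> = sum \<theta> J"
  define S2 where "S2 = (\<Sum>j\<in>J. (\<theta> j)\<^sup>2)"
  define S3 where "S3 = (\<Sum>j\<in>J. \<bar>\<theta> j\<bar> ^ 3)"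
  define \<alpha> where "\<alpha> n j = \<theta> j / sqrt (log_scale n)" for n j
  define \<xi> where "\<xi> n h = (\<Sum>j\<in>J. \<i> * of_real (\<alpha> n j * doublings h)
      + (exp (\<i> * of_real (\<alpha> n j)) - 1) * of_real (recip_sum h) - \<i> * of_real (2 * \<theta> j * sqrt (log_scale n)))" for n h
  define y where "y n h = \<i> * of_real (doubling_coeff * \<Theta> / sqrt (log_scale n) * centered_doublings h) - of_real (S2 / 2)" for n h
  have S2: "S2 \<ge> 0" and S3: "S3 \<ge> 0" by (auto simp: S2_def S3_def intro!: sum_nonneg)
  have "(\<lambda>n. hist_exp n (\<lambda>h. exp (\<xi> n h)) - hist_exp n (\<lambda>h. exp (y n h))) \<longlonglongrightarrow> 0"
  \<comment> \<open>Here \<open>a\<close> comes from the coefficient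
    \<open>2 / (1 + ln 2) \<le> 2\<close> of the defect, \<open>b\<close> from the quadratic terms
    and \<open>c\<close> from the cubic remainders.\<close>
  proof (rule hist_exp_exp_diff_tendsto[where a = "2 * \<bar>\<Theta>\<bar>" and b = "S2 / 2" and c = "3 * S3" and K = 0])
    fix n and h :: "node list" assume n: "log_scale n \<ge> 1" "n \<ge> 1" "length h = n"
    have "Re (\<xi> n h) = (\<Sum>j\<in>J. Re (exp (\<i> * of_real (\<alpha> n j)) - 1) * recip_sum h)"
      by (simp add: \<xi>_def)
    also have "\<dots> \<le> 0"
      by (intro sum_nonpos mult_nonpos_nonneg Re_iexp_minus_1_le recip_sum_nonneg)
    finally show "Re (\<xi> n h) \<le> 0 \<and> Re (y n h) \<le> 0"
      using S2 by (simp add: y_def)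
    define L where "L = sqrt (log_scale n)"
    have L: "L > 0" "log_scale n = L\<^sup>2" using n by (auto simp: L_def)
    define r where "r j = exp (\<i> * of_real (\<alpha> n j)) - 1 - \<i> * of_real (\<alpha> n j) + of_real ((\<alpha> n j)\<^sup>2 / 2)" for j
    have term_eq: "\<i> * of_real (\<alpha> n j * doublings h) + (exp (\<i> * of_real (\<alpha> n j)) - 1) * of_real (recip_sum h)
        - \<i> * of_real (2 * \<theta> j * L)
        = of_real (\<theta> j) * (\<i> * of_real ((doublings h + recip_sum h - 2 * L\<^sup>2) / L))
          - of_real ((\<theta> j)\<^sup>2) * of_real (recip_sum h / L\<^sup>2 / 2) + r j * of_real (recip_sum h)" for j
    proof -
      have \<alpha>: "\<alpha> n j = \<theta> j / L" by (simp add: \<alpha>_def L_def)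
      have e: "exp (\<i> * of_real (\<alpha> n j)) - 1 = \<i> * of_real (\<theta> j / L) - of_real ((\<theta> j)\<^sup>2 / L\<^sup>2 / 2) + r j"
        by (simp add: r_def power_divide \<alpha>)
      show ?thesis
        unfolding e unfolding \<alpha> using L(1) by (simp add: field_simps power2_eq_square)
    qed
    define q where "q = 2 / (1 + ln 2) * log_defect n h"
    have "\<xi> n h = of_real \<Theta> * (\<i> * of_real ((doublings h + recip_sum h - 2 * L\<^sup>2) / L))
          - of_real S2 * of_real (recip_sum h / L\<^sup>2 / 2) + (\<Sum>j\<in>J. r j * of_real (recip_sum h))"
      unfolding \<xi>_def L_def[symmetric] term_eq \<Theta>_def S2_def of_real_sum
      by (simp only: sum.distrib sum_subtractf sum_distrib_right)
    also have "doublings h + recip_sum h - 2 * L\<^sup>2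
        = doubling_coeff * centered_doublings h + q"
      using doublings_plus_recip_sum[of h n] L(2) by (simp add: q_def)
    finally have \<xi>_eq: "\<xi> n h = of_real \<Theta> * (\<i> * of_real ((doubling_coeff * centered_doublings h + q) / L))
          - of_real S2 * of_real (recip_sum h / L\<^sup>2 / 2) + (\<Sum>j\<in>J. r j * of_real (recip_sum h))" .
    have "\<xi> n h - y n h = \<i> * of_real (\<Theta> * (q / L))
        - of_real (S2 / 2 * (recip_sum h / L\<^sup>2 - 1)) + (\<Sum>j\<in>J. r j * of_real (recip_sum h))"
      unfolding \<xi>_eq y_def L_def[symmetric] by (simp add: algebra_simps add_divide_distrib)
    also have "norm \<dots> \<le> norm (\<i> * of_real (\<Theta> * (q / L)))
        + norm (of_real (S2 / 2 * (recip_sum h / L\<^sup>2 - 1)) :: complex) + norm (\<Sum>j\<in>J. r j * of_real (recip_sum h))"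
      by (intro order_trans[OF norm_triangle_ineq] add_right_mono norm_triangle_ineq4)
    also have "norm (\<i> * of_real (\<Theta> * (q / L)))
        = 2 * \<bar>\<Theta>\<bar> * (\<bar>log_defect n h\<bar> / L) / (1 + ln 2)"
      unfolding norm_mult norm_of_real q_def using L(1) ln2_bounds by (simp add: abs_mult mult_ac)
    also have "\<dots> \<le> 2 * \<bar>\<Theta>\<bar> * (\<bar>log_defect n h\<bar> / L) / 1"
      using ln2_bounds(1) L(1) by (intro divide_left_mono) (auto simp del: ln_gt_zero_iff)
    also have "norm (of_real (S2 / 2 * (recip_sum h / L\<^sup>2 - 1)) :: complex) = S2 / 2 * \<bar>recip_sum h / log_scale n - 1\<bar>"
      unfolding norm_of_real using S2 L(2) by (simp add: abs_mult)
    also have "norm (\<Sum>j\<in>J. r j * of_real (recip_sum h)) \<le> (\<Sum>j\<in>J. 3 * \<bar>\<theta> j\<bar> ^ 3 / L)"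
    proof (rule sum_norm_le)
      fix j
      have "norm (r j * of_real (recip_sum h)) \<le> \<bar>\<alpha> n j\<bar> ^ 3 * recip_sum h"
        using iexp_third_order[of "\<alpha> n j"] recip_sum_nonneg[of h]
        unfolding r_def[symmetric] norm_mult by (simp add: mult_right_mono)
      also have "\<dots> \<le> 3 * \<bar>\<theta> j\<bar> ^ 3 / L"
        unfolding \<alpha>_def L_def using n by (rule cube_scaled_le)
      finally show "norm (r j * of_real (recip_sum h)) \<le> 3 * \<bar>\<theta> j\<bar> ^ 3 / L" .
    qed
    also have "(\<Sum>j\<in>J. 3 * \<bar>\<theta> j\<bar> ^ 3 / L) = 3 * S3 / L"
      by (simp add: S3_def sum_distrib_left sum_divide_distrib)
    finally show "norm (\<xi> n h - y n h) \<le> 2 * \<bar>\<Theta>\<bar> * (\<bar>log_defect n h\<bar> / sqrt (log_scale n)) +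
        S2 / 2 * \<bar>recip_sum h / log_scale n - 1\<bar> + 3 * S3 / sqrt (log_scale n)"
      by (simp add: L_def)
  qed (use S2 S3 in auto)
  moreover have "(\<lambda>n. hist_exp n (\<lambda>h. exp (y n h))) \<longlonglongrightarrow>
      of_real (exp (- (doubling_coeff * \<Theta>)\<^sup>2 / 2)) * of_real (exp (- S2 / 2))"
  proof -
    have "exp (y n h) = exp (\<i> * of_real (doubling_coeff * \<Theta> / sqrt (log_scale n) * centered_doublings h)) * of_real (exp (- S2 / 2))" for n h
      unfolding y_def exp_of_real[symmetric] exp_add[symmetric] by simp
    then show ?thesis
      by (simp only: integral_mult_left_zero) (intro tendsto_intros centered_doublings_clt)
  qed
  ultimately have "(\<lambda>n. (hist_exp n (\<lambda>h. exp (\<xi> n h)) - hist_exp n (\<lambda>h. exp (y n h))) + hist_exp n (\<lambda>h. exp (y n h)))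
      \<longlonglongrightarrow> 0 + of_real (exp (- (doubling_coeff * \<Theta>)\<^sup>2 / 2)) * of_real (exp (- S2 / 2))"
    by (rule tendsto_add)
  moreover have "exp (\<xi> n h) = (\<Prod>j\<in>J. phase (\<theta> j / sqrt (log_scale n)) h * exp (- \<i> * of_real (2 * \<theta> j * sqrt (log_scale n))))" for n h
    unfolding \<xi>_def exp_sum[OF assms] by (simp add: phase_def \<alpha>_def exp_add[symmetric])
  moreover have "exp (- (doubling_coeff * \<Theta>)\<^sup>2 / 2) * exp (- S2 / 2) = exp (- (doubling_coeff * \<Theta>)\<^sup>2 / 2 - S2 / 2)"
    by (simp add: exp_add[symmetric])
  ultimately show ?thesis
    by (simp add: \<Theta>_def S2_def of_real_mult[symmetric] del: of_real_mult of_real_exp)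
qed

text \<open>All factors lie in the closed unit disc, so two products differ by at most the sum of
  the differences of their factors.\<close>

lemma prod_height_gf_tendsto:
  assumes "finite J"
  shows "(\<lambda>n. hist_exp n (\<lambda>h. \<Prod>j\<in>J. height_gf (exp (\<i> * of_real (\<theta> j / sqrt (log_scale n)))) h
            * exp (- \<i> * of_real (2 * \<theta> j * sqrt (log_scale n)))))
    \<longlonglongrightarrow> of_real (exp (- (doubling_coeff * sum \<theta> J)\<^sup>2 / 2 - (\<Sum>j\<in>J. (\<theta> j)\<^sup>2) / 2))"
proof -
  define \<alpha> where "\<alpha> j n = \<theta> j / sqrt (log_scale n)" for n j
  define c where "c j n = exp (- \<i> * of_real (2 * \<theta> j * sqrt (log_scale n)))" for j n
  define X where "X n h = (\<Prod>j\<in>J. height_gf (exp (\<i> * of_real (\<alpha> j n))) h * c j n)" for n h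
  define Y where "Y n h = (\<Prod>j\<in>J. phase (\<alpha> j n) h * c j n)" for n h
  have c: "norm (c j n) = 1" for j n by (simp add: c_def norm_exp_eq_Re)
  have \<alpha>: "\<alpha> j \<longlonglongrightarrow> 0" for j
  proof -
    have "((\<lambda>x::real. \<theta> j / sqrt x) \<longlongrightarrow> 0) at_top" by real_asymp
    from filterlim_compose[OF this log_scale_at_top] show ?thesis by (simp add: \<alpha>_def[abs_def])
  qed
  have "(\<lambda>n. hist_exp n (X n) - hist_exp n (Y n)) \<longlonglongrightarrow> 0"
  proof (rule Lim_null_comparison[OF always_eventually[OF allI]])
    fix n
    have "norm (hist_exp n (X n) - hist_exp n (Y n)) = norm (hist_exp n (\<lambda>h. X n h - Y n h))" by simp
    also have "\<dots> \<le> hist_exp n (\<lambda>h. norm (X n h - Y n h))" by (rule integral_norm_bound)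
    also have "\<dots> \<le> hist_exp n (\<lambda>h. \<Sum>j\<in>J. norm (height_gf (exp (\<i> * of_real (\<alpha> j n))) h - phase (\<alpha> j n) h))"
    proof (rule hist_exp_mono)
      fix h
      have "norm (X n h - Y n h) \<le> (\<Sum>j\<in>J. norm (height_gf (exp (\<i> * of_real (\<alpha> j n))) h * c j n - phase (\<alpha> j n) h * c j n))"
        unfolding X_def Y_def using norm_height_gf_le norm_phase_le
        by (intro norm_prod_diff) (auto simp: norm_mult c)
      also have "\<dots> = (\<Sum>j\<in>J. norm (height_gf (exp (\<i> * of_real (\<alpha> j n))) h - phase (\<alpha> j n) h))"
        by (simp add: left_diff_distrib[symmetric] norm_mult c)
      finally show "norm (X n h - Y n h) \<le> (\<Sum>j\<in>J. norm (height_gf (exp (\<i> * of_real (\<alpha> j n))) h - phase (\<alpha> j n) h))" .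
    qed
    also have "\<dots> = (\<Sum>j\<in>J. hist_exp n (\<lambda>h. norm (height_gf (exp (\<i> * of_real (\<alpha> j n))) h - phase (\<alpha> j n) h)))"
      by simp
    finally show "norm (hist_exp n (X n) - hist_exp n (Y n)) \<le>
        (\<Sum>j\<in>J. hist_exp n (\<lambda>h. norm (height_gf (exp (\<i> * of_real (\<alpha> j n))) h - phase (\<alpha> j n) h)))" .
  next
    have "(\<lambda>n. \<Sum>j\<in>J. hist_exp n (\<lambda>h. norm (height_gf (exp (\<i> * of_real (\<alpha> j n))) h - phase (\<alpha> j n) h))) \<longlonglongrightarrow> (\<Sum>j\<in>J. 0)"
      by (intro tendsto_sum hist_exp_gf_phase_tendsto \<alpha>)
    then show "(\<lambda>n. \<Sum>j\<in>J. hist_exp n (\<lambda>h. norm (height_gf (exp (\<i> * of_real (\<alpha> j n))) h - phase (\<alpha> j n) h))) \<longlonglongrightarrow> 0"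
      by simp
  qed
  from tendsto_add[OF this prod_phase_tendsto[OF assms, of \<theta>]]
  show ?thesis
    by (simp add: X_def[abs_def] Y_def[abs_def] \<alpha>_def c_def)
qed

section \<open>Transfer to the sampled process\<close>

text \<open>Finitely many events of total probability 1 carry the integral, so measurability is
  asked only of these events and of \<open>f (X \<omega>)\<close>. This suits a value made of a tree
  and a sample vector.\<close>

lemma (in prob_space) integral_finite_range:
  fixes f :: "'b \<Rightarrow> 'c::{banach, second_countable_topology}"
  assumes F: "finite F" and [measurable]: "\<And>x. x \<in> F \<Longrightarrow> {\<omega> \<in> space M. X \<omega> = x} \<in> events"
    and 1: "(\<Sum>x\<in>F. prob {\<omega> \<in> space M. X \<omega> = x}) = 1"
    and [measurable]: "(\<lambda>\<omega>. f (X \<omega>)) \<in> borel_measurable M"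
  shows "(\<integral>\<omega>. f (X \<omega>) \<partial>M) = (\<Sum>x\<in>F. prob {\<omega> \<in> space M. X \<omega> = x} *\<^sub>R f x)"
proof -
  let ?A = "\<lambda>x. {\<omega> \<in> space M. X \<omega> = x}"
  have "prob (\<Union>x\<in>F. ?A x) = 1"
    using F 1 by (subst finite_measure_finite_Union) (auto simp: disjoint_family_on_def)
  then have "AE \<omega> in M. \<omega> \<in> (\<Union>x\<in>F. ?A x)" by (rule AE_prob_1)
  then have "AE \<omega> in M. f (X \<omega>) = (\<Sum>x\<in>F. indicator (?A x) \<omega> *\<^sub>R f x)"
  proof eventually_elim
    case (elim \<omega>)
    then have "(\<Sum>x\<in>F. indicator (?A x) \<omega> *\<^sub>R f x) = (\<Sum>x\<in>F. if x = X \<omega> then f x else 0)"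
      by (intro sum.cong) auto
    then show ?case using elim F by auto
  qed
  then have "(\<integral>\<omega>. f (X \<omega>) \<partial>M) = (\<integral>\<omega>. (\<Sum>x\<in>F. indicator (?A x) \<omega> *\<^sub>R f x) \<partial>M)"
    by (intro integral_cong_AE) auto
  also have "\<dots> = (\<Sum>x\<in>F. prob (?A x) *\<^sub>R f x)"
    by (subst Bochner_Integration.integral_sum) (auto simp: less_top[symmetric])
  finally show ?thesis .
qed

text \<open>A history reveals its past as its tail, so only \<open>h' = h\<close> contributes to the
  bind.\<close>

lemma pmf_hist_pmf_Cons:
  "pmf (hist_pmf (Suc n)) (v # h) = pmf (hist_pmf n) h * pmf (pmf_of_set (hist_tree h)) v"
proof -
  have "pmf (map_pmf (\<lambda>v. v # h') (pmf_of_set (hist_tree h'))) (v # h)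
      = indicator {h} h' * pmf (pmf_of_set (hist_tree h)) v" for h'
  proof (cases "h' = h")
    case True
    then show ?thesis
      using pmf_map_inj'[of "\<lambda>v. v # h" "pmf_of_set (hist_tree h)" v] by (simp add: inj_def)
  next
    case False
    then have "v # h \<notin> set_pmf (map_pmf (\<lambda>v. v # h') (pmf_of_set (hist_tree h')))" by auto
    then have "pmf (map_pmf (\<lambda>v. v # h') (pmf_of_set (hist_tree h'))) (v # h) = 0"
      unfolding pmf_eq_0_set_pmf .
    then show ?thesis using False by simp
  qed
  then show ?thesis
    unfolding hist_pmf.simps map_pmf_def[symmetric] by (simp add: pmf_bind measure_pmf_single)
qed

section \<open>The law of the history in the given process\<close>

context doubling_recursive_tree
begin

primrec history :: "nat \<Rightarrow> 'a \<Rightarrow> node list" where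
  "history 0 \<omega> = []"
| "history (Suc n) \<omega> = \<nu> n \<omega> # history n \<omega>"

lemma tau_history: "\<omega> \<in> space M \<Longrightarrow> \<tau> n \<omega> = hist_tree (history n \<omega>)"
  by (induction n) (auto simp: tau_0 tau_Suc)

lemma history_eq_iff: "history n \<omega> = history n \<omega>' \<longleftrightarrow> (\<forall>i<n. \<nu> i \<omega> = \<nu> i \<omega>')"
  by (induction n) (auto simp: less_Suc_eq)

text \<open>Node lists form a countable type, so single histories suffice.\<close>

lemma history_measurable [measurable]: "history n \<in> measurable M (count_space UNIV)"
proof (induction n)
  case (Suc n)
  note [measurable] = Suc nu_measurable
  have "history (Suc n) -` {h} \<inter> space M \<in> events" for h
  proof (cases h)
    case (Cons v h')
    then have "history (Suc n) -` {h} \<inter> space M = {\<omega> \<in> space M. \<nu> n \<omega> = v \<and> history n \<omega> = h'}" by auto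
    also have "\<dots> \<in> events" by measurable
    finally show ?thesis .
  next
    case Nil
    then have "history (Suc n) -` {h} \<inter> space M = {}" by auto
    then show ?thesis by simp
  qed
  then show ?case by (subst measurable_count_space_eq2_countable) auto
qed (simp add: measurable_const[of "[]"] del: measurable_const)

text \<open>The assumption \<open>nu_uniform\<close> conditions on trees and nodes jointly. The
  nodes determine the trees, so that event is the same as \<open>history n \<omega> = h'\<close>,
  and a sample point with this history supplies the values to condition on. If the event is null,
  both sides vanish.\<close>

lemma prob_history: "prob {\<omega> \<in> space M. history n \<omega> = h} = pmf (hist_pmf n) h"
proof (induction n arbitrary: h)
  case 0
  then show ?case by (cases "h = []") (auto simp: prob_space)
next
  case (Suc n)
  show ?case
  proof (cases h)
    case Nil
    then have "h \<notin> set_pmf (hist_pmf (Suc n))" using length_hist_pmf by fastforce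
    then show ?thesis using Nil by (simp del: hist_pmf.simps add: pmf_eq_0_set_pmf)
  next
    case (Cons v h')
    note [measurable] = nu_measurable
    have eq: "{\<omega> \<in> space M. history (Suc n) \<omega> = h} = {\<omega> \<in> space M. \<nu> n \<omega> = v \<and> history n \<omega> = h'}"
      using Cons by auto
    show ?thesis
    proof (cases "prob {\<omega> \<in> space M. history n \<omega> = h'} = 0")
      case True
      have "prob {\<omega> \<in> space M. history (Suc n) \<omega> = h} \<le> prob {\<omega> \<in> space M. history n \<omega> = h'}"
        unfolding eq by (rule finite_measure_mono) auto
      then show ?thesis
        using True Suc[of h'] by (simp only: Cons pmf_hist_pmf_Cons) (simp add: measure_le_0_iff)
    next
      case False
      then have "{\<omega> \<in> space M. history n \<omega> = h'} \<noteq> {}" by (metis measure_empty)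
      then obtain \<omega>0 where \<omega>0: "\<omega>0 \<in> space M" "history n \<omega>0 = h'" by blast
      have hist_iff: "history n \<omega> = h' \<longleftrightarrow> (\<forall>i\<le>n. \<tau> i \<omega> = \<tau> i \<omega>0) \<and> (\<forall>i<n. \<nu> i \<omega> = \<nu> i \<omega>0)"
        if "\<omega> \<in> space M" for \<omega>
      proof -
        have "\<tau> i \<omega> = \<tau> i \<omega>0" if "\<forall>i<n. \<nu> i \<omega> = \<nu> i \<omega>0" "i \<le> n" for i
          using that \<open>\<omega> \<in> space M\<close> \<omega>0(1) history_eq_iff[of i \<omega> \<omega>0] by (simp add: tau_history)
        then show ?thesis using history_eq_iff[of n \<omega> \<omega>0] \<omega>0(2) by auto
      qed
      have past: "{\<omega> \<in> space M. (\<forall>i\<le>n. \<tau> i \<omega> = \<tau> i \<omega>0) \<and> (\<forall>i<n. \<nu> i \<omega> = \<nu> i \<omega>0)} = {\<omega> \<in> space M. history n \<omega> = h'}"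
        using hist_iff by blast
      have now: "{\<omega> \<in> space M. \<nu> n \<omega> = v \<and> (\<forall>i\<le>n. \<tau> i \<omega> = \<tau> i \<omega>0) \<and> (\<forall>i<n. \<nu> i \<omega> = \<nu> i \<omega>0)}
          = {\<omega> \<in> space M. \<nu> n \<omega> = v \<and> history n \<omega> = h'}"
        using hist_iff by blast
      have "prob {\<omega> \<in> space M. history n \<omega> = h'} > 0"
        using False measure_nonneg[of M] by (simp add: less_le)
      then have "prob {\<omega> \<in> space M. \<nu> n \<omega> = v \<and> history n \<omega> = h'} / prob {\<omega> \<in> space M. history n \<omega> = h'}
          = pmf (pmf_of_set (\<tau> n \<omega>0)) v"
        using nu_uniform[of n "\<lambda>i. \<tau> i \<omega>0" "\<lambda>i. \<nu> i \<omega>0" v] unfolding cond_prob_def past now by simp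
      then show ?thesis
        using False Suc[of h'] \<omega>0 unfolding eq Cons pmf_hist_pmf_Cons
        by (simp add: tau_history field_simps)
    qed
  qed
qed

lemma tau_event [measurable]: "{\<omega> \<in> space M. \<tau> n \<omega> = t} \<in> events"
proof -
  have "{\<omega> \<in> space M. \<tau> n \<omega> = t} = {\<omega> \<in> space M. history n \<omega> \<in> {h. hist_tree h = t}}"
    by (auto simp: tau_history)
  also have "\<dots> \<in> events" by measurable
  finally show ?thesis .
qed

text \<open>Trees form an uncountable type; the laws are therefore compared on histories, point by
  point, and then pushed forward by \<open>hist_tree\<close>.\<close>

lemma prob_tau: "prob {\<omega> \<in> space M. \<tau> n \<omega> = t} = pmf (map_pmf hist_tree (hist_pmf n)) t"
proof -
  have distr: "distr M (count_space UNIV) (history n) = measure_pmf (hist_pmf n)"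
  proof (rule measure_eqI_countable[of _ UNIV])
    fix h
    have "history n -` {h} \<inter> space M = {\<omega> \<in> space M. history n \<omega> = h}" by auto
    then show "emeasure (distr M (count_space UNIV) (history n)) {h} = emeasure (measure_pmf (hist_pmf n)) {h}"
      by (simp add: emeasure_distr emeasure_eq_measure prob_history emeasure_pmf_single)
  qed auto
  have "prob {\<omega> \<in> space M. \<tau> n \<omega> = t} = measure (distr M (count_space UNIV) (history n)) (hist_tree -` {t})"
    by (subst measure_distr) (auto simp: tau_history intro!: arg_cong[where f = prob])
  then show ?thesis unfolding distr by (simp add: pmf_map)
qed

end

section \<open>Conditional independence of the samples and their characteristic function\<close>

context sampled_doubling_recursive_tree
begin

text \<open>Independence holds only given the tree: the inner mean factorises into averages over one
  and the same tree, and the outer mean over the tree remains.\<close>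

lemma sample_product_integral:
  fixes \<phi> :: "nat \<Rightarrow> node \<Rightarrow> complex"
  assumes "1 \<le> k" "1 \<le> n"
  shows "(\<integral>\<omega>. (\<Prod>i=1..k. \<phi> i (u k n i \<omega>)) \<partial>M)
    = hist_exp n (\<lambda>h. \<Prod>i=1..k. (\<Sum>w\<in>hist_tree h. \<phi> i w) / of_real (tree_size h))"
proof -
  define tr where "tr = map_pmf hist_tree (hist_pmf n)"
  \<comment> \<open>Restriction to \<open>{1..k}\<close> turns equality of sample vectors into a
    condition on these coordinates alone, and leaves finitely many values of positive
    probability.\<close>
  define X where "X \<omega> = (\<tau> n \<omega>, \<lambda>i\<in>{1..k}. u k n i \<omega>)" for \<omega>
  define F where "F = Sigma (set_pmf tr) (\<lambda>t. PiE {1..k} (\<lambda>_. t))"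
  define f where "f x = (\<Prod>i=1..k. \<phi> i (snd x i))" for x :: "tree \<times> (nat \<Rightarrow> node)"
  have [measurable]: "u k n i \<in> measurable M (count_space UNIV)" if "i \<in> {1..k}" for i
    using u_measurable[OF assms that] .
  have tree: "finite t \<and> t \<noteq> {}" if "t \<in> set_pmf tr" for t
    using that by (auto simp: tr_def)
  have fin_tr: "finite (set_pmf tr)" by (simp add: tr_def)
  have fin: "finite F"
    unfolding F_def using fin_tr tree by (intro finite_SigmaI finite_PiE) auto
  have X_eq: "{\<omega> \<in> space M. X \<omega> = (t, w)} = {\<omega> \<in> space M. (\<forall>i\<in>{1..k}. u k n i \<omega> = w i) \<and> \<tau> n \<omega> = t}"
    if "w \<in> PiE {1..k} (\<lambda>_. t)" for t w
    using that by (auto simp: X_def restrict_def fun_eq_iff PiE_def extensional_def)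
  have ev: "{\<omega> \<in> space M. X \<omega> = x} \<in> events" if x: "x \<in> F" for x
  proof -
    obtain t w where tw: "x = (t, w)" by (cases x)
    with x have "w \<in> PiE {1..k} (\<lambda>_. t)" by (auto simp: F_def)
    note X_eq[OF this]
    moreover have "{\<omega> \<in> space M. (\<forall>i\<in>{1..k}. u k n i \<omega> = w i) \<and> \<tau> n \<omega> = t} \<in> events"
      by (intro sets.sets_Collect_conj sets.sets_Collect_finite_All' tau_event) (use assms in auto)
    ultimately show ?thesis using tw by simp
  qed
  have pr: "prob {\<omega> \<in> space M. X \<omega> = (t, w)} = pmf tr t * (\<Prod>i=1..k. 1 / real (card t))"
    if t: "t \<in> set_pmf tr" and w: "w \<in> PiE {1..k} (\<lambda>_. t)" for t w
  proof -
    have pos: "prob {\<omega> \<in> space M. \<tau> n \<omega> = t} > 0"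
      using t unfolding prob_tau tr_def[symmetric] by (rule pmf_positive)
    have "prob {\<omega> \<in> space M. (\<forall>i\<in>{1..k}. u k n i \<omega> = w i) \<and> \<tau> n \<omega> = t} / prob {\<omega> \<in> space M. \<tau> n \<omega> = t}
        = (\<Prod>i=1..k. pmf (pmf_of_set t) (w i))"
      using u_uniform[OF assms pos, of w] by (simp add: cond_prob_def)
    also have "\<dots> = (\<Prod>i=1..k. 1 / real (card t))"
      using tree[OF t] w by (intro prod.cong) (auto simp: PiE_def Pi_def)
    finally show ?thesis
      using pos unfolding X_eq[OF w] by (simp add: prob_tau tr_def field_simps)
  qed
  have total: "(\<Sum>x\<in>F. prob {\<omega> \<in> space M. X \<omega> = x} *\<^sub>R g (snd x))
      = (\<Sum>t\<in>set_pmf tr. pmf tr t *\<^sub>R (\<Sum>w\<in>PiE {1..k} (\<lambda>_. t). (\<Prod>i=1..k. 1 / real (card t)) *\<^sub>R g w))"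
    for g :: "(nat \<Rightarrow> node) \<Rightarrow> complex"
  proof -
    have "(\<Sum>x\<in>F. prob {\<omega> \<in> space M. X \<omega> = x} *\<^sub>R g (snd x))
        = (\<Sum>t\<in>set_pmf tr. \<Sum>w\<in>PiE {1..k} (\<lambda>_. t). prob {\<omega> \<in> space M. X \<omega> = (t, w)} *\<^sub>R g w)"
      unfolding F_def using fin_tr tree by (subst sum.Sigma) (auto intro!: finite_PiE simp: case_prod_beta)
    also have "\<dots> = (\<Sum>t\<in>set_pmf tr. pmf tr t *\<^sub>R (\<Sum>w\<in>PiE {1..k} (\<lambda>_. t). (\<Prod>i=1..k. 1 / real (card t)) *\<^sub>R g w))"
      by (intro sum.cong refl) (simp add: pr scaleR_sum_right)
    finally show ?thesis .
  qed
  have product: "(\<Sum>w\<in>PiE {1..k} (\<lambda>_. t). (\<Prod>i=1..k. 1 / real (card t)) *\<^sub>R (\<Prod>i=1..k. \<psi> i (w i)))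
      = (\<Prod>i=1..k. (\<Sum>v\<in>t. \<psi> i v) / of_real (real (card t)))"
    if "t \<in> set_pmf tr" for t and \<psi> :: "nat \<Rightarrow> node \<Rightarrow> complex"
  proof -
    have "(\<Prod>i=1..k. (\<Sum>v\<in>t. \<psi> i v) / of_real (real (card t))) = (\<Prod>i=1..k. \<Sum>v\<in>t. (1 / real (card t)) *\<^sub>R \<psi> i v)"
      by (simp add: sum_divide_distrib scaleR_conv_of_real)
    also have "\<dots> = (\<Sum>w\<in>PiE {1..k} (\<lambda>_. t). \<Prod>i=1..k. (1 / real (card t)) *\<^sub>R \<psi> i (w i))"
      using tree[OF that] by (intro prod_sum_PiE) auto
    also have "\<dots> = (\<Sum>w\<in>PiE {1..k} (\<lambda>_. t). (\<Prod>i=1..k. 1 / real (card t)) *\<^sub>R (\<Prod>i=1..k. \<psi> i (w i)))"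
      by (simp only: scaleR_conv_of_real of_real_prod prod.distrib)
    finally show ?thesis by simp
  qed
  \<comment> \<open>With all factors equal to 1, the same computation shows that \<open>F\<close>
    carries the full mass.\<close>
  have "complex_of_real (\<Sum>x\<in>F. prob {\<omega> \<in> space M. X \<omega> = x}) = (\<Sum>x\<in>F. prob {\<omega> \<in> space M. X \<omega> = x} *\<^sub>R (\<Prod>i=1..k. 1))"
    by (simp add: scaleR_conv_of_real)
  also have "\<dots> = (\<Sum>t\<in>set_pmf tr. pmf tr t *\<^sub>R (\<Prod>i=1..k. (\<Sum>v\<in>t. 1) / of_real (real (card t))))"
    unfolding total[of "\<lambda>_. \<Prod>i=1..k. 1"] by (intro sum.cong refl) (simp only: product[of _ "\<lambda>_ _. 1"])
  also have "\<dots> = (\<Sum>t\<in>set_pmf tr. pmf tr t *\<^sub>R 1)"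
    using tree by (intro sum.cong refl) (simp add: card_gt_0_iff)
  also have "\<dots> = complex_of_real (\<Sum>t\<in>set_pmf tr. pmf tr t)"
    by (simp add: scaleR_conv_of_real)
  also have "(\<Sum>t\<in>set_pmf tr. pmf tr t) = 1"
    using fin_tr by (rule sum_pmf_eq_1) simp
  finally have one: "(\<Sum>x\<in>F. prob {\<omega> \<in> space M. X \<omega> = x}) = 1"
    by (simp only: of_real_eq_iff)
  have f_X: "f (X \<omega>) = (\<Prod>i=1..k. \<phi> i (u k n i \<omega>))" for \<omega>
    by (simp add: f_def X_def)
  have "(\<lambda>\<omega>. \<phi> i (u k n i \<omega>)) \<in> borel_measurable M" if "i \<in> {1..k}" for i
    by (rule measurable_compose[OF u_measurable[OF assms that]]) simp
  then have "(\<lambda>\<omega>. \<Prod>i=1..k. \<phi> i (u k n i \<omega>)) \<in> borel_measurable M"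
    by (rule borel_measurable_prod)
  then have meas: "(\<lambda>\<omega>. f (X \<omega>)) \<in> borel_measurable M" by (simp add: f_X)
  have "(\<integral>\<omega>. (\<Prod>i=1..k. \<phi> i (u k n i \<omega>)) \<partial>M) = (\<Sum>x\<in>F. prob {\<omega> \<in> space M. X \<omega> = x} *\<^sub>R f x)"
    using integral_finite_range[OF fin ev one meas] by (simp add: f_X)
  also have "\<dots> = (\<Sum>t\<in>set_pmf tr. pmf tr t *\<^sub>R (\<Prod>i=1..k. (\<Sum>v\<in>t. \<phi> i v) / of_real (real (card t))))"
    unfolding f_def total[of "\<lambda>w. \<Prod>i=1..k. \<phi> i (w i)"] by (intro sum.cong refl) (simp only: product)
  also have "\<dots> = measure_pmf.expectation tr (\<lambda>t. \<Prod>i=1..k. (\<Sum>v\<in>t. \<phi> i v) / of_real (real (card t)))"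
    using fin_tr by (subst integral_measure_pmf[of "set_pmf tr"]) auto
  also have "\<dots> = hist_exp n (\<lambda>h. \<Prod>i=1..k. (\<Sum>w\<in>hist_tree h. \<phi> i w) / of_real (tree_size h))"
    by (simp add: tr_def tree_size_def)
  finally show ?thesis .
qed

text \<open>After centring and scaling, each character is a power
  \<open>z j ^ length (u k n j \<omega>)\<close> times a constant phase, so the product formula
  produces \<open>height_gf\<close>. The identity is needed only once \<open>log_scale n\<close> is
  positive.\<close>

lemma sample_char_tendsto:
  assumes k: "1 \<le> k"
  shows "(\<lambda>n. \<integral>\<omega>. iexp (\<Sum>j=1..k. \<theta> j * ((real (length (u k n j \<omega>)) - 2 * log_scale n) / sqrt (log_scale n))) \<partial>M)
    \<longlonglongrightarrow> of_real (exp (- (doubling_coeff * (\<Sum>j=1..k. \<theta> j))\<^sup>2 / 2 - (\<Sum>j=1..k. (\<theta> j)\<^sup>2) / 2))"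
proof (rule Lim_transform_eventually[OF prod_height_gf_tendsto])
  show "eventually (\<lambda>n. hist_exp n (\<lambda>h. \<Prod>j=1..k. height_gf (exp (\<i> * of_real (\<theta> j / sqrt (log_scale n)))) h
            * exp (- \<i> * of_real (2 * \<theta> j * sqrt (log_scale n))))
      = (\<integral>\<omega>. iexp (\<Sum>j=1..k. \<theta> j * ((real (length (u k n j \<omega>)) - 2 * log_scale n) / sqrt (log_scale n))) \<partial>M)) sequentially"
    using log_scale_ge_1
  proof eventually_elim
    case (elim n)
    define L where "L = sqrt (log_scale n)"
    have L: "L > 0" "log_scale n = L\<^sup>2" using elim by (auto simp: L_def)
    define z where "z j = exp (\<i> * of_real (\<theta> j / L))" for j
    define c where "c j = exp (- \<i> * of_real (2 * \<theta> j * L))" for j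
    have factor: "iexp (\<theta> j * ((real m - 2 * log_scale n) / L)) = z j ^ m * c j" for j m
    proof -
      have "\<theta> j * ((real m - 2 * log_scale n) / L) = real m * (\<theta> j / L) - 2 * \<theta> j * L"
        using L by (simp add: field_simps power2_eq_square)
      then have "iexp (\<theta> j * ((real m - 2 * log_scale n) / L))
          = exp (of_nat m * (\<i> * of_real (\<theta> j / L)) + - \<i> * of_real (2 * \<theta> j * L))"
        by (simp only:) (simp add: algebra_simps)
      then show ?thesis by (simp only: exp_add exp_of_nat_mult z_def c_def)
    qed
    have "(\<integral>\<omega>. iexp (\<Sum>j=1..k. \<theta> j * ((real (length (u k n j \<omega>)) - 2 * log_scale n) / L)) \<partial>M)
        = (\<integral>\<omega>. (\<Prod>j=1..k. z j ^ length (u k n j \<omega>) * c j) \<partial>M)"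
      unfolding of_real_sum sum_distrib_left exp_sum[OF finite_atLeastAtMost] factor ..
    also have "\<dots> = hist_exp n (\<lambda>h. \<Prod>j=1..k. (\<Sum>w\<in>hist_tree h. z j ^ length w * c j) / of_real (tree_size h))"
      using k elim by (intro sample_product_integral) auto
    also have "\<dots> = hist_exp n (\<lambda>h. \<Prod>j=1..k. height_gf (z j) h * c j)"
      by (simp add: height_gf_def sum_distrib_right[symmetric])
    finally show ?case by (simp add: z_def c_def L_def)
  qed
qed simp

end

section \<open>The Gaussian limit space\<close>

text \<open>Coordinate 0 will drive \<open>V\<close>, and coordinate \<open>i \<ge> 1\<close> will
  be \<open>W i\<close>.\<close>

definition gaussian_space :: "(nat \<Rightarrow> real) measure" where
  "gaussian_space = PiM UNIV (\<lambda>_. std_normal_distribution)"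

lemma prob_space_std_normal: "prob_space std_normal_distribution"
  using real_dist_normal_dist by (simp add: real_distribution_def)

lemma prob_space_gaussian: "prob_space gaussian_space"
  unfolding gaussian_space_def by (intro prob_space_PiM prob_space_std_normal)

lemma measurable_gaussian_component [measurable]: "(\<lambda>\<omega>. \<omega> i) \<in> borel_measurable gaussian_space"
  unfolding gaussian_space_def
  using measurable_component_singleton[of i UNIV "\<lambda>_. std_normal_distribution"]
  by (simp cong: measurable_cong_sets)

lemma distr_gaussian_component: "distr gaussian_space borel (\<lambda>\<omega>. \<omega> i) = std_normal_distribution"
proof -
  have "distr gaussian_space borel (\<lambda>\<omega>. \<omega> i) = distr gaussian_space std_normal_distribution (\<lambda>\<omega>. \<omega> i)"
    by (rule distr_cong) auto
  then show ?thesis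
    unfolding gaussian_space_def
    using distr_PiM_component[of UNIV "\<lambda>_. std_normal_distribution" i] prob_space_std_normal by simp
qed

lemma indep_gaussian_components: "prob_space.indep_vars gaussian_space (\<lambda>_. borel) (\<lambda>i \<omega>. \<omega> i) UNIV"
proof -
  interpret prob_space gaussian_space by (rule prob_space_gaussian)
  have sets: "sets (PiM UNIV (\<lambda>_::nat. borel)) = sets gaussian_space"
    unfolding gaussian_space_def by (intro sets_PiM_cong) auto
  show ?thesis
    by (subst indep_vars_iff_distr_eq_PiM)
      (simp_all add: distr_gaussian_component restrict_UNIV gaussian_space_def[symmetric] distr_id2[OF sets])
qed

lemma gaussian_char:
  fixes c :: "nat \<Rightarrow> real"
  assumes "finite I" "I \<noteq> {}"
  shows "(\<integral>\<omega>. (\<Prod>i\<in>I. iexp (c i * \<omega> i)) \<partial>gaussian_space) = of_real (exp (- (\<Sum>i\<in>I. (c i)\<^sup>2) / 2))"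
proof -
  interpret prob_space gaussian_space by (rule prob_space_gaussian)
  have ind: "indep_vars (\<lambda>_. borel) (\<lambda>i \<omega>. iexp (c i * \<omega> i)) I"
    by (rule indep_vars_compose2[OF indep_vars_subset[OF indep_gaussian_components]]) auto
  have "(\<integral>\<omega>. iexp (c i * \<omega> i) \<partial>gaussian_space) = char std_normal_distribution (c i)" for i
    unfolding char_def distr_gaussian_component[of i, symmetric]
    by (subst integral_distr) auto
  then have char: "(\<integral>\<omega>. iexp (c i * \<omega> i) \<partial>gaussian_space) = of_real (exp (- ((c i)\<^sup>2) / 2))" for i
    by (simp add: char_std_normal_distribution)
  have "(\<integral>\<omega>. (\<Prod>i\<in>I. iexp (c i * \<omega> i)) \<partial>gaussian_space) = (\<Prod>i\<in>I. \<integral>\<omega>. iexp (c i * \<omega> i) \<partial>gaussian_space)"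
    by (rule indep_vars_lebesgue_integral[OF assms(1) ind])
      (rule integrable_const_bound[where B = 1], auto)
  also have "\<dots> = of_real (exp (\<Sum>i\<in>I. - ((c i)\<^sup>2) / 2))"
    unfolding char exp_sum[OF assms(1)] by simp
  finally show ?thesis by (simp add: sum_negf sum_divide_distrib)
qed

theorem theorem1p4:
  fixes M :: "'a measure"
    and \<tau> :: "nat \<Rightarrow> 'a \<Rightarrow> tree"
    and \<nu> :: "nat \<Rightarrow> 'a \<Rightarrow> node"
    and u :: "nat \<Rightarrow> nat \<Rightarrow> nat \<Rightarrow> 'a \<Rightarrow> node"
  assumes "sampled_doubling_recursive_tree M \<tau> \<nu> u"
  shows "\<exists>(N :: (nat \<Rightarrow> real) measure) (V :: (nat \<Rightarrow> real) \<Rightarrow> real)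
            (W :: nat \<Rightarrow> (nat \<Rightarrow> real) \<Rightarrow> real).
     prob_space N \<and>
     prob_space.indep_vars N (\<lambda>_. borel) (\<lambda>i. if i = 0 then V else W i) (UNIV :: nat set) \<and>
     (\<forall>i\<ge>1. distributed N lborel (W i) std_normal_density) \<and>
     (\<forall>k\<ge>1. converges_in_distribution {1..k}
        M (\<lambda>n \<omega>. \<lambda>i\<in>{1..k}.
             (real (length (u k n i \<omega>)) - 2 * ln (real n) / (1 + ln 2))
               / sqrt (ln (real n) / (1 + ln 2)))
        N (\<lambda>\<omega>. \<lambda>i\<in>{1..k}. V \<omega> + W i \<omega>))"
proof -
  interpret sampled_doubling_recursive_tree M \<tau> \<nu> u by fact
  define V where "V \<omega> = doubling_coeff * \<omega> 0" for \<omega> :: "nat \<Rightarrow> real"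
  define W where "W i \<omega> = \<omega> i" for i and \<omega> :: "nat \<Rightarrow> real"
  interpret G: prob_space gaussian_space by (rule prob_space_gaussian)
  have indep: "G.indep_vars (\<lambda>_. borel) (\<lambda>i. if i = 0 then V else W i) UNIV"
  proof -
    have "G.indep_vars (\<lambda>_. borel) (\<lambda>i \<omega>. (if i = 0 then doubling_coeff * \<omega> i else \<omega> i)) UNIV"
      by (rule G.indep_vars_compose2[OF indep_gaussian_components, where Y = "\<lambda>i x. if i = 0 then doubling_coeff * x else x"]) auto
    moreover have "(\<lambda>i \<omega>. (if i = 0 then doubling_coeff * \<omega> i else \<omega> i)) = (\<lambda>i. if i = 0 then V else W i)"
      by (auto simp: V_def W_def fun_eq_iff)
    ultimately show ?thesis by simp
  qed
  have normal: "distributed gaussian_space lborel (W i) std_normal_density" for i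
  proof -
    have "distr gaussian_space lborel (W i) = distr gaussian_space borel (\<lambda>\<omega>. \<omega> i)"
      by (rule distr_cong) (auto simp: W_def)
    then show ?thesis
      by (auto simp: distributed_def distr_gaussian_component W_def[abs_def])
  qed
  have conv: "converges_in_distribution {1..k}
        M (\<lambda>n \<omega>. \<lambda>i\<in>{1..k}.
             (real (length (u k n i \<omega>)) - 2 * ln (real n) / (1 + ln 2))
               / sqrt (ln (real n) / (1 + ln 2)))
        gaussian_space (\<lambda>\<omega>. \<lambda>i\<in>{1..k}. V \<omega> + W i \<omega>)" if k: "1 \<le> k" for k
    unfolding converges_in_distribution_def
  proof (intro allI impI)
    fix f :: "(nat \<Rightarrow> real) \<Rightarrow> real"
    assume cont: "continuous_map (product_topology (\<lambda>_. euclideanreal) {1..k}) euclideanreal f"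
      and bdd: "bounded (f ` ({1..k} \<rightarrow>\<^sub>E UNIV))"
    \<comment> \<open>\<open>f\<close> is continuous only on the extensional carrier; composing it
      with restriction gives a continuous function on the whole space that depends only on the
      coordinates in \<open>{1..k}\<close>.\<close>
    define F where "F x = f (restrict x {1..k})" for x
    have "continuous_map (product_topology (\<lambda>_. euclideanreal) UNIV) (product_topology (\<lambda>_. euclideanreal) {1..k})
        (\<lambda>x. restrict x {1..k})"
      unfolding continuous_map_componentwise
      by (auto intro: continuous_map_product_projection)
    from continuous_map_compose[OF this cont]
    have F_cont: "continuous_on UNIV F"
      by (simp add: euclidean_product_topology F_def[abs_def] o_def)
    obtain C where "\<And>y. y \<in> f ` ({1..k} \<rightarrow>\<^sub>E UNIV) \<Longrightarrow> norm y \<le> C"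
      using bdd unfolding bounded_iff by blast
    then have F_bdd: "\<bar>F x\<bar> \<le> C" for x by (simp add: F_def)
    \<comment> \<open>The default 0 covers \<open>n = 0\<close> and indices outside
      \<open>{1..k}\<close>, where measurability of \<open>u\<close> is not assumed; the limit is
      unaffected.\<close>
    define X where "X n \<omega> j = (if 1 \<le> n \<and> j \<in> {1..k}
        then (real (length (u k n j \<omega>)) - 2 * log_scale n) / sqrt (log_scale n) else 0)" for n \<omega> j
    have X_meas: "(\<lambda>\<omega>. X n \<omega> j) \<in> borel_measurable M" for n j
    proof (cases "1 \<le> n \<and> j \<in> {1..k}")
      case True
      then have "(\<lambda>\<omega>. (real (length (u k n j \<omega>)) - 2 * log_scale n) / sqrt (log_scale n)) \<in> borel_measurable M"
        using k by (intro measurable_compose[OF u_measurable[of k n j]]) auto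
      then show ?thesis using True by (simp add: X_def)
    next
      case False
      then have "(\<lambda>\<omega>. X n \<omega> j) = (\<lambda>_. 0)" by (simp only: X_def if_False)
      then show ?thesis by simp
    qed
    have char: "(\<integral>\<omega>. iexp (\<Sum>j=1..k. \<theta> j * (V \<omega> + W j \<omega>)) \<partial>gaussian_space)
        = of_real (exp (- (doubling_coeff * (\<Sum>j=1..k. \<theta> j))\<^sup>2 / 2 - (\<Sum>j=1..k. (\<theta> j)\<^sup>2) / 2))" for \<theta>
    proof -
      \<comment> \<open>All summands share coordinate 0 through \<open>V\<close>, so its coefficient
        is \<open>doubling_coeff\<close> times the sum of the \<open>\<theta> j\<close>. As 0 is not
        in \<open>{1..k}\<close>, the other coefficients are unchanged.\<close>
      define c where "c = \<theta>(0 := doubling_coeff * (\<Sum>j=1..k. \<theta> j))"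
      have c: "(\<Sum>j=1..k. g j (c j)) = (\<Sum>j=1..k. g j (\<theta> j))" for g :: "nat \<Rightarrow> real \<Rightarrow> real"
        by (intro sum.cong) (auto simp: c_def)
      have "(\<Sum>j=1..k. \<theta> j * (V \<omega> + W j \<omega>)) = (\<Sum>i\<in>insert 0 {1..k}. c i * \<omega> i)" for \<omega>
        using c[of "\<lambda>j x. x * \<omega> j"]
        by (simp add: V_def W_def c_def distrib_left sum.distrib sum_distrib_left sum_distrib_right mult_ac)
      then have "iexp (\<Sum>j=1..k. \<theta> j * (V \<omega> + W j \<omega>)) = (\<Prod>i\<in>insert 0 {1..k}. iexp (c i * \<omega> i))" for \<omega>
        by (subst exp_sum[symmetric]) (simp_all only: of_real_sum sum_distrib_left finite_insert finite_atLeastAtMost)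
      then have "(\<integral>\<omega>. iexp (\<Sum>j=1..k. \<theta> j * (V \<omega> + W j \<omega>)) \<partial>gaussian_space)
          = of_real (exp (- (\<Sum>i\<in>insert 0 {1..k}. (c i)\<^sup>2) / 2))"
        by (simp only:) (rule gaussian_char; simp)
      also have "(\<Sum>i\<in>insert 0 {1..k}. (c i)\<^sup>2) = (doubling_coeff * (\<Sum>j=1..k. \<theta> j))\<^sup>2 + (\<Sum>j=1..k. (\<theta> j)\<^sup>2)"
        using c[of "\<lambda>j x. x\<^sup>2"] by (simp add: c_def)
      finally show ?thesis by (simp add: add_divide_distrib)
    qed
    have "(\<lambda>n. \<integral>\<omega>. F (X n \<omega>) \<partial>M) \<longlonglongrightarrow> (\<integral>\<omega>. F (\<lambda>j. V \<omega> + W j \<omega>) \<partial>gaussian_space)"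
    proof (rule multivariate_levy_continuity[OF prob_space_axioms prob_space_gaussian,
          where X = X and X' = "\<lambda>\<omega> j. V \<omega> + W j \<omega>" and f = F and J = "{1..k}" and C = C])
      fix \<theta> :: "nat \<Rightarrow> real"
      have "eventually (\<lambda>n. (\<integral>\<omega>. iexp (\<Sum>j=1..k. \<theta> j * ((real (length (u k n j \<omega>)) - 2 * log_scale n) / sqrt (log_scale n))) \<partial>M)
          = (\<integral>\<omega>. iexp (\<Sum>j=1..k. \<theta> j * X n \<omega> j) \<partial>M)) sequentially"
        using eventually_ge_at_top[of 1]
      proof eventually_elim
        case (elim n)
        have "(\<Sum>j=1..k. \<theta> j * X n \<omega> j)
            = (\<Sum>j=1..k. \<theta> j * ((real (length (u k n j \<omega>)) - 2 * log_scale n) / sqrt (log_scale n)))" for \<omega>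
          using elim by (intro sum.cong) (auto simp: X_def)
        then show ?case by (simp only:)
      qed
      from Lim_transform_eventually[OF sample_char_tendsto[OF k] this]
      show "(\<lambda>n. \<integral>\<omega>. iexp (\<Sum>j=1..k. \<theta> j * X n \<omega> j) \<partial>M)
          \<longlonglongrightarrow> (\<integral>\<omega>. iexp (\<Sum>j=1..k. \<theta> j * (V \<omega> + W j \<omega>)) \<partial>gaussian_space)"
        unfolding char .
    qed (use k X_meas F_cont F_bdd in \<open>auto simp: V_def W_def F_def[abs_def]\<close>)
    moreover have "F (\<lambda>j. V \<omega> + W j \<omega>) = f (\<lambda>i\<in>{1..k}. V \<omega> + W i \<omega>)" for \<omega>
      by (simp add: F_def)
    moreover have "eventually (\<lambda>n. (\<integral>\<omega>. F (X n \<omega>) \<partial>M) = (\<integral>\<omega>. f (\<lambda>i\<in>{1..k}.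
             (real (length (u k n i \<omega>)) - 2 * ln (real n) / (1 + ln 2))
               / sqrt (ln (real n) / (1 + ln 2))) \<partial>M)) sequentially"
      using eventually_ge_at_top[of 1]
      by eventually_elim (simp add: F_def X_def log_scale_def cong: restrict_cong)
    ultimately show "(\<lambda>n. \<integral>\<omega>. f (\<lambda>i\<in>{1..k}.
             (real (length (u k n i \<omega>)) - 2 * ln (real n) / (1 + ln 2))
               / sqrt (ln (real n) / (1 + ln 2))) \<partial>M)
        \<longlonglongrightarrow> (\<integral>\<omega>. f (\<lambda>i\<in>{1..k}. V \<omega> + W i \<omega>) \<partial>gaussian_space)"
      by (simp only:) (erule Lim_transform_eventually)
  qed
  show ?thesis
    using prob_space_gaussian indep normal conv by blast
qed

end
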